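(* Let $(M,g)$ be a Hermitian manifold. If $(\square_{BC})_0$ or $(\square_A)_0$ is essentially self-adjoint, then $$\partial\bar\partial_s=\partial\bar\partial_w,\qquad \bar\partial^*\partial^*_s=\bar\partial^*\partial^*_w$$ (equality of unbounded operators, including domains).
   Context: A Hermitian manifold $(M,g)$ is a complex manifold (without boundary) with a Riemannian metric $g$ for which the complex structure is an isometry. $A^{\bullet,\bullet}=\bigoplus_{p,q}A^{p,q}$ denotes smooth forms, $A^{\bullet,\bullet}_0$ those with compact support, and $L^2\Lambda^{\bullet,\bullet}=\bigoplus_{p,q}L^2\Lambda^{p,q}$ the Hilbert space of square-integrable measurable forms. $\partial^*,\bar\partial^*$ are the $L^2$ formal adjoints of $\partial,\bar\partial$. Define on $A^{\bullet,\bullet}$ $$\square_{BC}=\partial\bar\partial\bar\partial^*\partial^*+(\partial^*\partial+\bar\partial^*\bar\partial)^2,\qquad \square_A=\bar\partial^*\partial^*\partial\bar\partial+(\partial\partial^*+\bar\partial\bar\partial^* )^2 .$$ For a differential operator $P$ (with formal adjoint $P^*$), $P_0$ is its restriction to smooth compactly supported sections, viewed as a densely defined operator between $L^2$ spaces. The strong extension $P_s$ is the closure of $P_0$. The weak extension $P_w$ is defined by: $u\in\mathcal D(P_w)$ and $P_wu=v$ iff $u,v$ are $L^2$ and $\langle v,w\rangle=\langle u,P^*w\rangle$ for all smooth compactly supported $w$. Notation: $\partial\bar\partial_a:=(\partial\bar\partial)_a$, $\bar\partial^*\partial^*_a:=(\bar\partial^*\partial^* )_a$ for $a\in\{s,w\}$,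 as operators on $L^2\Lambda^{\bullet,\bullet}$. An operator is essentially self-adjoint if it has a unique self-adjoint extension (equivalently, its closure is self-adjoint). *)

theory Defs
  imports "HOL-Analysis.Analysis"
begin

section \<open>Smooth and holomorphic maps\<close>

primrec C_diff_on :: "nat \<Rightarrow> 'a::real_normed_vector set \<Rightarrow> ('a \<Rightarrow> 'b::real_normed_vector) \<Rightarrow> bool" where
  "C_diff_on 0 S f \<longleftrightarrow> continuous_on S f"
| "C_diff_on (Suc k) S f \<longleftrightarrow>
     (\<forall>x\<in>S. f differentiable (at x)) \<and>
     (\<forall>v. C_diff_on k S (\<lambda>x. frechet_derivative f (at x) v))"

text \<open>Only used for open \<^term>\<open>S\<close> and a finite-dimensional domain.\<close>

definition smooth_on :: "'a::real_normed_vector set \<Rightarrow> ('a \<Rightarrow> 'b::real_normed_vector) \<Rightarrow> bool" where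
  "smooth_on S f \<longleftrightarrow> (\<forall>k. C_diff_on k S f)"

text \<open>Smoothness is automatic for complex differentiable maps on open sets, so requiring it
  does not restrict the class of holomorphic maps.\<close>

definition holomorphic_map_on :: "(complex^'n) set \<Rightarrow> (complex^'n \<Rightarrow> complex^'n) \<Rightarrow> bool" where
  "holomorphic_map_on S f \<longleftrightarrow> smooth_on S f \<and>
     (\<forall>x\<in>S. \<forall>c v. frechet_derivative f (at x) (c *s v) = c *s frechet_derivative f (at x) v)"


section \<open>Hermitian manifolds\<close>

text \<open>The underlying set of the manifold is the whole type \<open>'m\<close>; a chart is a pair of its
  domain and its coordinate map.\<close>

type_synonym ('m, 'n) chart = "'m set \<times> ('m \<Rightarrow> complex^'n)"

definition complex_atlas :: "('m::topological_space, 'n::finite) chart set \<Rightarrow> bool" where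
  "complex_atlas \<A> \<longleftrightarrow>
     (\<Union>(U, \<phi>)\<in>\<A>. U) = UNIV \<and>
     (\<forall>(U, \<phi>)\<in>\<A>. open U \<and> open (\<phi> ` U) \<and> homeomorphism U (\<phi> ` U) \<phi> (inv_into U \<phi>)) \<and>
     (\<forall>(U, \<phi>)\<in>\<A>. \<forall>(V, \<psi>)\<in>\<A>. holomorphic_map_on (\<phi> ` (U \<inter> V)) (\<psi> \<circ> inv_into U \<phi>))"

text \<open>One chart around each point is singled out, and the tangent space at \<open>p\<close> is identified
  with \<open>complex^'n\<close> by the differential at \<open>p\<close> of that chart. Since coordinate changes are
  holomorphic, the complex structure of the tangent space is multiplication by \<open>\<i>\<close>. The map
  \<open>tangent_coord \<A> (U, \<phi>) x\<close> sends a vector written in the chart \<open>(U, \<phi>)\<close> and based at the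
  point with coordinates \<open>x\<close> to the corresponding tangent vector.\<close>

definition chart_at :: "('m, 'n) chart set \<Rightarrow> 'm \<Rightarrow> ('m, 'n) chart" where
  "chart_at \<A> p = (SOME c. c \<in> \<A> \<and> p \<in> fst c)"

definition tangent_coord ::
  "('m, 'n::finite) chart set \<Rightarrow> ('m, 'n) chart \<Rightarrow> complex^'n \<Rightarrow> complex^'n \<Rightarrow> complex^'n" where
  "tangent_coord \<A> c x =
     (let \<theta> = inv_into (fst c) (snd c)
      in frechet_derivative (snd (chart_at \<A> (\<theta> x)) \<circ> \<theta>) (at x))"

type_synonym ('m, 'n) metric_tensor = "'m \<Rightarrow> complex^'n \<Rightarrow> complex^'n \<Rightarrow> real"

definition metric_rep ::
  "('m, 'n::finite) chart set \<Rightarrow> ('m, 'n) metric_tensor \<Rightarrow> ('m, 'n) chart \<Rightarrow>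
   complex^'n \<Rightarrow> complex^'n \<Rightarrow> complex^'n \<Rightarrow> real" where
  "metric_rep \<A> g c x v w =
     g (inv_into (fst c) (snd c) x) (tangent_coord \<A> c x v) (tangent_coord \<A> c x w)"

definition riemannian_metric ::
  "('m, 'n::finite) chart set \<Rightarrow> ('m, 'n) metric_tensor \<Rightarrow> bool" where
  "riemannian_metric \<A> g \<longleftrightarrow>
     (\<forall>p. bilinear (g p) \<and> (\<forall>v w. g p v w = g p w v) \<and> (\<forall>v. v \<noteq> 0 \<longrightarrow> g p v v > 0)) \<and>
     (\<forall>c\<in>\<A>. \<forall>v w. smooth_on (snd c ` fst c) (\<lambda>x. metric_rep \<A> g c x v w))"

definition hermitian_manifold ::
  "('m::{t2_space, second_countable_topology}, 'n::finite) chart set \<Rightarrow>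
   ('m, 'n) metric_tensor \<Rightarrow> bool" where
  "hermitian_manifold \<A> g \<longleftrightarrow>
     complex_atlas \<A> \<and> riemannian_metric \<A> g \<and>
     (\<forall>p v w. g p (\<i> *s v) (\<i> *s w) = g p v w)"

fun real_basis_vec :: "'n + 'n \<Rightarrow> complex^'n::finite" where
  "real_basis_vec (Inl k) = axis k 1"
| "real_basis_vec (Inr k) = axis k \<i>"

definition volume_density ::
  "('m, 'n::finite) chart set \<Rightarrow> ('m, 'n) metric_tensor \<Rightarrow> ('m, 'n) chart \<Rightarrow> complex^'n \<Rightarrow> real" where
  "volume_density \<A> g c x =
     sqrt (det ((\<chi> i j. metric_rep \<A> g c x (real_basis_vec i) (real_basis_vec j))
                  :: real^('n + 'n)^('n + 'n)))"

text \<open>Because the manifold is second countable, these local formulas determine the measure.\<close>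

definition riemannian_volume ::
  "('m::topological_space, 'n::finite) chart set \<Rightarrow> ('m, 'n) metric_tensor \<Rightarrow> 'm measure \<Rightarrow> bool" where
  "riemannian_volume \<A> g \<mu> \<longleftrightarrow> sets \<mu> = sets borel \<and>
     (\<forall>c\<in>\<A>. \<forall>S\<in>sets borel. S \<subseteq> fst c \<longrightarrow>
        emeasure \<mu> S =
          (\<integral>\<^sup>+x. ennreal (volume_density \<A> g c x) * indicator (snd c ` S) x \<partial>lborel))"


section \<open>Differential forms\<close>

text \<open>An element of the full exterior algebra of complex-valued forms on the (real) tangent
  space is a function on lists of tangent vectors: its values on lists of length \<open>k\<close> are its
  degree \<open>k\<close> component. Hence a form below is a form of mixed degree, i.e. an element of the
  direct sum of all bidegrees.\<close>

type_synonym ('m, 'n) form = "'m \<Rightarrow> (complex^'n) list \<Rightarrow> complex"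

definition alternating :: "((complex^'n::finite) list \<Rightarrow> complex) \<Rightarrow> bool" where
  "alternating \<alpha> \<longleftrightarrow>
     (\<forall>xs ys. linear (\<lambda>v. \<alpha> (xs @ v # ys))) \<and>
     (\<forall>xs v ys zs. \<alpha> (xs @ v # ys @ v # zs) = 0)"

definition form_rep ::
  "('m, 'n::finite) chart set \<Rightarrow> ('m, 'n) form \<Rightarrow> ('m, 'n) chart \<Rightarrow>
   complex^'n \<Rightarrow> (complex^'n) list \<Rightarrow> complex" where
  "form_rep \<A> u c x l = u (inv_into (fst c) (snd c) x) (map (tangent_coord \<A> c x) l)"

definition smooth_forms :: "('m, 'n::finite) chart set \<Rightarrow> ('m, 'n) form set" where
  "smooth_forms \<A> =
     {u. (\<forall>p. alternating (u p)) \<and>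
         (\<forall>c\<in>\<A>. \<forall>l. smooth_on (snd c ` fst c) (\<lambda>x. form_rep \<A> u c x l))}"

definition form_support :: "('m::topological_space, 'n) form \<Rightarrow> 'm set" where
  "form_support u = closure {p. \<exists>l. u p l \<noteq> 0}"

definition test_forms :: "('m::topological_space, 'n::finite) chart set \<Rightarrow> ('m, 'n) form set" where
  "test_forms \<A> = {u \<in> smooth_forms \<A>. compact (form_support u)}"

text \<open>Complex linear and antilinear parts of the differential of a function:
  \<open>\<partial>f\<close> and \<open>\<partial>\<close>-bar \<open>f\<close> evaluated at the vector \<open>v\<close>.\<close>

definition D10 :: "(complex^'n::finite \<Rightarrow> complex) \<Rightarrow> complex^'n \<Rightarrow> complex^'n \<Rightarrow> complex" where
  "D10 f x v = (frechet_derivative f (at x) v - \<i> * frechet_derivative f (at x) (\<i> *s v)) / 2"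

definition D01 :: "(complex^'n::finite \<Rightarrow> complex) \<Rightarrow> complex^'n \<Rightarrow> complex^'n \<Rightarrow> complex" where
  "D01 f x v = (frechet_derivative f (at x) v + \<i> * frechet_derivative f (at x) (\<i> *s v)) / 2"

definition remove_nth :: "nat \<Rightarrow> 'a list \<Rightarrow> 'a list" where
  "remove_nth i l = take i l @ drop (Suc i) l"

text \<open>In holomorphic coordinates \<open>\<partial>u = (\<Sum>j. dz\<^sub>j \<and> \<partial>u/\<partial>z\<^sub>j)\<close>, the derivative acting on the
  coefficients of \<open>u\<close> with respect to the \<open>dz\<^sub>I \<and> d\<close>z-bar\<open>\<^sub>J\<close>; evaluated on vectors this is
  the alternating sum below (the formula for the exterior derivative \<open>d\<close> with \<open>D\<close> replaced by
  its complex linear part), which is written in the distinguished chart at \<open>p\<close>.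
  Likewise for \<open>delbar\<close> with the complex antilinear part.\<close>

definition del :: "('m, 'n::finite) chart set \<Rightarrow> ('m, 'n) form \<Rightarrow> ('m, 'n) form" where
  "del \<A> u p l =
     (let c = chart_at \<A> p in
      \<Sum>i<length l. (-1) ^ i * D10 (\<lambda>x. form_rep \<A> u c x (remove_nth i l)) (snd c p) (l ! i))"

definition delbar :: "('m, 'n::finite) chart set \<Rightarrow> ('m, 'n) form \<Rightarrow> ('m, 'n) form" where
  "delbar \<A> u p l =
     (let c = chart_at \<A> p in
      \<Sum>i<length l. (-1) ^ i * D01 (\<lambda>x. form_rep \<A> u c x (remove_nth i l)) (snd c p) (l ! i))"


section \<open>Square-integrable forms\<close>

definition orthonormal_basis ::
  "(complex^'n \<Rightarrow> complex^'n \<Rightarrow> real) \<Rightarrow> (complex^'n::finite) set \<Rightarrow> bool" where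
  "orthonormal_basis h B \<longleftrightarrow> span B = UNIV \<and> (\<forall>v\<in>B. \<forall>w\<in>B. h v w = (if v = w then 1 else 0))"

text \<open>The Hermitian extension of the inner product on forms induced by a real inner product
  \<open>h\<close>: the wedge products of distinct elements of the dual of an orthonormal basis are
  orthonormal, and the factorial accounts for the orderings of a set of basis vectors. The
  value does not depend on the orthonormal basis \<open>B\<close>.\<close>

definition form_inner ::
  "(complex^'n \<Rightarrow> complex^'n \<Rightarrow> real) \<Rightarrow> ((complex^'n::finite) list \<Rightarrow> complex) \<Rightarrow>
   ((complex^'n) list \<Rightarrow> complex) \<Rightarrow> complex" where
  "form_inner h \<alpha> \<beta> =
     (let B = (SOME B. orthonormal_basis h B)
      in \<Sum>l | distinct l \<and> set l \<subseteq> B. \<alpha> l * cnj (\<beta> l) / fact (length l))"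

definition measurable_forms ::
  "('m::topological_space, 'n::finite) chart set \<Rightarrow> ('m, 'n) form set" where
  "measurable_forms \<A> =
     {u. (\<forall>p. alternating (u p)) \<and>
         (\<forall>c\<in>\<A>. \<forall>l. (\<lambda>p. form_rep \<A> u c (snd c p) l)
                        \<in> borel_measurable (restrict_space borel (fst c)))}"

text \<open>Elements of the Hilbert space are handled through representatives: \<open>L2_forms\<close> consists
  of forms rather than of almost-everywhere classes. Closures, adjoints and weak extensions
  below are saturated with respect to almost-everywhere equality in both components, so their
  equality as relations is the equality of the operators on classes, domains included.\<close>

definition L2_forms ::
  "('m::topological_space, 'n::finite) chart set \<Rightarrow> ('m, 'n) metric_tensor \<Rightarrow> 'm measure \<Rightarrow>
   ('m, 'n) form set" where
  "L2_forms \<A> g \<mu> =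
     {u \<in> measurable_forms \<A>. integrable \<mu> (\<lambda>p. form_inner (g p) (u p) (u p))}"

definition L2_inner ::
  "('m, 'n::finite) metric_tensor \<Rightarrow> 'm measure \<Rightarrow> ('m, 'n) form \<Rightarrow> ('m, 'n) form \<Rightarrow> complex" where
  "L2_inner g \<mu> u v = (LINT p|\<mu>. form_inner (g p) (u p) (v p))"

definition L2_dist ::
  "('m, 'n::finite) metric_tensor \<Rightarrow> 'm measure \<Rightarrow> ('m, 'n) form \<Rightarrow> ('m, 'n) form \<Rightarrow> real" where
  "L2_dist g \<mu> u v =
     (let w = (\<lambda>p l. u p l - v p l) in sqrt (Re (L2_inner g \<mu> w w)))"


section \<open>Unbounded operators, given by their graphs\<close>

type_synonym ('m, 'n) op_graph = "(('m, 'n) form \<times> ('m, 'n) form) set"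

definition graph_closure ::
  "('m::topological_space, 'n::finite) chart set \<Rightarrow> ('m, 'n) metric_tensor \<Rightarrow> 'm measure \<Rightarrow>
   ('m, 'n) op_graph \<Rightarrow> ('m, 'n) op_graph" where
  "graph_closure \<A> g \<mu> T =
     {(u, v). u \<in> L2_forms \<A> g \<mu> \<and> v \<in> L2_forms \<A> g \<mu> \<and>
        (\<forall>e>0. \<exists>(x, y)\<in>T. L2_dist g \<mu> x u < e \<and> L2_dist g \<mu> y v < e)}"

definition densely_defined ::
  "('m::topological_space, 'n::finite) chart set \<Rightarrow> ('m, 'n) metric_tensor \<Rightarrow> 'm measure \<Rightarrow>
   ('m, 'n) op_graph \<Rightarrow> bool" where
  "densely_defined \<A> g \<mu> T \<longleftrightarrow>
     (\<forall>u\<in>L2_forms \<A> g \<mu>. \<forall>e>0. \<exists>x\<in>Domain T. L2_dist g \<mu> x u < e)"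

definition graph_adjoint ::
  "('m::topological_space, 'n::finite) chart set \<Rightarrow> ('m, 'n) metric_tensor \<Rightarrow> 'm measure \<Rightarrow>
   ('m, 'n) op_graph \<Rightarrow> ('m, 'n) op_graph" where
  "graph_adjoint \<A> g \<mu> T =
     {(u, v). u \<in> L2_forms \<A> g \<mu> \<and> v \<in> L2_forms \<A> g \<mu> \<and>
        (\<forall>(x, y)\<in>T. L2_inner g \<mu> y u = L2_inner g \<mu> x v)}"

definition self_adjoint ::
  "('m::topological_space, 'n::finite) chart set \<Rightarrow> ('m, 'n) metric_tensor \<Rightarrow> 'm measure \<Rightarrow>
   ('m, 'n) op_graph \<Rightarrow> bool" where
  "self_adjoint \<A> g \<mu> T \<longleftrightarrow> densely_defined \<A> g \<mu> T \<and> graph_adjoint \<A> g \<mu> T = T"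

definition essentially_self_adjoint ::
  "('m::topological_space, 'n::finite) chart set \<Rightarrow> ('m, 'n) metric_tensor \<Rightarrow> 'm measure \<Rightarrow>
   ('m, 'n) op_graph \<Rightarrow> bool" where
  "essentially_self_adjoint \<A> g \<mu> T \<longleftrightarrow> self_adjoint \<A> g \<mu> (graph_closure \<A> g \<mu> T)"


section \<open>Operators on forms and their extensions\<close>

type_synonym ('m, 'n) form_op = "('m, 'n) form \<Rightarrow> ('m, 'n) form"

text \<open>By Peetre's theorem linear operators that do not increase supports are, locally, the
  differential operators.\<close>

definition local_operator :: "('m::topological_space, 'n::finite) chart set \<Rightarrow> ('m, 'n) form_op \<Rightarrow> bool" where
  "local_operator \<A> P \<longleftrightarrow>
     (\<forall>u\<in>smooth_forms \<A>. P u \<in> smooth_forms \<A> \<and> form_support (P u) \<subseteq> form_support u) \<and>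
     (\<forall>u\<in>smooth_forms \<A>. \<forall>v\<in>smooth_forms \<A>. \<forall>a b.
        P (\<lambda>p l. a * u p l + b * v p l) = (\<lambda>p l. a * P u p l + b * P v p l))"

text \<open>This determines \<open>Q\<close> uniquely on smooth forms.\<close>

definition formal_adjoint ::
  "('m::topological_space, 'n::finite) chart set \<Rightarrow> ('m, 'n) metric_tensor \<Rightarrow> 'm measure \<Rightarrow>
   ('m, 'n) form_op \<Rightarrow> ('m, 'n) form_op \<Rightarrow> bool" where
  "formal_adjoint \<A> g \<mu> P Q \<longleftrightarrow> local_operator \<A> Q \<and>
     (\<forall>u\<in>test_forms \<A>. \<forall>w\<in>test_forms \<A>. L2_inner g \<mu> (P u) w = L2_inner g \<mu> u (Q w))"

definition restrict0 ::
  "('m::topological_space, 'n::finite) chart set \<Rightarrow> ('m, 'n) form_op \<Rightarrow> ('m, 'n) op_graph" where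
  "restrict0 \<A> P = {(u, P u) | u. u \<in> test_forms \<A>}"

definition strong_ext ::
  "('m::topological_space, 'n::finite) chart set \<Rightarrow> ('m, 'n) metric_tensor \<Rightarrow> 'm measure \<Rightarrow>
   ('m, 'n) form_op \<Rightarrow> ('m, 'n) op_graph" where
  "strong_ext \<A> g \<mu> P = graph_closure \<A> g \<mu> (restrict0 \<A> P)"

definition weak_ext ::
  "('m::topological_space, 'n::finite) chart set \<Rightarrow> ('m, 'n) metric_tensor \<Rightarrow> 'm measure \<Rightarrow>
   ('m, 'n) form_op \<Rightarrow> ('m, 'n) op_graph" where
  "weak_ext \<A> g \<mu> P =
     {(u, v). u \<in> L2_forms \<A> g \<mu> \<and> v \<in> L2_forms \<A> g \<mu> \<and>
        (\<exists>Q. formal_adjoint \<A> g \<mu> P Q \<and>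
             (\<forall>w\<in>test_forms \<A>. L2_inner g \<mu> v w = L2_inner g \<mu> u (Q w)))}"

text \<open>In the next two definitions \<open>ds\<close> and \<open>dbs\<close> stand for the formal adjoints of
  \<open>del \<A>\<close> and \<open>delbar \<A>\<close>.\<close>

definition box_BC ::
  "('m, 'n::finite) chart set \<Rightarrow> ('m, 'n) form_op \<Rightarrow> ('m, 'n) form_op \<Rightarrow> ('m, 'n) form_op" where
  "box_BC \<A> ds dbs u =
     (let L = (\<lambda>v p l. ds (del \<A> v) p l + dbs (delbar \<A> v) p l)
      in (\<lambda>p l. del \<A> (delbar \<A> (dbs (ds u))) p l + L (L u) p l))"

definition box_A ::
  "('m, 'n::finite) chart set \<Rightarrow> ('m, 'n) form_op \<Rightarrow> ('m, 'n) form_op \<Rightarrow> ('m, 'n) form_op" where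
  "box_A \<A> ds dbs u =
     (let L = (\<lambda>v p l. del \<A> (ds v) p l + delbar \<A> (dbs v) p l)
      in (\<lambda>p l. dbs (ds (del \<A> (delbar \<A> u))) p l + L (L u) p l))"

end

theory Submission
  imports Defs "HOL-Library.Function_Algebras"
begin

text \<open>Let \<open>\<partial>\<close> and \<open>\<partial>'\<close> stand for \<^const>\<open>del\<close> and \<^const>\<open>delbar\<close>, let \<open>D = \<partial> \<partial>'\<close> with formal
  adjoint \<open>D\<^sup>t\<close>, and let \<open>B = D D\<^sup>t + L L\<close> be the Bott-Chern Laplacian, where
  \<open>L = \<partial>\<^sup>t \<partial> + \<partial>'\<^sup>t \<partial>'\<close>. A pair \<open>(u, v)\<close> in the weak graph of \<open>D\<^sup>t\<close> that is orthogonal to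
  the graph of \<open>D\<^sup>t\<close> over the test forms satisfies \<open>D v = - u\<close> weakly. Tested against \<open>L L w\<close>
  this gives \<open>\<langle>u, L L w\<rangle> = - \<langle>v, D\<^sup>t L L w\<rangle> = 0\<close>, because \<open>L D = 0\<close> and hence
  \<open>D\<^sup>t L = 0\<close> on test forms. Moreover
  \<open>\<langle>u, D D\<^sup>t w\<rangle> = \<langle>v, D\<^sup>t w\<rangle> = - \<langle>u, w\<rangle>\<close>. So \<open>u\<close> is in the domain of the adjoint of \<open>B\<close>,
  which sends it to \<open>- u\<close>. If \<open>B\<close> is essentially self-adjoint, then \<open>(u, - u)\<close> lies in the
  closure of the graph of \<open>B\<close>. As \<open>\<langle>B w, w\<rangle> \<ge> 0\<close> for all test forms, \<open>u = 0\<close>, and then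
  \<open>v = 0\<close> because test forms are dense. Orthogonal projection in the space of pairs of
  square-integrable forms turns this into the equality of the strong and the weak extension of
  \<open>D\<^sup>t\<close>, and taking adjoints transfers the equality to \<open>D\<close>. For the Aeppli Laplacian the roles
  of \<open>D\<close> and \<open>D\<^sup>t\<close> are exchanged. This argument is
  \<open>essentially_self_adjoint_imp_strong_eq_weak\<close>.

  Three facts about forms feed the argument. The operators \<open>\<partial>\<close> and \<open>\<partial>'\<close> are well-defined
  local operators that square to zero and anticommute (\<open>form_rep_dop\<close>, \<open>dop_anticommute\<close>);
  they are defined in a chart that depends on the point, so even the smoothness of \<open>\<partial>u\<close> rests
  on the invariance under holomorphic coordinate changes (\<open>dloc_pullback\<close>). Smooth forms with
  compact support are square-integrable (\<open>test_forms_L2\<close>). Finally the space of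
  square-integrable forms is complete (\<open>L2_complete\<close>), which the projection needs.\<close>

section \<open>Unbounded operators in a semi-Hilbert space\<close>

lemma sequence_null_comparison:
  fixes f :: "nat \<Rightarrow> 'b::real_normed_vector"
  assumes "\<And>n. norm (f n) \<le> h n" "h \<longlonglongrightarrow> 0"
  shows "f \<longlonglongrightarrow> 0"
  using assms by (intro Lim_null_comparison[of f h]) auto

text \<open>Square-integrable forms are representatives and not classes modulo null forms, so the
  inner product is only positive semidefinite, and the space is a subset \<open>V\<close> of a type of
  functions. The map \<open>sc\<close> is the multiplication by complex scalars.\<close>

locale semi_inner_product =
  fixes V :: "'a::ab_group_add set" and sc :: "complex \<Rightarrow> 'a \<Rightarrow> 'a"
    and ip :: "'a \<Rightarrow> 'a \<Rightarrow> complex"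
  assumes V_zero: "0 \<in> V"
    and V_add: "x \<in> V \<Longrightarrow> y \<in> V \<Longrightarrow> x + y \<in> V"
    and V_sc: "x \<in> V \<Longrightarrow> sc c x \<in> V"
    and sc_minus: "sc (-1) x = - x"
    and ip_add: "x \<in> V \<Longrightarrow> y \<in> V \<Longrightarrow> z \<in> V \<Longrightarrow> ip (x + y) z = ip x z + ip y z"
    and ip_sc: "x \<in> V \<Longrightarrow> z \<in> V \<Longrightarrow> ip (sc c x) z = c * ip x z"
    and ip_cnj: "x \<in> V \<Longrightarrow> y \<in> V \<Longrightarrow> ip y x = cnj (ip x y)"
    and ip_nonneg: "x \<in> V \<Longrightarrow> 0 \<le> Re (ip x x)"
begin

definition nrm :: "'a \<Rightarrow> real" where "nrm x = sqrt (Re (ip x x))"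

lemma V_minus: "x \<in> V \<Longrightarrow> - x \<in> V"
  using V_sc[of x "-1"] sc_minus by simp

lemma V_diff: "x \<in> V \<Longrightarrow> y \<in> V \<Longrightarrow> x - y \<in> V"
  using V_add[of x "-y"] V_minus[of y] by simp

lemma ip_minus: "x \<in> V \<Longrightarrow> z \<in> V \<Longrightarrow> ip (- x) z = - ip x z"
  using ip_sc[of x z "-1"] sc_minus by simp

lemma ip_diff: "x \<in> V \<Longrightarrow> y \<in> V \<Longrightarrow> z \<in> V \<Longrightarrow> ip (x - y) z = ip x z - ip y z"
  using ip_add[of x "-y" z] ip_minus[of y z] V_minus[of y] by simp

lemma ip_zero: "z \<in> V \<Longrightarrow> ip 0 z = 0"
  using ip_diff[of 0 0 z] V_zero by simp

lemma ip_add_right: "x \<in> V \<Longrightarrow> y \<in> V \<Longrightarrow> z \<in> V \<Longrightarrow> ip z (x + y) = ip z x + ip z y"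
  using ip_add[of x y z] ip_cnj[of _ z] V_add by (metis complex_cnj_add)

lemma ip_sc_right: "x \<in> V \<Longrightarrow> z \<in> V \<Longrightarrow> ip z (sc c x) = cnj c * ip z x"
  using ip_sc[of x z c] ip_cnj[of _ z] V_sc by (metis complex_cnj_mult)

lemma ip_minus_right: "x \<in> V \<Longrightarrow> z \<in> V \<Longrightarrow> ip z (- x) = - ip z x"
  using ip_minus[of x z] ip_cnj[of _ z] V_minus by (metis complex_cnj_minus)

lemma ip_diff_right: "x \<in> V \<Longrightarrow> y \<in> V \<Longrightarrow> z \<in> V \<Longrightarrow> ip z (x - y) = ip z x - ip z y"
  using ip_add_right[of x "-y" z] ip_minus_right[of y z] V_minus[of y] by simp

lemma ip_zero_right: "z \<in> V \<Longrightarrow> ip z 0 = 0"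
  using ip_diff_right[of 0 0 z] V_zero by simp

lemma nrm_nonneg: "x \<in> V \<Longrightarrow> 0 \<le> nrm x"
  unfolding nrm_def using ip_nonneg by simp

lemma nrm_square: "x \<in> V \<Longrightarrow> (nrm x)\<^sup>2 = Re (ip x x)"
  unfolding nrm_def using ip_nonneg by simp

lemma ip_self: "x \<in> V \<Longrightarrow> ip x x = of_real ((nrm x)\<^sup>2)"
  using ip_cnj[of x x] nrm_square[of x] by (simp add: complex_eq_iff)

lemma nrm_minus: "x \<in> V \<Longrightarrow> nrm (- x) = nrm x"
  unfolding nrm_def by (simp add: ip_minus ip_minus_right V_minus)

lemma nrm_diff_commute: "x \<in> V \<Longrightarrow> y \<in> V \<Longrightarrow> nrm (x - y) = nrm (y - x)"
  using nrm_minus[of "x - y"] V_diff by simp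

lemma nrm_add_square:
  assumes "x \<in> V" "y \<in> V"
  shows "(nrm (x + y))\<^sup>2 = (nrm x)\<^sup>2 + 2 * Re (ip x y) + (nrm y)\<^sup>2"
  using assms ip_cnj[of x y]
  by (simp add: nrm_square V_add ip_add ip_add_right)

lemma nrm_diff_square:
  assumes "x \<in> V" "y \<in> V"
  shows "(nrm (x - y))\<^sup>2 = (nrm x)\<^sup>2 - 2 * Re (ip x y) + (nrm y)\<^sup>2"
  using nrm_add_square[of x "-y"] assms by (simp add: V_minus ip_minus_right nrm_minus)

lemma nrm_sc: "x \<in> V \<Longrightarrow> nrm (sc c x) = cmod c * nrm x"
proof -
  assume x: "x \<in> V"
  have "ip (sc c x) (sc c x) = c * cnj c * ip x x"
    using x by (simp add: ip_sc ip_sc_right V_sc)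
  also have "\<dots> = of_real ((cmod c * nrm x)\<^sup>2)"
    using x by (simp add: ip_self complex_norm_square[symmetric] power_mult_distrib)
  finally have "(nrm (sc c x))\<^sup>2 = (cmod c * nrm x)\<^sup>2"
    using x by (simp add: nrm_square V_sc)
  then show ?thesis using nrm_nonneg x V_sc by (simp add: power2_eq_iff_nonneg)
qed

lemma Cauchy_Schwarz:
  assumes x: "x \<in> V" and y: "y \<in> V"
  shows "cmod (ip x y) \<le> nrm x * nrm y"
proof -
  define a where "a = ip x y"
  have q: "0 \<le> (nrm x)\<^sup>2 - 2 * r * (cmod a)\<^sup>2 + r\<^sup>2 * (cmod a)\<^sup>2 * (nrm y)\<^sup>2" for r :: real
  proof -
    have "Re (cnj (of_real r * a) * a) = r * (cmod a)\<^sup>2"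
      unfolding cmod_power2 by (simp add: power2_eq_square algebra_simps)
    moreover have "0 \<le> (nrm (x - sc (of_real r * a) y))\<^sup>2" by simp
    ultimately show ?thesis
      using x y by (simp add: nrm_diff_square V_sc ip_sc_right nrm_sc a_def[symmetric]
          norm_mult power_mult_distrib)
  qed
  have "(cmod a)\<^sup>2 \<le> (nrm x)\<^sup>2 * (nrm y)\<^sup>2"
  proof (cases "(nrm y)\<^sup>2 = 0")
    case True
    \<comment> \<open>here the quadratic inequality is affine in \<open>r\<close>, and a large \<open>r\<close> refutes \<open>a \<noteq> 0\<close>\<close>
    have "(cmod a)\<^sup>2 = 0"
    proof (rule ccontr)
      assume "(cmod a)\<^sup>2 \<noteq> 0"
      then have "0 < (cmod a)\<^sup>2" by simp
      moreover have "0 \<le> (nrm x)\<^sup>2 - 2 * (((nrm x)\<^sup>2 + 1) / (cmod a)\<^sup>2) * (cmod a)\<^sup>2"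
        using q[of "((nrm x)\<^sup>2 + 1) / (cmod a)\<^sup>2"] True by simp
      ultimately have "0 \<le> (nrm x)\<^sup>2 - 2 * ((nrm x)\<^sup>2 + 1)" by simp
      then have "(nrm x)\<^sup>2 + 2 \<le> 0" by (simp add: algebra_simps)
      then show False using zero_le_power2[of "nrm x"] by linarith
    qed
    then show ?thesis by simp
  next
    case False
    then have p: "0 < (nrm y)\<^sup>2" by simp
    define Y where "Y = (nrm y)\<^sup>2"
    have "0 \<le> (nrm x)\<^sup>2 - 2 * (1 / Y) * (cmod a)\<^sup>2 + (1 / Y)\<^sup>2 * (cmod a)\<^sup>2 * Y"
      using q[of "1 / Y"] by (simp add: Y_def)
    also have "(1 / Y)\<^sup>2 * (cmod a)\<^sup>2 * Y = (cmod a)\<^sup>2 / Y"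
      using p by (simp add: Y_def[symmetric] power2_eq_square)
    finally have "0 \<le> (nrm x)\<^sup>2 - (cmod a)\<^sup>2 / (nrm y)\<^sup>2" by (simp add: Y_def)
    then show ?thesis using p by (simp add: field_simps)
  qed
  then show ?thesis
    unfolding a_def power_mult_distrib[symmetric]
    using nrm_nonneg x y by (meson mult_nonneg_nonneg power2_le_imp_le)
qed

lemma nrm_triangle:
  assumes "x \<in> V" "y \<in> V"
  shows "nrm (x + y) \<le> nrm x + nrm y"
proof -
  have "Re (ip x y) \<le> nrm x * nrm y"
    using Cauchy_Schwarz[OF assms] complex_Re_le_cmod order_trans by blast
  then have "(nrm (x + y))\<^sup>2 \<le> (nrm x + nrm y)\<^sup>2"
    using assms by (simp add: nrm_add_square power2_sum)
  then show ?thesis using nrm_nonneg assms power2_le_imp_le by (meson add_nonneg_nonneg)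
qed

lemma nrm_triangle_diff:
  assumes "x \<in> V" "y \<in> V" "z \<in> V"
  shows "nrm (x - z) \<le> nrm (x - y) + nrm (y - z)"
  using nrm_triangle[of "x - y" "y - z"] assms by (simp add: V_diff)

lemma ip_null: "x \<in> V \<Longrightarrow> y \<in> V \<Longrightarrow> nrm x = 0 \<Longrightarrow> ip y x = 0"
  using Cauchy_Schwarz[of y x] by simp

definition converges :: "(nat \<Rightarrow> 'a) \<Rightarrow> 'a \<Rightarrow> bool" where
  "converges X x \<longleftrightarrow> (\<forall>n. X n \<in> V) \<and> x \<in> V \<and> (\<lambda>n. nrm (X n - x)) \<longlonglongrightarrow> 0"

lemma converges_ip_left:
  assumes X: "converges X x" and y: "y \<in> V"
  shows "(\<lambda>n. ip (X n) y) \<longlonglongrightarrow> ip x y"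
proof -
  have V: "X n \<in> V" "x \<in> V" for n using X by (auto simp: converges_def)
  have "(\<lambda>n. nrm (X n - x)) \<longlonglongrightarrow> 0" using X by (simp add: converges_def)
  from tendsto_mult_left_zero[OF this, of "nrm y"]
  have lim: "(\<lambda>n. nrm (X n - x) * nrm y) \<longlonglongrightarrow> 0" .
  have "cmod (ip (X n) y - ip x y) \<le> nrm (X n - x) * nrm y" for n
    using Cauchy_Schwarz[of "X n - x" y] V y by (simp add: ip_diff V_diff)
  then have "(\<lambda>n. ip (X n) y - ip x y) \<longlonglongrightarrow> 0"
    by (rule sequence_null_comparison[OF _ lim])
  then show ?thesis using LIM_zero_iff by blast
qed

lemma converges_nrm:
  assumes X: "converges X x"
  shows "(\<lambda>n. nrm (X n)) \<longlonglongrightarrow> nrm x"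
proof -
  have V: "X n \<in> V" "x \<in> V" for n using X by (auto simp: converges_def)
  have "norm (nrm (X n) - nrm x) \<le> nrm (X n - x)" for n
  proof -
    have "nrm (X n) \<le> nrm (X n - x) + nrm x"
      using nrm_triangle[OF V_diff[OF V(1)[of n] V(2)] V(2)] by simp
    moreover have "nrm x \<le> nrm (X n - x) + nrm (X n)"
      using nrm_triangle[OF V_diff[OF V(2) V(1)[of n]] V(1)[of n]]
        nrm_diff_commute[OF V(2) V(1)[of n]] by simp
    ultimately show ?thesis by (simp add: abs_le_iff)
  qed
  moreover have "(\<lambda>n. nrm (X n - x)) \<longlonglongrightarrow> 0" using X by (simp add: converges_def)
  ultimately have "(\<lambda>n. nrm (X n) - nrm x) \<longlonglongrightarrow> 0" by (rule sequence_null_comparison)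
  then show ?thesis using LIM_zero_iff by blast
qed

lemma converges_ip:
  assumes X: "converges X x" and Y: "converges Y y"
  shows "(\<lambda>n. ip (X n) (Y n)) \<longlonglongrightarrow> ip x y"
proof -
  have V: "X n \<in> V" "x \<in> V" "Y n \<in> V" "y \<in> V" for n
    using X Y by (auto simp: converges_def)
  have "(\<lambda>n. nrm (Y n - y)) \<longlonglongrightarrow> 0" using Y by (simp add: converges_def)
  from tendsto_mult[OF converges_nrm[OF X] this]
  have lim: "(\<lambda>n. nrm (X n) * nrm (Y n - y)) \<longlonglongrightarrow> 0" by simp
  have "cmod (ip (X n) (Y n) - ip (X n) y) \<le> nrm (X n) * nrm (Y n - y)" for n
    using Cauchy_Schwarz[of "X n" "Y n - y"] V by (simp add: ip_diff_right V_diff)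
  then have "(\<lambda>n. ip (X n) (Y n) - ip (X n) y) \<longlonglongrightarrow> 0"
    by (rule sequence_null_comparison[OF _ lim])
  from tendsto_add[OF this converges_ip_left[OF X V(4)]] show ?thesis by simp
qed

definition subspace_of :: "'a set \<Rightarrow> bool" where
  "subspace_of S \<longleftrightarrow> S \<subseteq> V \<and> 0 \<in> S \<and> (\<forall>x\<in>S. \<forall>y\<in>S. x + y \<in> S) \<and> (\<forall>c. \<forall>x\<in>S. sc c x \<in> S)"

definition gclosure :: "('a \<times> 'a) set \<Rightarrow> ('a \<times> 'a) set" where
  "gclosure T = {(u, v). u \<in> V \<and> v \<in> V \<and>
     (\<forall>e>0. \<exists>(x, y)\<in>T. nrm (x - u) < e \<and> nrm (y - v) < e)}"

definition gadjoint :: "('a \<times> 'a) set \<Rightarrow> ('a \<times> 'a) set" where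
  "gadjoint T = {(u, v). u \<in> V \<and> v \<in> V \<and> (\<forall>(x, y)\<in>T. ip y u = ip x v)}"

definition gdense :: "('a \<times> 'a) set \<Rightarrow> bool" where
  "gdense T \<longleftrightarrow> (\<forall>u\<in>V. \<forall>e>0. \<exists>x\<in>Domain T. nrm (x - u) < e)"

lemma gclosure_sequence:
  assumes T: "T \<subseteq> V \<times> V" and "(u, v) \<in> gclosure T"
  obtains X Y where "converges X u" "converges Y v" "\<And>n. (X n, Y n) \<in> T"
proof -
  have V: "u \<in> V" "v \<in> V" using assms by (auto simp: gclosure_def)
  have "\<exists>z\<in>T. nrm (fst z - u) < inverse (real (Suc n)) \<and>
      nrm (snd z - v) < inverse (real (Suc n))" for n
  proof -
    have "0 < inverse (real (Suc n))" by simp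
    then have "\<exists>(x, y)\<in>T. nrm (x - u) < inverse (real (Suc n)) \<and>
        nrm (y - v) < inverse (real (Suc n))"
      using assms(2) unfolding gclosure_def by blast
    then obtain a b where "(a, b) \<in> T" "nrm (a - u) < inverse (real (Suc n))"
        "nrm (b - v) < inverse (real (Suc n))" by blast
    then show ?thesis by (intro bexI[of _ "(a, b)"]) (simp_all del: of_nat_Suc)
  qed
  then obtain Z where Z: "Z n \<in> T" "nrm (fst (Z n) - u) < inverse (real (Suc n))"
      "nrm (snd (Z n) - v) < inverse (real (Suc n))" for n by metis
  have ZV: "fst (Z n) \<in> V" "snd (Z n) \<in> V" for n
    using subsetD[OF T Z(1)[of n]] by (auto simp: mem_Times_iff)
  have "(\<lambda>n. nrm (fst (Z n) - u)) \<longlonglongrightarrow> 0"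
  proof (rule sequence_null_comparison[OF _ LIMSEQ_inverse_real_of_nat])
    show "norm (nrm (fst (Z n) - u)) \<le> inverse (real (Suc n))" for n
      using Z(2)[of n] nrm_nonneg[OF V_diff[OF ZV(1)[of n] V(1)]] by (simp del: of_nat_Suc)
  qed
  moreover have "(\<lambda>n. nrm (snd (Z n) - v)) \<longlonglongrightarrow> 0"
  proof (rule sequence_null_comparison[OF _ LIMSEQ_inverse_real_of_nat])
    show "norm (nrm (snd (Z n) - v)) \<le> inverse (real (Suc n))" for n
      using Z(3)[of n] nrm_nonneg[OF V_diff[OF ZV(2)[of n] V(2)]] by (simp del: of_nat_Suc)
  qed
  ultimately show ?thesis
    using that[of "\<lambda>n. fst (Z n)" "\<lambda>n. snd (Z n)"] V ZV Z(1) by (simp add: converges_def)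
qed

lemma gclosureI:
  assumes X: "converges X u" and Y: "converges Y v" and T: "\<And>n. (X n, Y n) \<in> T"
  shows "(u, v) \<in> gclosure T"
proof -
  have "\<exists>(x, y)\<in>T. nrm (x - u) < e \<and> nrm (y - v) < e" if "e > 0" for e
  proof -
    have "\<forall>\<^sub>F n in sequentially. nrm (X n - u) < e \<and> nrm (Y n - v) < e"
      using X Y order_tendstoD(2)[OF _ that] unfolding converges_def
      by (intro eventually_conj) blast+
    then obtain n where "nrm (X n - u) < e \<and> nrm (Y n - v) < e"
      by (auto simp: eventually_sequentially)
    then show ?thesis using T[of n] by auto
  qed
  then show ?thesis using X Y by (auto simp: gclosure_def converges_def)
qed

lemma gadjoint_gclosure:
  assumes T: "T \<subseteq> V \<times> V"
  shows "gadjoint T \<subseteq> gadjoint (gclosure T)"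
proof safe
  fix u v assume uv: "(u, v) \<in> gadjoint T"
  then have V: "u \<in> V" "v \<in> V" by (auto simp: gadjoint_def)
  have "ip y u = ip x v" if xy: "(x, y) \<in> gclosure T" for x y
  proof -
    obtain X Y where XY: "converges X x" "converges Y y" "\<And>n. (X n, Y n) \<in> T"
      using gclosure_sequence[OF T xy] by blast
    have "ip (Y n) u = ip (X n) v" for n using XY(3)[of n] uv by (auto simp: gadjoint_def)
    then have "(\<lambda>n. ip (X n) v) \<longlonglongrightarrow> ip y u" using converges_ip_left[OF XY(2) V(1)] by simp
    then show ?thesis using converges_ip_left[OF XY(1) V(2)] by (rule LIMSEQ_unique)
  qed
  then show "(u, v) \<in> gadjoint (gclosure T)" using V by (auto simp: gadjoint_def)
qed

end

locale semi_hilbert = semi_inner_product +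
  assumes complete: "(\<And>n. X n \<in> V) \<Longrightarrow>
      (\<And>e. e > 0 \<Longrightarrow> \<exists>N. \<forall>m\<ge>N. \<forall>n\<ge>N. nrm (X m - X n) < e) \<Longrightarrow>
      \<exists>x\<in>V. (\<lambda>n. nrm (X n - x)) \<longlonglongrightarrow> 0"
begin

text \<open>The limit \<open>y\<close> of a minimizing sequence for the distance to \<open>S\<close>. As \<open>S\<close> will be a graph
  that is not closed, the sequence itself is part of the conclusion.\<close>

lemma orthogonal_projection:
  assumes S: "subspace_of S" and x: "x \<in> V"
  obtains X y where "\<And>n. X n \<in> S" "converges X y" "\<And>s. s \<in> S \<Longrightarrow> ip (x - y) s = 0"
proof -
  have SV: "S \<subseteq> V" and S0: "0 \<in> S" and Sadd: "\<And>a b. a \<in> S \<Longrightarrow> b \<in> S \<Longrightarrow> a + b \<in> S"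
    and Ssc: "\<And>c a. a \<in> S \<Longrightarrow> sc c a \<in> S" using S by (auto simp: subspace_of_def)
  define d where "d = (INF s\<in>S. (nrm (x - s))\<^sup>2)"
  have bdd: "bdd_below ((\<lambda>s. (nrm (x - s))\<^sup>2) ` S)" by (rule bdd_belowI2[of _ 0]) simp
  have d_le: "d \<le> (nrm (x - s))\<^sup>2" if "s \<in> S" for s
    unfolding d_def using bdd that by (rule cINF_lower)
  have "\<exists>s\<in>S. (nrm (x - s))\<^sup>2 < d + inverse (real (Suc n))" for n
  proof -
    have "(INF s\<in>S. (nrm (x - s))\<^sup>2) < d + inverse (real (Suc n))" unfolding d_def by simp
    then show ?thesis using cINF_less_iff[OF _ bdd] S0 by blast
  qed
  then obtain X where X: "X n \<in> S" "(nrm (x - X n))\<^sup>2 < d + inverse (real (Suc n))" for n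
    by metis
  have XV: "X n \<in> V" for n using X(1) SV by auto
  \<comment> \<open>the parallelogram law for \<open>x - X m\<close> and \<open>x - X n\<close>, whose mean lies in \<open>x - S\<close>\<close>
  have par: "(nrm (X m - X n))\<^sup>2 \<le> 2 * inverse (real (Suc m)) + 2 * inverse (real (Suc n))" for m n
  proof -
    define a b where "a = x - X m" and "b = x - X n"
    have ab: "a \<in> V" "b \<in> V" unfolding a_def b_def by (auto intro: V_diff x XV)
    have h: "sc (1/2) (X m + X n) \<in> S" using X(1) Sadd Ssc by blast
    define k where "k = x - sc (1/2) (X m + X n)"
    have k: "k \<in> V" using h x SV V_diff unfolding k_def by blast
    have kab: "ip k z = (ip a z + ip b z) / 2" if "z \<in> V" for z
      unfolding a_def b_def k_def using that x XV h SV
      by (simp add: ip_diff V_sc V_add ip_sc ip_add field_simps)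
    have kab': "ip z k = (ip z a + ip z b) / 2" if "z \<in> V" for z
      using kab[OF that] ip_cnj[of _ z] ab that k by (metis complex_cnj_add complex_cnj_divide complex_cnj_numeral)
    have "ip k k = (ip a a + ip a b + ip b a + ip b b) / 4"
      unfolding kab[OF k] kab'[OF ab(1)] kab'[OF ab(2)] by (simp add: add_divide_distrib)
    then have "Re (ip k k) = Re (ip a a + ip a b + ip b a + ip b b) / 4"
      by (simp only: Re_divide_numeral)
    then have "4 * (nrm k)\<^sup>2 = (nrm (a + b))\<^sup>2"
      using k ab by (simp add: nrm_square V_add ip_add ip_add_right)
    moreover have "d \<le> (nrm k)\<^sup>2" unfolding k_def by (rule d_le[OF h])
    moreover have "(nrm (a - b))\<^sup>2 + (nrm (a + b))\<^sup>2 = 2 * (nrm a)\<^sup>2 + 2 * (nrm b)\<^sup>2"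
      using ab by (simp add: nrm_diff_square nrm_add_square)
    moreover have "nrm (a - b) = nrm (X m - X n)"
      using nrm_diff_commute[OF XV XV] by (simp add: a_def b_def)
    ultimately show ?thesis using X(2)[of m] X(2)[of n] by (simp add: a_def b_def)
  qed
  have "\<exists>N. \<forall>m\<ge>N. \<forall>n\<ge>N. nrm (X m - X n) < e" if e: "e > 0" for e
  proof -
    obtain N where N: "inverse (real (Suc N)) < e\<^sup>2 / 4"
      using reals_Archimedean[of "e\<^sup>2 / 4"] e by auto
    have "nrm (X m - X n) < e" if mn: "m \<ge> N" "n \<ge> N" for m n
    proof -
      have "inverse (real (Suc m)) \<le> inverse (real (Suc N))"
        "inverse (real (Suc n)) \<le> inverse (real (Suc N))" using mn by (auto simp: le_imp_inverse_le)
      then have "(nrm (X m - X n))\<^sup>2 < e\<^sup>2" using par[of m n] N by linarith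
      then show ?thesis using e power2_less_imp_less[of "nrm (X m - X n)" e] by simp
    qed
    then show ?thesis by blast
  qed
  then obtain y where y: "y \<in> V" "(\<lambda>n. nrm (X n - y)) \<longlonglongrightarrow> 0"
    using complete[of X] XV by blast
  then have conv: "converges X y" using XV by (simp add: converges_def)
  have orth: "ip (x - y) s = 0" if s: "s \<in> S" for s
  proof -
    have sV: "s \<in> V" using s SV by auto
    have xyV: "x - y \<in> V" using x y V_diff by blast
    have lim1: "(\<lambda>n. (nrm (x - X n))\<^sup>2) \<longlonglongrightarrow> (nrm (x - y))\<^sup>2"
    proof -
      have "converges (\<lambda>n. x - X n) (x - y)"
        using conv x XV y nrm_diff_commute by (simp add: converges_def V_diff)
      then show ?thesis by (intro tendsto_power converges_nrm)
    qed
    have "(\<lambda>n. d + inverse (real (Suc n))) \<longlonglongrightarrow> d + 0"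
      by (intro tendsto_add tendsto_const LIMSEQ_inverse_real_of_nat)
    then have "(nrm (x - y))\<^sup>2 \<le> d + 0"
      by (rule LIMSEQ_le[OF lim1]) (use less_imp_le[OF X(2)] in blast)
    then have dxy: "(nrm (x - y))\<^sup>2 \<le> d" by simp
    have low: "d \<le> (nrm ((x - y) - t))\<^sup>2" if t: "t \<in> S" for t
    proof -
      have tV: "t \<in> V" using t SV by auto
      have "converges (\<lambda>n. x - (X n + t)) (x - y - t)"
        using conv x XV y nrm_diff_commute tV
        by (simp add: converges_def V_diff V_add algebra_simps)
      then have "(\<lambda>n. (nrm (x - (X n + t)))\<^sup>2) \<longlonglongrightarrow> (nrm (x - y - t))\<^sup>2"
        by (intro tendsto_power converges_nrm)
      then show ?thesis by (rule LIMSEQ_le_const) (use d_le Sadd X(1) t in blast)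
    qed
    define a where "a = ip (x - y) s"
    have ineq: "2 * r * (cmod a)\<^sup>2 \<le> r\<^sup>2 * (cmod a)\<^sup>2 * (nrm s)\<^sup>2" for r :: real
    proof -
      have "Re (cnj (of_real r * a) * a) = r * (cmod a)\<^sup>2"
        unfolding cmod_power2 by (simp add: power2_eq_square algebra_simps)
      moreover have "(nrm (x - y))\<^sup>2 \<le> (nrm ((x - y) - sc (of_real r * a) s))\<^sup>2"
        using low[OF Ssc[OF s]] dxy order_trans by blast
      ultimately show ?thesis
        using xyV sV by (simp add: nrm_diff_square V_sc ip_sc_right nrm_sc a_def[symmetric]
            norm_mult power_mult_distrib)
    qed
    have "cmod a = 0"
    proof (rule ccontr)
      assume "cmod a \<noteq> 0"
      then have p: "0 < (cmod a)\<^sup>2" by simp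
      define r where "r = 1 / ((nrm s)\<^sup>2 + 1)"
      have pos: "0 < (nrm s)\<^sup>2 + 1" using zero_le_power2[of "nrm s"] by linarith
      have rp: "r > 0" using pos by (simp add: r_def)
      have "(r * (cmod a)\<^sup>2) * 2 \<le> (r * (cmod a)\<^sup>2) * (r * (nrm s)\<^sup>2)"
        using ineq[of r] by (simp add: power2_eq_square algebra_simps)
      then have "2 \<le> r * (nrm s)\<^sup>2" using p rp by simp
      moreover have "r * (nrm s)\<^sup>2 \<le> 1" using pos by (simp add: r_def field_simps)
      ultimately show False by simp
    qed
    then show ?thesis by (simp add: a_def)
  qed
  show ?thesis using that[OF X(1) conv orth] by blast
qed

end

definition pair_ip :: "('a \<Rightarrow> 'a \<Rightarrow> complex) \<Rightarrow> 'a \<times> 'a \<Rightarrow> 'a \<times> 'a \<Rightarrow> complex" where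
  "pair_ip ip z w = ip (fst z) (fst w) + ip (snd z) (snd w)"

text \<open>The inner product of pairs induces the graph norm on the graph of an operator.\<close>

lemma (in semi_hilbert) semi_hilbert_pair:
  "semi_hilbert (V \<times> V) (\<lambda>c z. (sc c (fst z), sc c (snd z))) (pair_ip ip)"
proof -
  interpret P: semi_inner_product "V \<times> V" "\<lambda>c z. (sc c (fst z), sc c (snd z))" "pair_ip ip"
  proof unfold_locales
    fix x y :: "'a \<times> 'a" assume "x \<in> V \<times> V" "y \<in> V \<times> V"
    then show "pair_ip ip y x = cnj (pair_ip ip x y)"
      using ip_cnj[of "fst x" "fst y"] ip_cnj[of "snd x" "snd y"]
      by (auto simp: pair_ip_def mem_Times_iff)
  qed (auto simp: pair_ip_def V_zero V_add V_sc sc_minus ip_add ip_sc ip_nonneg zero_prod_def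
        algebra_simps)
  have nrm2: "(P.nrm z)\<^sup>2 = (nrm (fst z))\<^sup>2 + (nrm (snd z))\<^sup>2" if "z \<in> V \<times> V" for z
    using that by (auto simp: P.nrm_square nrm_square pair_ip_def)
  have le: "nrm (fst z) \<le> P.nrm z" "nrm (snd z) \<le> P.nrm z" if z: "z \<in> V \<times> V" for z
    using nrm2[OF z] by (auto intro: power2_le_imp_le[OF _ P.nrm_nonneg[OF z]])
  have ge: "P.nrm z \<le> nrm (fst z) + nrm (snd z)" if z: "z \<in> V \<times> V" for z
  proof -
    have p: "0 \<le> nrm (fst z)" "0 \<le> nrm (snd z)" using z nrm_nonneg by auto
    then have "(P.nrm z)\<^sup>2 \<le> (nrm (fst z) + nrm (snd z))\<^sup>2"
      using nrm2[OF z] by (simp add: power2_sum)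
    then show ?thesis by (rule power2_le_imp_le[OF _ add_nonneg_nonneg[OF p]])
  qed
  show ?thesis
  proof (unfold_locales, goal_cases)
    case (1 X)
    have X: "X n \<in> V \<times> V" "fst (X n) \<in> V" "snd (X n) \<in> V" for n
      using 1(1)[of n] by (auto simp: mem_Times_iff)
    have D: "X m - X n \<in> V \<times> V" for m n using X P.V_diff by blast
    have "\<exists>N. \<forall>m\<ge>N. \<forall>n\<ge>N. nrm (fst (X m) - fst (X n)) < e" if "e > 0" for e
    proof -
      obtain N where N: "P.nrm (X m - X n) < e" if "m \<ge> N" "n \<ge> N" for m n
        using 1(2)[OF \<open>e > 0\<close>] by blast
      have "nrm (fst (X m) - fst (X n)) < e" if "m \<ge> N" "n \<ge> N" for m n
        using le(1)[OF D, of m n] N[OF that] by simp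
      then show ?thesis by blast
    qed
    then obtain x where x: "x \<in> V" "(\<lambda>n. nrm (fst (X n) - x)) \<longlonglongrightarrow> 0"
      using complete[of "\<lambda>n. fst (X n)"] X by blast
    have "\<exists>N. \<forall>m\<ge>N. \<forall>n\<ge>N. nrm (snd (X m) - snd (X n)) < e" if "e > 0" for e
    proof -
      obtain N where N: "P.nrm (X m - X n) < e" if "m \<ge> N" "n \<ge> N" for m n
        using 1(2)[OF \<open>e > 0\<close>] by blast
      have "nrm (snd (X m) - snd (X n)) < e" if "m \<ge> N" "n \<ge> N" for m n
        using le(2)[OF D, of m n] N[OF that] by simp
      then show ?thesis by blast
    qed
    then obtain y where y: "y \<in> V" "(\<lambda>n. nrm (snd (X n) - y)) \<longlonglongrightarrow> 0"
      using complete[of "\<lambda>n. snd (X n)"] X by blast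
    have E: "X n - (x, y) \<in> V \<times> V" for n using X(1) P.V_diff x(1) y(1) by blast
    have "(\<lambda>n. nrm (fst (X n) - x) + nrm (snd (X n) - y)) \<longlonglongrightarrow> 0 + 0"
      using x y by (intro tendsto_add)
    then have lim: "(\<lambda>n. nrm (fst (X n) - x) + nrm (snd (X n) - y)) \<longlonglongrightarrow> 0" by simp
    have "norm (P.nrm (X n - (x, y))) \<le> nrm (fst (X n) - x) + nrm (snd (X n) - y)" for n
      using ge[OF E[of n]] P.nrm_nonneg[OF E[of n]] by simp
    then have "(\<lambda>n. P.nrm (X n - (x, y))) \<longlonglongrightarrow> 0"
      by (rule sequence_null_comparison[OF _ lim])
    then show ?case using x y by blast
  qed
qed

text \<open>The set \<open>C\<close> is the common domain of the operators below; in the application it consists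
  of the smooth forms with compact support.\<close>

locale test_space = semi_hilbert +
  fixes C :: "'a set"
  assumes C_subspace: "subspace_of C"
begin

lemma C_V: "w \<in> C \<Longrightarrow> w \<in> V" and C_zero: "0 \<in> C"
  and C_add: "w \<in> C \<Longrightarrow> w' \<in> C \<Longrightarrow> w + w' \<in> C" and C_sc: "w \<in> C \<Longrightarrow> sc c w \<in> C"
  using C_subspace by (auto simp: subspace_of_def)

definition linear_op :: "('a \<Rightarrow> 'a) \<Rightarrow> bool" where
  "linear_op P \<longleftrightarrow> (\<forall>w\<in>C. P w \<in> C) \<and> (\<forall>w\<in>C. \<forall>w'\<in>C. P (w + w') = P w + P w') \<and>
     (\<forall>c. \<forall>w\<in>C. P (sc c w) = sc c (P w)) \<and> P 0 = 0"

definition adjoint_pair :: "('a \<Rightarrow> 'a) \<Rightarrow> ('a \<Rightarrow> 'a) \<Rightarrow> bool" where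
  "adjoint_pair P Q \<longleftrightarrow> linear_op P \<and> linear_op Q \<and> (\<forall>w\<in>C. \<forall>w'\<in>C. ip (P w) w' = ip w (Q w'))"

definition graph0 :: "('a \<Rightarrow> 'a) \<Rightarrow> ('a \<times> 'a) set" where
  "graph0 P = {(w, P w) | w. w \<in> C}"

text \<open>The weak extension of the operator whose formal adjoint is \<open>Q\<close>.\<close>

definition weak :: "('a \<Rightarrow> 'a) \<Rightarrow> ('a \<times> 'a) set" where
  "weak Q = {(u, v). u \<in> V \<and> v \<in> V \<and> (\<forall>w\<in>C. ip v w = ip u (Q w))}"

lemma linear_op_C: "linear_op P \<Longrightarrow> w \<in> C \<Longrightarrow> P w \<in> C"
  by (simp add: linear_op_def)

lemma adjoint_pair_sym: "adjoint_pair P Q \<Longrightarrow> adjoint_pair Q P"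
  unfolding adjoint_pair_def by (metis C_V ip_cnj linear_op_C)

lemma graph0_V: "linear_op P \<Longrightarrow> graph0 P \<subseteq> V \<times> V"
  by (auto simp: graph0_def linear_op_def C_V)

lemma gclosure_subset_weak:
  assumes PQ: "adjoint_pair P Q"
  shows "gclosure (graph0 P) \<subseteq> weak Q"
proof safe
  fix u v assume uv: "(u, v) \<in> gclosure (graph0 P)"
  have lin: "linear_op P" "linear_op Q" using PQ by (auto simp: adjoint_pair_def)
  obtain X Y where XY: "converges X u" "converges Y v" "\<And>n. (X n, Y n) \<in> graph0 P"
    using gclosure_sequence[OF graph0_V[OF lin(1)] uv] by blast
  have "ip v w = ip u (Q w)" if w: "w \<in> C" for w
  proof -
    have "ip (Y n) w = ip (X n) (Q w)" for n
      using XY(3)[of n] PQ w by (auto simp: graph0_def adjoint_pair_def)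
    then have "(\<lambda>n. ip (X n) (Q w)) \<longlonglongrightarrow> ip v w"
      using converges_ip_left[OF XY(2) C_V[OF w]] by simp
    then show ?thesis
      using converges_ip_left[OF XY(1) C_V[OF linear_op_C[OF lin(2) w]]] by (rule LIMSEQ_unique)
  qed
  then show "(u, v) \<in> weak Q" using XY by (auto simp: weak_def converges_def)
qed

definition C_dense :: bool where
  "C_dense \<longleftrightarrow> (\<forall>u\<in>V. \<forall>e>0. \<exists>w\<in>C. nrm (w - u) < e)"

lemma dense_orthogonal_null:
  assumes d: C_dense and u: "u \<in> V" and o: "\<And>w. w \<in> C \<Longrightarrow> ip u w = 0"
  shows "nrm u = 0"
proof (rule ccontr)
  assume "nrm u \<noteq> 0"
  then have p: "nrm u > 0" using nrm_nonneg[OF u] by simp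
  then obtain w where w: "w \<in> C" "nrm (w - u) < nrm u" using d u by (auto simp: C_dense_def)
  have wV: "w \<in> V" using w C_V by auto
  have "(nrm (w - u))\<^sup>2 = (nrm w)\<^sup>2 + (nrm u)\<^sup>2"
    using nrm_diff_square[OF wV u] o[OF w(1)] ip_cnj[OF u wV] by simp
  moreover have "(nrm (w - u))\<^sup>2 < (nrm u)\<^sup>2"
    using w(2) nrm_nonneg V_diff wV u by (intro power_strict_mono) auto
  ultimately show False using zero_le_power2[of "nrm w"] by linarith
qed

text \<open>The part of a weak pair that is orthogonal to the graph over \<open>C\<close> is again a weak pair
  \<open>(u, v)\<close>. Once \<open>u\<close> is null, the defining identity of the weak extension makes \<open>v\<close>
  orthogonal to \<open>C\<close>, hence null; so every weak pair is its own projection up to null vectors.\<close>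

lemma strong_eq_weak_criterion:
  assumes PQ: "adjoint_pair P Q" and d: C_dense
    and key: "\<And>u v. (u, v) \<in> weak Q \<Longrightarrow> (\<And>w. w \<in> C \<Longrightarrow> ip u w + ip v (P w) = 0) \<Longrightarrow> nrm u = 0"
  shows "gclosure (graph0 P) = weak Q"
proof
  show "gclosure (graph0 P) \<subseteq> weak Q" by (rule gclosure_subset_weak[OF PQ])
next
  have lin: "linear_op P" "linear_op Q" using PQ by (auto simp: adjoint_pair_def)
  show "weak Q \<subseteq> gclosure (graph0 P)"
  proof safe
    fix u v assume uv: "(u, v) \<in> weak Q"
    then have V: "u \<in> V" "v \<in> V" by (auto simp: weak_def)
    interpret P: semi_hilbert "V \<times> V" "\<lambda>c z. (sc c (fst z), sc c (snd z))" "pair_ip ip"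
      by (rule semi_hilbert_pair)
    have nrmP: "(P.nrm z)\<^sup>2 = (nrm (fst z))\<^sup>2 + (nrm (snd z))\<^sup>2" if "z \<in> V \<times> V" for z
      using that by (auto simp: P.nrm_square nrm_square pair_ip_def)
    have "P.subspace_of (graph0 P)"
      unfolding P.subspace_of_def using graph0_V[OF lin(1)] lin(1)
      by (auto simp: graph0_def linear_op_def C_zero C_add C_sc zero_prod_def)
    then obtain Z z where Z: "\<And>n. Z n \<in> graph0 P" "P.converges Z z"
        "\<And>s. s \<in> graph0 P \<Longrightarrow> pair_ip ip ((u, v) - z) s = 0"
      using P.orthogonal_projection[of "graph0 P" "(u, v)"] V by blast
    obtain a b where z: "z = (a, b)" by (cases z)
    have ab: "a \<in> V" "b \<in> V" using Z(2) z by (auto simp: P.converges_def)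
    have ZV: "Z n \<in> V \<times> V" for n using Z(2) by (auto simp: P.converges_def)
    have D: "Z n - z \<in> V \<times> V" for n using ZV z ab P.V_diff by blast
    have lim: "(\<lambda>n. P.nrm (Z n - z)) \<longlonglongrightarrow> 0" using Z(2) by (auto simp: P.converges_def)
    have le: "nrm (fst (Z n) - a) \<le> P.nrm (Z n - z)" "nrm (snd (Z n) - b) \<le> P.nrm (Z n - z)" for n
      by (rule power2_le_imp_le[OF _ P.nrm_nonneg[OF D[of n]]], simp add: nrmP[OF D[of n]], simp add: z)+
    have FV: "fst (Z n) \<in> V" "snd (Z n) \<in> V" for n using ZV[of n] by (auto simp: mem_Times_iff)
    have c1: "converges (\<lambda>n. fst (Z n)) a"
    proof -
      have "norm (nrm (fst (Z n) - a)) \<le> P.nrm (Z n - z)" for n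
        using le(1)[of n] nrm_nonneg[OF V_diff[OF FV(1)[of n] ab(1)]] by simp
      then have "(\<lambda>n. nrm (fst (Z n) - a)) \<longlonglongrightarrow> 0" by (rule sequence_null_comparison[OF _ lim])
      then show ?thesis using FV ab by (simp add: converges_def)
    qed
    have c2: "converges (\<lambda>n. snd (Z n)) b"
    proof -
      have "norm (nrm (snd (Z n) - b)) \<le> P.nrm (Z n - z)" for n
        using le(2)[of n] nrm_nonneg[OF V_diff[OF FV(2)[of n] ab(2)]] by simp
      then have "(\<lambda>n. nrm (snd (Z n) - b)) \<longlonglongrightarrow> 0" by (rule sequence_null_comparison[OF _ lim])
      then show ?thesis using FV ab by (simp add: converges_def)
    qed
    have ab_cl: "(a, b) \<in> gclosure (graph0 P)" using gclosureI[OF c1 c2] Z(1) by simp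
    then have "(a, b) \<in> weak Q" using gclosure_subset_weak[OF PQ] by blast
    then have w': "(u - a, v - b) \<in> weak Q"
      using uv ab V by (auto simp: weak_def V_diff ip_diff C_V linear_op_C[OF lin(2)])
    have orth: "ip (u - a) w + ip (v - b) (P w) = 0" if "w \<in> C" for w
      using Z(3)[of "(w, P w)"] that z by (auto simp: graph0_def pair_ip_def)
    have n1: "nrm (u - a) = 0" using key[OF w' orth] by blast
    have uaV: "u - a \<in> V" "v - b \<in> V" using V ab V_diff by auto
    have "ip (v - b) w = 0" if w: "w \<in> C" for w
    proof -
      have "ip (v - b) w = ip (u - a) (Q w)" using w' w by (auto simp: weak_def)
      also have "\<dots> = 0"
        using ip_null[OF uaV(1) C_V[OF linear_op_C[OF lin(2) w]] n1]
          ip_cnj[OF C_V[OF linear_op_C[OF lin(2) w]] uaV(1)] by simp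
      finally show ?thesis .
    qed
    then have n2: "nrm (v - b) = 0" by (rule dense_orthogonal_null[OF d uaV(2)])
    have shift: "nrm (x - u) \<le> nrm (x - a)" if "x \<in> V" for x
      using nrm_triangle_diff[OF that ab(1) V(1)] n1 nrm_diff_commute[OF V(1) ab(1)] by simp
    have shift2: "nrm (x - v) \<le> nrm (x - b)" if "x \<in> V" for x
      using nrm_triangle_diff[OF that ab(2) V(2)] n2 nrm_diff_commute[OF V(2) ab(2)] by simp
    have "converges (\<lambda>n. fst (Z n)) u"
    proof -
      have "norm (nrm (fst (Z n) - u)) \<le> nrm (fst (Z n) - a)" for n
        using shift[OF FV(1)[of n]] nrm_nonneg[OF V_diff[OF FV(1)[of n] V(1)]] by simp
      moreover have "(\<lambda>n. nrm (fst (Z n) - a)) \<longlonglongrightarrow> 0" using c1 by (simp add: converges_def)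
      ultimately have "(\<lambda>n. nrm (fst (Z n) - u)) \<longlonglongrightarrow> 0" by (rule sequence_null_comparison)
      then show ?thesis using FV V by (simp add: converges_def)
    qed
    moreover have "converges (\<lambda>n. snd (Z n)) v"
    proof -
      have "norm (nrm (snd (Z n) - v)) \<le> nrm (snd (Z n) - b)" for n
        using shift2[OF FV(2)[of n]] nrm_nonneg[OF V_diff[OF FV(2)[of n] V(2)]] by simp
      moreover have "(\<lambda>n. nrm (snd (Z n) - b)) \<longlonglongrightarrow> 0" using c2 by (simp add: converges_def)
      ultimately have "(\<lambda>n. nrm (snd (Z n) - v)) \<longlonglongrightarrow> 0" by (rule sequence_null_comparison)
      then show ?thesis using FV V by (simp add: converges_def)
    qed
    ultimately show "(u, v) \<in> gclosure (graph0 P)" using gclosureI Z(1) by simp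
  qed
qed

text \<open>For a weak pair \<open>(u, v)\<close> of the adjoint that is orthogonal to its graph, \<open>(v, -u)\<close> is a
  weak pair of \<open>P\<close>, hence a limit of pairs of \<open>P\<close>. Testing the weak identity for \<open>(u, v)\<close>
  on this limit yields \<open>\<langle>v, v\<rangle> = -\<langle>u, u\<rangle>\<close>.\<close>

lemma strong_eq_weak_adjoint:
  assumes PQ: "adjoint_pair P Q" and d: C_dense and eq: "gclosure (graph0 P) = weak Q"
  shows "gclosure (graph0 Q) = weak P"
proof (rule strong_eq_weak_criterion[OF adjoint_pair_sym[OF PQ] d])
  fix u v assume uv: "(u, v) \<in> weak P" and orth: "\<And>w. w \<in> C \<Longrightarrow> ip u w + ip v (Q w) = 0"
  have lin: "linear_op P" "linear_op Q" using PQ by (auto simp: adjoint_pair_def)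
  have V: "u \<in> V" "v \<in> V" using uv by (auto simp: weak_def)
  have "ip (- u) w = ip v (Q w)" if "w \<in> C" for w
    using orth[OF that] that C_V V by (simp add: ip_minus add_eq_0_iff)
  then have "(v, - u) \<in> gclosure (graph0 P)" using V V_minus eq by (auto simp: weak_def)
  then obtain X Y where XY: "converges X v" "converges Y (- u)" "\<And>n. (X n, Y n) \<in> graph0 P"
    using gclosure_sequence[OF graph0_V[OF lin(1)]] by blast
  have "ip (X n) v = ip (Y n) u" for n
  proof -
    have "X n \<in> C" "Y n = P (X n)" using XY(3)[of n] by (auto simp: graph0_def)
    then have "ip v (X n) = ip u (Y n)" using uv by (auto simp: weak_def)
    then show ?thesis using ip_cnj V XY by (metis converges_def)
  qed
  then have "(\<lambda>n. ip (X n) v) \<longlonglongrightarrow> ip (- u) u" using converges_ip_left[OF XY(2) V(1)] by simp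
  with converges_ip_left[OF XY(1) V(2)] have "ip v v = ip (- u) u" by (rule LIMSEQ_unique)
  then have "of_real ((nrm v)\<^sup>2 + (nrm u)\<^sup>2) = (0::complex)"
    using V by (simp add: ip_minus ip_self)
  then have "(nrm v)\<^sup>2 + (nrm u)\<^sup>2 = 0" using of_real_eq_0_iff by blast
  then show "nrm u = 0" by (simp add: add_nonneg_eq_0_iff)
qed

text \<open>Let \<open>(u, v)\<close> be a weak pair orthogonal to the graph of \<open>P\<close>. By orthogonality, \<open>u\<close> pairs with
  \<open>L (L w)\<close> as \<open>- v\<close> does with \<open>P (L (L w))\<close>, which is null; the two alternatives in the
  hypothesis are adjoint to each other, up to null vectors. Hence the \<open>L\<close>-part of \<open>B\<close> does not
  see \<open>u\<close>, and \<open>u\<close> satisfies the eigenvalue equation for \<open>-1\<close> of the adjoint of the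
  nonnegative operator \<open>B\<close>.\<close>

theorem essentially_self_adjoint_imp_strong_eq_weak:
  assumes PQ: "adjoint_pair P Q"
    and B: "linear_op B" "\<And>w. w \<in> C \<Longrightarrow> B w = Q (P w) + L (L w)"
    and L: "adjoint_pair L L"
    and PL: "(\<forall>w\<in>C. P (L w) = 0) \<or> (\<forall>w\<in>C. L (Q w) = 0)"
    and dense: "gdense (gclosure (graph0 B))"
    and sa: "gadjoint (gclosure (graph0 B)) = gclosure (graph0 B)"
  shows "gclosure (graph0 P) = weak Q" "gclosure (graph0 Q) = weak P"
proof -
  have lin: "linear_op P" "linear_op Q" using PQ by (auto simp: adjoint_pair_def)
  have LC: "L w \<in> C" if "w \<in> C" for w using L that by (simp add: adjoint_pair_def linear_op_C)
  have L_sym: "ip (L w) w' = ip w (L w')" if "w \<in> C" "w' \<in> C" for w w'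
    using L that by (simp add: adjoint_pair_def)
  have PL_null: "nrm (P (L w)) = 0" if w: "w \<in> C" for w
    using PL
  proof
    assume LQ: "\<forall>w\<in>C. L (Q w) = 0"
    define y where "y = P (L w)"
    have y: "y \<in> C" unfolding y_def by (intro linear_op_C[OF lin(1)] LC w)
    have "ip y y = ip (L w) (Q y)" using PQ LC[OF w] y by (simp add: adjoint_pair_def y_def)
    also have "\<dots> = ip w (L (Q y))" by (rule L_sym[OF w linear_op_C[OF lin(2) y]])
    also have "\<dots> = 0" using LQ y by (simp add: ip_zero_right C_V[OF w])
    finally show ?thesis by (simp add: nrm_def y_def)
  qed (simp add: nrm_def ip_zero V_zero w)
  define K where "K w = L (L w)" for w
  have K: "K w \<in> C" "0 \<le> Re (ip (K w) w)" and PK: "nrm (P (K w)) = 0" if w: "w \<in> C" for w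
    unfolding K_def L_sym[OF LC[OF w] w]
    by (rule LC[OF LC[OF w]], rule ip_nonneg[OF C_V[OF LC[OF w]]], rule PL_null[OF LC[OF w]])
  note B = B[folded K_def]
  have d: C_dense
    unfolding C_dense_def
  proof (intro ballI allI impI)
    fix u :: 'a and e :: real assume u: "u \<in> V" and e: "e > 0"
    then obtain x where x: "x \<in> Domain (gclosure (graph0 B))" "nrm (x - u) < e / 2"
      using dense unfolding gdense_def by (meson half_gt_zero)
    then obtain y where xy: "(x, y) \<in> gclosure (graph0 B)" by blast
    then have xV: "x \<in> V" by (auto simp: gclosure_def)
    obtain w where w: "w \<in> C" "nrm (w - x) < e / 2"
    proof -
      have "\<exists>(w, z)\<in>graph0 B. nrm (w - x) < e / 2 \<and> nrm (z - y) < e / 2"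
        using xy half_gt_zero[OF e] unfolding gclosure_def by blast
      then show ?thesis using that by (auto simp: graph0_def)
    qed
    have "nrm (w - u) < e" using nrm_triangle_diff[OF C_V[OF w(1)] xV u] w x by simp
    then show "\<exists>w\<in>C. nrm (w - u) < e" using w by blast
  qed
  show 1: "gclosure (graph0 P) = weak Q"
  proof (rule strong_eq_weak_criterion[OF PQ d])
    fix u v assume uv: "(u, v) \<in> weak Q" and orth: "\<And>w. w \<in> C \<Longrightarrow> ip u w + ip v (P w) = 0"
    have V: "u \<in> V" "v \<in> V" using uv by (auto simp: weak_def)
    have "ip (B w) u = ip w (- u)" if w: "w \<in> C" for w
    proof -
      have wV: "w \<in> V" "P w \<in> C" "Q (P w) \<in> V" "K w \<in> V" "B w \<in> V"
        using C_V linear_op_C[OF lin(1)] linear_op_C[OF lin(2)] K(1) w linear_op_C[OF B(1)] by auto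
      have "ip u (Q (P w)) = ip v (P w)" using uv wV(2) by (auto simp: weak_def)
      moreover have "ip u (K w) = 0"
        using orth[OF K(1)[OF w]]
          ip_null[OF C_V[OF linear_op_C[OF lin(1) K(1)[OF w]]] V(2) PK[OF w]] by simp
      ultimately have "ip u (B w) = ip v (P w)"
        using B(2)[OF w] V wV by (simp add: ip_add_right)
      then have "ip u (B w) = - ip u w" using orth[OF w] by (simp add: add_eq_0_iff)
      then have "ip (B w) u = - ip w u"
        using ip_cnj[OF V(1) wV(5)] ip_cnj[OF V(1) wV(1)] by simp
      then show ?thesis using V wV by (simp add: ip_minus_right)
    qed
    then have "(u, - u) \<in> gadjoint (graph0 B)"
      using V V_minus by (auto simp: gadjoint_def graph0_def)
    then have "(u, - u) \<in> gclosure (graph0 B)"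
      using gadjoint_gclosure[OF graph0_V[OF B(1)]] sa by blast
    then obtain X Y where XY: "converges X u" "converges Y (- u)" "\<And>n. (X n, Y n) \<in> graph0 B"
      using gclosure_sequence[OF graph0_V[OF B(1)]] by blast
    have nonneg: "0 \<le> Re (ip (Y n) (X n))" for n
    proof -
      define w where "w = X n"
      have w: "w \<in> C" "Y n = B w" using XY(3)[of n] by (auto simp: graph0_def w_def)
      have wV: "w \<in> V" "P w \<in> C" "Q (P w) \<in> V" "K w \<in> V" "P w \<in> V"
        using C_V linear_op_C[OF lin(1)] linear_op_C[OF lin(2)] K(1) w by auto
      have "ip (Q (P w)) w = ip (P w) (P w)"
        using adjoint_pair_sym[OF PQ] w wV by (auto simp: adjoint_pair_def)
      then have "ip (B w) w = ip (P w) (P w) + ip (K w) w"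
        using B(2)[OF w(1)] wV by (simp add: ip_add)
      then show ?thesis
        using ip_nonneg[OF wV(5)] K(2)[OF w(1)] w(2) by (simp add: w_def)
    qed
    have "(\<lambda>n. Re (ip (Y n) (X n))) \<longlonglongrightarrow> Re (ip (- u) u)"
      using converges_ip[OF XY(2,1)] by (rule tendsto_Re)
    then have "0 \<le> Re (ip (- u) u)" by (rule LIMSEQ_le_const) (use nonneg in blast)
    then have "(nrm u)\<^sup>2 \<le> 0" using V by (simp add: ip_minus nrm_square)
    then show "nrm u = 0" by simp
  qed
  show "gclosure (graph0 Q) = weak P" by (rule strong_eq_weak_adjoint[OF PQ d 1])
qed

end


section \<open>The inner product of alternating forms\<close>

definition positive_definite :: "(complex^'n \<Rightarrow> complex^'n \<Rightarrow> real) \<Rightarrow> bool" where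
  "positive_definite h \<longleftrightarrow> bilinear h \<and> (\<forall>v w. h v w = h w v) \<and> (\<forall>v. v \<noteq> 0 \<longrightarrow> h v v > 0)"

lemma positive_definiteD:
  fixes h :: "complex^'n::finite \<Rightarrow> complex^'n \<Rightarrow> real"
  assumes "positive_definite h"
  shows "linear (\<lambda>x. h x y)" "linear (\<lambda>x. h y x)" "h v w = h w v" "v \<noteq> 0 \<Longrightarrow> h v v > 0"
  using assms by (auto simp: positive_definite_def bilinear_def)

lemma orthonormal_expansion:
  fixes h :: "complex^'n::finite \<Rightarrow> complex^'n \<Rightarrow> real"
  assumes h: "positive_definite h" and B: "finite B" "\<forall>v\<in>B. \<forall>w\<in>B. h v w = (if v = w then 1 else 0)"
    and x: "x \<in> span B"
  shows "x = (\<Sum>b\<in>B. h x b *\<^sub>R b)"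
proof -
  note lin = positive_definiteD[OF h]
  define y where "y = x - (\<Sum>b\<in>B. h x b *\<^sub>R b)"
  have orth: "h y b = 0" if b: "b \<in> B" for b
  proof -
    have "h y b = h x b - (\<Sum>c\<in>B. h x c * h c b)"
      unfolding y_def linear_diff[OF lin(1)] linear_sum[OF lin(1)] linear_scale[OF lin(1)] by simp
    also have "(\<Sum>c\<in>B. h x c * h c b) = (\<Sum>c\<in>B. if c = b then h x c else 0)"
      using B(2) b by (intro sum.cong) auto
    finally show ?thesis using B(1) b by simp
  qed
  have "y \<in> span B" unfolding y_def
    by (intro span_diff x span_sum span_scale span_base)
  moreover have "subspace {z. h y z = 0}"
    using lin(2)[of y] by (intro linear_subspace_kernel)
  ultimately have "h y y = 0" using orth span_induct[of y B "\<lambda>z. h y z = 0"] by auto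
  then have "y = 0" using lin(4)[of y] by force
  then show ?thesis by (simp add: y_def)
qed

text \<open>The resulting orthonormal bases guarantee that the choice of a basis in \<^const>\<open>form_inner\<close> is not vacuous.\<close>

lemma gram_schmidt:
  fixes h :: "complex^'n::finite \<Rightarrow> complex^'n \<Rightarrow> real"
  assumes h: "positive_definite h" and "finite S"
  shows "\<exists>B. finite B \<and> span B = span S \<and> (\<forall>v\<in>B. \<forall>w\<in>B. h v w = (if v = w then 1 else 0))"
  using assms(2)
proof (induction S rule: finite_induct)
  case empty
  show ?case by (intro exI[of _ "{}"]) simp
next
  case (insert a S)
  note lin = positive_definiteD[OF h]
  obtain B where B: "finite B" "span B = span S" "\<forall>v\<in>B. \<forall>w\<in>B. h v w = (if v = w then 1 else 0)"
    using insert.IH by blast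
  define p where "p = (\<Sum>b\<in>B. h a b *\<^sub>R b)"
  define y where "y = a - p"
  have p: "p \<in> span B" unfolding p_def by (intro span_sum span_scale span_base)
  show ?case
  proof (cases "y = 0")
    case True
    then have "a \<in> span S" using p B(2) by (simp add: y_def)
    then have "span (insert a S) = span S" by (rule span_redundant)
    then show ?thesis using B by auto
  next
    case False
    define n where "n = sqrt (h y y)"
    have n: "n > 0" "n * n = h y y" using lin(4)[OF False] by (auto simp: n_def)
    define e where "e = (1 / n) *\<^sub>R y"
    have orth: "h y b = 0" if b: "b \<in> B" for b
    proof -
      have "h y b = h a b - (\<Sum>c\<in>B. h a c * h c b)"
        unfolding y_def p_def linear_diff[OF lin(1)] linear_sum[OF lin(1)] linear_scale[OF lin(1)]
        by simp
      also have "(\<Sum>c\<in>B. h a c * h c b) = (\<Sum>c\<in>B. if c = b then h a c else 0)"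
        using B(3) b by (intro sum.cong) auto
      finally show ?thesis using B(1) b by simp
    qed
    have e1: "h e b = 0" if "b \<in> B" for b
      using orth[OF that] unfolding e_def linear_scale[OF lin(1)] by simp
    have e2: "h e e = 1"
      unfolding e_def linear_scale[OF lin(1)] linear_scale[OF lin(2)]
      using n by (simp add: n(2)[symmetric])
    have "h b e = 0" if "b \<in> B" for b using e1[OF that] lin(3) by simp
    then have "\<forall>v\<in>insert e B. \<forall>w\<in>insert e B. h v w = (if v = w then 1 else 0)"
      using B(3) e1 e2 by fastforce
    moreover have "span (insert e B) = span (insert a S)"
    proof
      have "e \<in> span (insert a S)"
      proof -
        have "p \<in> span (insert a S)" using p B(2) span_mono[of S "insert a S"] by blast
        moreover have "a \<in> span (insert a S)" by (simp add: span_base)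
        ultimately show ?thesis unfolding e_def y_def
          by (intro span_scale span_diff)
      qed
      moreover have "B \<subseteq> span (insert a S)"
        using span_superset[of B] B(2) span_mono[of S "insert a S"] by blast
      ultimately show "span (insert e B) \<subseteq> span (insert a S)"
        by (intro span_minimal) auto
      have "a = n *\<^sub>R e + p" using n by (simp add: e_def y_def)
      moreover have "p \<in> span (insert e B)" using p span_mono[of B "insert e B"] by blast
      ultimately have "a \<in> span (insert e B)"
        by (metis insertI1 span_add span_base span_scale)
      moreover have "S \<subseteq> span (insert e B)"
        using span_superset[of S] B(2) span_mono[of B "insert e B"] by blast
      ultimately show "span (insert a S) \<subseteq> span (insert e B)"
        by (intro span_minimal) auto
    qed
    ultimately show ?thesis using B(1) by (intro exI[of _ "insert e B"]) simp
  qed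
qed

lemma orthonormal_basis_some:
  fixes h :: "complex^'n::finite \<Rightarrow> complex^'n \<Rightarrow> real"
  assumes h: "positive_definite h"
  shows "orthonormal_basis h (SOME B. orthonormal_basis h B)"
proof -
  obtain B where "span B = span (Basis :: (complex^'n) set)"
      "\<forall>v\<in>B. \<forall>w\<in>B. h v w = (if v = w then 1 else 0)"
    using gram_schmidt[OF h finite_Basis] by blast
  then have "orthonormal_basis h B" by (simp add: orthonormal_basis_def span_Basis)
  then show ?thesis by (rule someI)
qed

lemma orthonormal_basis_card:
  fixes h :: "complex^'n::finite \<Rightarrow> complex^'n \<Rightarrow> real"
  assumes h: "positive_definite h" and B: "orthonormal_basis h B"
  shows "finite B" "card B \<le> DIM(complex^'n)"
proof -
  note lin = positive_definiteD[OF h]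
  have "independent B"
    unfolding dependent_def
  proof clarify
    fix b assume b: "b \<in> B" "b \<in> span (B - {b})"
    have "subspace {z. h z b = 0}" using lin(1)[of b] by (intro linear_subspace_kernel)
    then have "h b b = 0"
      using b B span_induct[of b "B - {b}" "\<lambda>z. h z b = 0"]
      by (auto simp: orthonormal_basis_def)
    then show False using b B by (auto simp: orthonormal_basis_def)
  qed
  then show "finite B" "card B \<le> DIM(complex^'n)"
    using independent_bound[of B] by blast+
qed

lemma alternating_linear: "alternating \<alpha> \<Longrightarrow> linear (\<lambda>v. \<alpha> (xs @ v # ys))"
  and alternating_repeat: "alternating \<alpha> \<Longrightarrow> \<alpha> (xs @ v # ys @ v # zs) = 0"
  by (auto simp: alternating_def)

lemma alternating_Cons:
  assumes "alternating \<alpha>"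
  shows "alternating (\<lambda>l. \<alpha> (v # l))"
  unfolding alternating_def
  using alternating_linear[OF assms, of "v # _"] alternating_repeat[OF assms, of "v # _"] by simp

lemma alternating_not_distinct: "alternating \<alpha> \<Longrightarrow> \<not> distinct l \<Longrightarrow> \<alpha> l = 0"
  using not_distinct_decomp[of l] alternating_repeat[of \<alpha>] by auto

definition lists_of :: "nat \<Rightarrow> 'b set \<Rightarrow> 'b list set" where
  "lists_of k B = {l. set l \<subseteq> B \<and> length l = k}"

lemma finite_lists_of: "finite B \<Longrightarrow> finite (lists_of k B)"
  by (simp add: lists_of_def finite_lists_length_eq)

lemma sum_lists_of_Suc:
  "finite B \<Longrightarrow> (\<Sum>l\<in>lists_of (Suc k) B. f l) = (\<Sum>b\<in>B. \<Sum>l\<in>lists_of k B. f (b # l))"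
proof -
  assume B: "finite B"
  have "lists_of (Suc k) B = (\<lambda>(b, l). b # l) ` (B \<times> lists_of k B)"
    by (auto simp: lists_of_def length_Suc_conv image_iff)
  moreover have inj: "inj_on (\<lambda>(b, l). b # l) (B \<times> lists_of k B)" by (auto simp: inj_on_def)
  ultimately have "(\<Sum>l\<in>lists_of (Suc k) B. f l) = (\<Sum>(b, l)\<in>B \<times> lists_of k B. f (b # l))"
    using sum.reindex[OF inj, of f] by (simp add: case_prod_beta comp_def)
  then show ?thesis using B by (simp add: sum.cartesian_product)
qed

text \<open>For \<open>H\<close> the inverse Gram matrix of a basis \<open>e\<close> this is \<open>k!\<close> times the inner product of the
  components of degree \<open>k\<close>. In contrast to \<^const>\<open>form_inner\<close>, which picks an orthonormal
  basis at every point without any regularity, it is a polynomial in the entries of \<open>H\<close>,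
  the values of \<open>\<alpha>\<close> and the conjugate values of \<open>\<beta>\<close> on basis vectors.\<close>

primrec contraction ::
  "nat \<Rightarrow> real^'i^'i \<Rightarrow> ('i::finite \<Rightarrow> 'v) \<Rightarrow> ('v list \<Rightarrow> complex) \<Rightarrow> ('v list \<Rightarrow> complex) \<Rightarrow> complex"
where
  "contraction 0 H e \<alpha> \<beta> = \<alpha> [] * cnj (\<beta> [])"
| "contraction (Suc k) H e \<alpha> \<beta> =
     (\<Sum>i\<in>UNIV. \<Sum>j\<in>UNIV. of_real (H $ i $ j) * contraction k H e (\<lambda>l. \<alpha> (e i # l)) (\<lambda>l. \<beta> (e j # l)))"

definition gram_matrix :: "('v \<Rightarrow> 'v \<Rightarrow> real) \<Rightarrow> ('i::finite \<Rightarrow> 'v) \<Rightarrow> real^'i^'i" where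
  "gram_matrix h e = (\<chi> i j. h (e i) (e j))"

text \<open>The vectors \<open>e i\<close> form a basis and \<open>c\<close> is the dual basis.\<close>

definition frame_coords :: "('i::finite \<Rightarrow> 'v::real_vector) \<Rightarrow> ('i \<Rightarrow> 'v \<Rightarrow> real) \<Rightarrow> bool" where
  "frame_coords e c \<longleftrightarrow> (\<forall>i. linear (c i)) \<and> (\<forall>x. x = (\<Sum>i\<in>UNIV. c i x *\<^sub>R e i)) \<and>
     (\<forall>i j. c i (e j) = (if i = j then 1 else 0))"

text \<open>If \<open>C\<close> is the matrix of coordinates of an orthonormal basis in the basis \<open>e\<close>, then
  \<open>C G C\<^sup>T = 1\<close> for the Gram matrix \<open>G\<close>, so \<open>C\<^sup>T C\<close> inverts \<open>G\<close>.\<close>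

lemma gram_matrix_inverse:
  fixes h :: "complex^'n::finite \<Rightarrow> complex^'n \<Rightarrow> real" and e :: "'i::finite \<Rightarrow> complex^'n"
  assumes h: "positive_definite h" and B: "orthonormal_basis h B" and c: "frame_coords e c"
  shows "invertible (gram_matrix h e)"
    and "matrix_inv (gram_matrix h e) $ i $ j = (\<Sum>b\<in>B. c i b * c j b)"
proof -
  note lin = positive_definiteD[OF h]
  have fin: "finite B" by (rule orthonormal_basis_card[OF h B])
  have c': "linear (c i)" "x = (\<Sum>i\<in>UNIV. c i x *\<^sub>R e i)" "c i (e j) = (if i = j then 1 else 0)"
    for i j x using c by (auto simp: frame_coords_def)
  define H where "H = ((\<chi> i j. \<Sum>b\<in>B. c i b * c j b) :: real^'i^'i)"
  have "(H ** gram_matrix h e) $ i $ j = (if i = j then 1 else 0)" for i j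
  proof -
    have "(H ** gram_matrix h e) $ i $ j = (\<Sum>k\<in>UNIV. (\<Sum>b\<in>B. c i b * c k b) * h (e k) (e j))"
      by (simp add: matrix_matrix_mult_def H_def gram_matrix_def)
    also have "\<dots> = (\<Sum>b\<in>B. c i b * (\<Sum>k\<in>UNIV. c k b * h (e k) (e j)))"
      unfolding sum_distrib_left sum_distrib_right by (subst sum.swap) (simp add: mult.assoc)
    also have "\<dots> = (\<Sum>b\<in>B. c i b * h b (e j))"
    proof (rule sum.cong[OF refl])
      fix b assume "b \<in> B"
      have "h b (e j) = h (\<Sum>k\<in>UNIV. c k b *\<^sub>R e k) (e j)" using c'(2)[of b] by simp
      also have "\<dots> = (\<Sum>k\<in>UNIV. c k b * h (e k) (e j))"
        unfolding linear_sum[OF lin(1)] linear_scale[OF lin(1)] by simp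
      finally show "c i b * (\<Sum>k\<in>UNIV. c k b * h (e k) (e j)) = c i b * h b (e j)" by simp
    qed
    also have "\<dots> = c i (\<Sum>b\<in>B. h (e j) b *\<^sub>R b)"
      unfolding linear_sum[OF c'(1)] linear_scale[OF c'(1)] using lin(3)
      by (simp add: mult.commute)
    also have "(\<Sum>b\<in>B. h (e j) b *\<^sub>R b) = e j"
      using orthonormal_expansion[OF h fin, of "e j"] B by (auto simp: orthonormal_basis_def)
    finally show ?thesis using c'(3) by simp
  qed
  then have HG: "H ** gram_matrix h e = mat 1" by (simp add: vec_eq_iff mat_def)
  then have GH: "gram_matrix h e ** H = mat 1" by (simp add: matrix_left_right_inverse)
  show inv: "invertible (gram_matrix h e)"
    using HG GH by (auto simp: invertible_def)
  have "matrix_inv (gram_matrix h e) = matrix_inv (gram_matrix h e) ** (gram_matrix h e ** H)"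
    by (simp add: GH)
  also have "\<dots> = H"
  proof -
    have "\<exists>H'. gram_matrix h e ** H' = mat 1 \<and> H' ** gram_matrix h e = mat 1"
      by (rule exI[of _ H], rule conjI[OF GH HG])
    from someI_ex[OF this] have "matrix_inv (gram_matrix h e) ** gram_matrix h e = mat 1"
      unfolding matrix_inv_def by (rule conjunct2)
    then show ?thesis by (simp add: matrix_mul_assoc)
  qed
  finally have "matrix_inv (gram_matrix h e) = H" .
  then show "matrix_inv (gram_matrix h e) $ i $ j = (\<Sum>b\<in>B. c i b * c j b)" by (simp add: H_def)
qed

text \<open>One slot at a time: for linear \<open>f\<close> and \<open>g\<close> the sum of \<open>f b * cnj (g b)\<close> over an
  orthonormal basis is expressed by the inverse Gram matrix.\<close>

lemma sum_orthonormal_eq_contraction: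
  fixes h :: "complex^'n::finite \<Rightarrow> complex^'n \<Rightarrow> real" and e :: "'i::finite \<Rightarrow> complex^'n"
  assumes h: "positive_definite h" and B: "orthonormal_basis h B" and c: "frame_coords e c"
  shows "alternating \<alpha> \<Longrightarrow> alternating \<beta> \<Longrightarrow>
    (\<Sum>l\<in>lists_of k B. \<alpha> l * cnj (\<beta> l)) = contraction k (matrix_inv (gram_matrix h e)) e \<alpha> \<beta>"
proof (induction k arbitrary: \<alpha> \<beta>)
  case 0
  have "lists_of 0 B = {[]}" by (auto simp: lists_of_def)
  then show ?case by simp
next
  case (Suc k)
  have fin: "finite B" by (rule orthonormal_basis_card[OF h B])
  define H where "H = matrix_inv (gram_matrix h e)"
  have H: "H $ i $ j = (\<Sum>b\<in>B. c i b * c j b)" for i j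
    unfolding H_def by (rule gram_matrix_inverse(2)[OF h B c])
  have pair: "(\<Sum>b\<in>B. f b * cnj (g b)) =
      (\<Sum>i\<in>UNIV. \<Sum>j\<in>UNIV. of_real (H $ i $ j) * (f (e i) * cnj (g (e j))))"
    if f: "linear f" and g: "linear g" for f g :: "complex^'n \<Rightarrow> complex"
  proof -
    have ex: "f' x = (\<Sum>i\<in>UNIV. of_real (c i x) * f' (e i))" if "linear f'" for f' :: "complex^'n \<Rightarrow> complex" and x
    proof -
      have "f' x = f' (\<Sum>i\<in>UNIV. c i x *\<^sub>R e i)" using c by (simp add: frame_coords_def)
      then show ?thesis
        unfolding linear_sum[OF that] linear_scale[OF that] by (simp add: scaleR_conv_of_real)
    qed
    have "(\<Sum>b\<in>B. f b * cnj (g b)) =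
        (\<Sum>b\<in>B. \<Sum>i\<in>UNIV. \<Sum>j\<in>UNIV. of_real (c i b * c j b) * (f (e i) * cnj (g (e j))))"
    proof (rule sum.cong[OF refl])
      fix b
      show "f b * cnj (g b) =
          (\<Sum>i\<in>UNIV. \<Sum>j\<in>UNIV. of_real (c i b * c j b) * (f (e i) * cnj (g (e j))))"
        by (subst ex[OF f], subst ex[OF g]) (simp add: sum_product mult_ac)
    qed
    also have "\<dots> = (\<Sum>i\<in>UNIV. \<Sum>j\<in>UNIV. \<Sum>b\<in>B. of_real (c i b * c j b) * (f (e i) * cnj (g (e j))))"
      by (subst sum.swap, rule sum.cong[OF refl], subst sum.swap) simp
    also have "\<dots> = (\<Sum>i\<in>UNIV. \<Sum>j\<in>UNIV. of_real (H $ i $ j) * (f (e i) * cnj (g (e j))))"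
      unfolding H of_real_sum sum_distrib_right ..
    finally show ?thesis .
  qed
  have "(\<Sum>l\<in>lists_of (Suc k) B. \<alpha> l * cnj (\<beta> l)) =
      (\<Sum>l\<in>lists_of k B. \<Sum>b\<in>B. \<alpha> (b # l) * cnj (\<beta> (b # l)))"
    unfolding sum_lists_of_Suc[OF fin] by (rule sum.swap)
  also have "\<dots> = (\<Sum>l\<in>lists_of k B. \<Sum>i\<in>UNIV. \<Sum>j\<in>UNIV.
      of_real (H $ i $ j) * (\<alpha> (e i # l) * cnj (\<beta> (e j # l))))"
  proof (rule sum.cong[OF refl])
    fix l
    have "linear (\<lambda>b. \<alpha> (b # l))" "linear (\<lambda>b. \<beta> (b # l))"
      using alternating_linear[OF Suc.prems(1), of "[]" l] alternating_linear[OF Suc.prems(2), of "[]" l]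
      by auto
    then show "(\<Sum>b\<in>B. \<alpha> (b # l) * cnj (\<beta> (b # l))) = (\<Sum>i\<in>UNIV. \<Sum>j\<in>UNIV.
      of_real (H $ i $ j) * (\<alpha> (e i # l) * cnj (\<beta> (e j # l))))" by (rule pair)
  qed
  also have "\<dots> = (\<Sum>i\<in>UNIV. \<Sum>j\<in>UNIV. \<Sum>l\<in>lists_of k B.
      of_real (H $ i $ j) * (\<alpha> (e i # l) * cnj (\<beta> (e j # l))))"
    by (subst sum.swap, rule sum.cong[OF refl], subst sum.swap) simp
  also have "\<dots> = contraction (Suc k) H e \<alpha> \<beta>"
    using Suc.IH[OF alternating_Cons[OF Suc.prems(1)] alternating_Cons[OF Suc.prems(2)]]
    by (simp add: sum_distrib_left[symmetric] H_def)
  finally show ?case by (simp add: H_def)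
qed

definition frame_lists :: "(complex^'n \<Rightarrow> complex^'n \<Rightarrow> real) \<Rightarrow> (complex^'n::finite) list set" where
  "frame_lists h = {l. distinct l \<and> set l \<subseteq> (SOME B. orthonormal_basis h B)}"

lemma form_inner_alt:
  "form_inner h \<alpha> \<beta> = (\<Sum>l\<in>frame_lists h. \<alpha> l * cnj (\<beta> l) / fact (length l))"
  unfolding form_inner_def frame_lists_def Let_def ..

lemma finite_frame_lists:
  assumes "positive_definite h"
  shows "finite (frame_lists h)"
proof -
  have "frame_lists h \<subseteq> {l. set l \<subseteq> (SOME B. orthonormal_basis h B) \<and> distinct l}"
    by (auto simp: frame_lists_def)
  then show ?thesis
    by (rule finite_subset)
      (rule finite_subset_distinct[OF orthonormal_basis_card(1)[OF assms orthonormal_basis_some[OF assms]]])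
qed

lemma form_inner_eq_contraction:
  fixes h :: "complex^'n::finite \<Rightarrow> complex^'n \<Rightarrow> real" and e :: "'i::finite \<Rightarrow> complex^'n"
  assumes h: "positive_definite h" and c: "frame_coords e c"
    and \<alpha>: "alternating \<alpha>" and \<beta>: "alternating \<beta>"
  shows "form_inner h \<alpha> \<beta> =
    (\<Sum>k\<le>DIM(complex^'n). contraction k (matrix_inv (gram_matrix h e)) e \<alpha> \<beta> / fact k)"
proof -
  define B where "B = (SOME B. orthonormal_basis h B)"
  have B: "orthonormal_basis h B" unfolding B_def by (rule orthonormal_basis_some[OF h])
  note fin = orthonormal_basis_card[OF h B]
  define U where "U = (\<Union>k\<in>{..DIM(complex^'n)}. lists_of k B)"
  have U: "finite U" unfolding U_def by (intro finite_UN_I finite_lists_of fin) simp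
  have sub: "frame_lists h \<subseteq> U"
  proof
    fix l assume "l \<in> frame_lists h"
    then have l: "distinct l" "set l \<subseteq> B" by (auto simp: frame_lists_def B_def)
    then have "length l \<le> DIM(complex^'n)"
      using card_mono[OF fin(1) l(2)] fin(2) by (simp add: distinct_card)
    then show "l \<in> U" using l by (auto simp: U_def lists_of_def)
  qed
  have "form_inner h \<alpha> \<beta> = (\<Sum>l\<in>U. \<alpha> l * cnj (\<beta> l) / fact (length l))"
    unfolding form_inner_alt
  proof (rule sum.mono_neutral_left[OF U sub], safe)
    fix l assume "l \<in> U" "l \<notin> frame_lists h"
    then have "\<not> distinct l" by (auto simp: U_def lists_of_def frame_lists_def B_def)
    then show "\<alpha> l * cnj (\<beta> l) / fact (length l) = 0"
      using alternating_not_distinct[OF \<alpha>] by simp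
  qed
  also have "\<dots> = (\<Sum>k\<le>DIM(complex^'n). \<Sum>l\<in>lists_of k B. \<alpha> l * cnj (\<beta> l) / fact (length l))"
    unfolding U_def by (rule sum.UNION_disjoint) (use finite_lists_of[OF fin(1)] in \<open>auto simp: lists_of_def\<close>)
  also have "\<dots> = (\<Sum>k\<le>DIM(complex^'n). (\<Sum>l\<in>lists_of k B. \<alpha> l * cnj (\<beta> l)) / fact k)"
    by (intro sum.cong refl) (auto simp: lists_of_def sum_divide_distrib)
  finally show ?thesis
    by (simp add: sum_orthonormal_eq_contraction[OF h B c \<alpha> \<beta>])
qed

lemma form_inner_cnj: "form_inner h \<beta> \<alpha> = cnj (form_inner h \<alpha> \<beta>)"
  unfolding form_inner_alt cnj_sum
  by (rule sum.cong[OF refl])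
    (simp only: complex_cnj_mult complex_cnj_divide complex_cnj_cnj complex_cnj_fact mult.commute)

lemma form_inner_self: "form_inner h \<alpha> \<alpha> = of_real (\<Sum>l\<in>frame_lists h. (cmod (\<alpha> l))\<^sup>2 / fact (length l))"
  unfolding form_inner_alt complex_norm_square[symmetric] by simp

lemma Re_form_inner_self:
  "Re (form_inner h \<alpha> \<alpha>) = (\<Sum>l\<in>frame_lists h. (cmod (\<alpha> l))\<^sup>2 / fact (length l))"
  unfolding form_inner_self Re_complex_of_real ..

lemma form_inner_self_nonneg: "0 \<le> Re (form_inner h \<alpha> \<alpha>)"
  unfolding Re_form_inner_self by (simp add: sum_nonneg)

lemma form_inner_self_real: "form_inner h \<alpha> \<alpha> = of_real (Re (form_inner h \<alpha> \<alpha>))"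
  unfolding Re_form_inner_self by (rule form_inner_self)

lemma form_inner_add_left: "form_inner h (\<lambda>l. \<alpha> l + \<alpha>' l) \<beta> = form_inner h \<alpha> \<beta> + form_inner h \<alpha>' \<beta>"
  unfolding form_inner_alt sum.distrib[symmetric]
  by (rule sum.cong[OF refl]) (simp only: add_divide_distrib distrib_right)

lemma form_inner_scale_left: "form_inner h (\<lambda>l. a * \<alpha> l) \<beta> = a * form_inner h \<alpha> \<beta>"
  unfolding form_inner_alt sum_distrib_left
  by (rule sum.cong[OF refl]) (simp only: mult.assoc times_divide_eq_right)

lemma form_inner_bound:
  "cmod (form_inner h \<alpha> \<beta>) \<le> Re (form_inner h \<alpha> \<alpha>) + Re (form_inner h \<beta> \<beta>)"
proof -
  have "cmod (form_inner h \<alpha> \<beta>) \<le> (\<Sum>l\<in>frame_lists h. cmod (\<alpha> l * cnj (\<beta> l) / fact (length l)))"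
    unfolding form_inner_alt by (rule norm_sum)
  also have "\<dots> \<le> (\<Sum>l\<in>frame_lists h. (cmod (\<alpha> l))\<^sup>2 / fact (length l) + (cmod (\<beta> l))\<^sup>2 / fact (length l))"
  proof (rule sum_mono)
    fix l
    have "cmod (\<alpha> l) * cmod (\<beta> l) \<le> (cmod (\<alpha> l))\<^sup>2 + (cmod (\<beta> l))\<^sup>2"
      using sum_squares_bound[of "cmod (\<alpha> l)" "cmod (\<beta> l)"]
        mult_nonneg_nonneg[OF norm_ge_zero[of "\<alpha> l"] norm_ge_zero[of "\<beta> l"]] by linarith
    then show "cmod (\<alpha> l * cnj (\<beta> l) / fact (length l)) \<le>
        (cmod (\<alpha> l))\<^sup>2 / fact (length l) + (cmod (\<beta> l))\<^sup>2 / fact (length l)"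
      by (simp add: norm_mult norm_divide add_divide_distrib[symmetric] divide_right_mono)
  qed
  finally show ?thesis unfolding Re_form_inner_self sum.distrib .
qed

lemma form_inner_add_bound:
  "Re (form_inner h (\<lambda>l. \<alpha> l + \<beta> l) (\<lambda>l. \<alpha> l + \<beta> l)) \<le>
    2 * Re (form_inner h \<alpha> \<alpha>) + 2 * Re (form_inner h \<beta> \<beta>)"
proof -
  have "(\<Sum>l\<in>frame_lists h. (cmod (\<alpha> l + \<beta> l))\<^sup>2 / fact (length l)) \<le>
      (\<Sum>l\<in>frame_lists h. 2 * ((cmod (\<alpha> l))\<^sup>2 / fact (length l)) + 2 * ((cmod (\<beta> l))\<^sup>2 / fact (length l)))"
  proof (rule sum_mono)
    fix l
    have "(cmod (\<alpha> l + \<beta> l))\<^sup>2 \<le> (cmod (\<alpha> l) + cmod (\<beta> l))\<^sup>2"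
      by (intro power_mono norm_triangle_ineq) simp
    also have "\<dots> \<le> 2 * (cmod (\<alpha> l))\<^sup>2 + 2 * (cmod (\<beta> l))\<^sup>2"
      using sum_squares_bound[of "cmod (\<alpha> l)" "cmod (\<beta> l)"] by (simp add: power2_sum)
    finally have "(cmod (\<alpha> l + \<beta> l))\<^sup>2 / fact (length l) \<le>
        (2 * (cmod (\<alpha> l))\<^sup>2 + 2 * (cmod (\<beta> l))\<^sup>2) / fact (length l)"
      by (rule divide_right_mono) simp
    then show "(cmod (\<alpha> l + \<beta> l))\<^sup>2 / fact (length l) \<le>
        2 * ((cmod (\<alpha> l))\<^sup>2 / fact (length l)) + 2 * ((cmod (\<beta> l))\<^sup>2 / fact (length l))"
      by (simp add: add_divide_distrib)
  qed
  then show ?thesis unfolding Re_form_inner_self sum.distrib sum_distrib_left .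
qed

lemma convergent_scaleR:
  fixes X :: "nat \<Rightarrow> 'b::real_normed_vector"
  assumes "convergent X"
  shows "convergent (\<lambda>n. r *\<^sub>R X n)"
proof -
  obtain L where "X \<longlonglongrightarrow> L" using assms by (auto simp: convergent_def)
  then have "(\<lambda>n. r *\<^sub>R X n) \<longlonglongrightarrow> r *\<^sub>R L" by (rule tendsto_scaleR[OF tendsto_const])
  then show ?thesis by (rule convergentI)
qed

text \<open>Convergence on lists of basis vectors spreads to all lists, replacing the entries from the
  left one after the other: the vectors for which convergence holds in a given slot form a
  subspace. Lists with a repeated entry contribute zero.\<close>

lemma convergent_form_values:
  fixes h :: "complex^'n::finite \<Rightarrow> complex^'n \<Rightarrow> real"
  assumes h: "positive_definite h" and alt: "\<And>k. alternating (\<alpha> k)"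
    and C: "\<And>l. l \<in> frame_lists h \<Longrightarrow> convergent (\<lambda>k. \<alpha> k l)"
  shows "convergent (\<lambda>k. \<alpha> k l)"
proof -
  define B where "B = (SOME B. orthonormal_basis h B)"
  have B: "orthonormal_basis h B" unfolding B_def by (rule orthonormal_basis_some[OF h])
  have "\<forall>ys. set ys \<subseteq> B \<longrightarrow> convergent (\<lambda>k. \<alpha> k (xs @ ys))" for xs
  proof (induction xs rule: rev_induct)
    case Nil
    show ?case
    proof safe
      fix ys assume ys: "set ys \<subseteq> B"
      show "convergent (\<lambda>k. \<alpha> k ([] @ ys))"
      proof (cases "distinct ys")
        case True
        then show ?thesis using C ys by (simp add: frame_lists_def B_def)
      next
        case False
        then show ?thesis using alternating_not_distinct[OF alt] by (simp add: convergent_const)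
      qed
    qed
  next
    case (snoc v xs)
    show ?case
    proof safe
      fix ys assume ys: "set ys \<subseteq> B"
      have lin: "linear (\<lambda>v. \<alpha> k (xs @ v # ys))" for k by (rule alternating_linear[OF alt])
      have "subspace {v. convergent (\<lambda>k. \<alpha> k (xs @ v # ys))}"
        unfolding subspace_def
        by (auto simp: linear_0[OF lin] linear_add[OF lin] linear_scale[OF lin]
            intro!: convergent_const convergent_add convergent_scaleR)
      moreover have "convergent (\<lambda>k. \<alpha> k (xs @ b # ys))" if "b \<in> B" for b
        using snoc.IH ys that by (metis insert_subset list.simps(15))
      moreover have "v \<in> span B" using B by (simp add: orthonormal_basis_def)
      ultimately have "convergent (\<lambda>k. \<alpha> k (xs @ v # ys))"
        using span_induct[of v B "\<lambda>v. convergent (\<lambda>k. \<alpha> k (xs @ v # ys))"] by blast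
      then show "convergent (\<lambda>k. \<alpha> k ((xs @ [v]) @ ys))" by simp
    qed
  qed
  from this[of l] show ?thesis by (metis append_Nil2 empty_subsetI list.set(1))
qed

lemma alternating_limit:
  assumes alt: "\<And>k. alternating (\<alpha> k)" and lim: "\<And>l. (\<lambda>k. \<alpha> k l) \<longlonglongrightarrow> \<beta> l"
  shows "alternating \<beta>"
  unfolding alternating_def
proof (intro conjI allI)
  fix xs ys :: "(complex^'a) list"
  have lin: "linear (\<lambda>v. \<alpha> k (xs @ v # ys))" for k by (rule alternating_linear[OF alt])
  show "linear (\<lambda>v. \<beta> (xs @ v # ys))"
  proof (rule linearI)
    fix v w :: "complex^'a" and r :: real
    show "\<beta> (xs @ (v + w) # ys) = \<beta> (xs @ v # ys) + \<beta> (xs @ w # ys)"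
      using lim[of "xs @ (v + w) # ys"] tendsto_add[OF lim[of "xs @ v # ys"] lim[of "xs @ w # ys"]]
      unfolding linear_add[OF lin] by (rule LIMSEQ_unique)
    show "\<beta> (xs @ (r *\<^sub>R v) # ys) = r *\<^sub>R \<beta> (xs @ v # ys)"
      using lim[of "xs @ (r *\<^sub>R v) # ys"] tendsto_scaleR[OF tendsto_const lim[of "xs @ v # ys"]]
      unfolding linear_scale[OF lin] by (rule LIMSEQ_unique)
  qed
next
  fix xs ys zs and v :: "complex^'a"
  show "\<beta> (xs @ v # ys @ v # zs) = 0"
    using lim[of "xs @ v # ys @ v # zs"]
    by (simp add: alternating_repeat[OF alt] LIMSEQ_const_iff)
qed


section \<open>Smooth maps and second derivatives\<close>

lemma smooth_on_continuous_on: "smooth_on S f \<Longrightarrow> continuous_on S f"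
  unfolding smooth_on_def by (metis C_diff_on.simps(1))

lemma smooth_on_differentiable: "smooth_on S f \<Longrightarrow> x \<in> S \<Longrightarrow> f differentiable (at x)"
  unfolding smooth_on_def by (metis C_diff_on.simps(2))

lemma smooth_on_derivative: "smooth_on S f \<Longrightarrow> smooth_on S (\<lambda>x. frechet_derivative f (at x) v)"
  unfolding smooth_on_def by (metis C_diff_on.simps(2))

lemma C_diff_on_subset: "C_diff_on k S f \<Longrightarrow> T \<subseteq> S \<Longrightarrow> C_diff_on k T f"
  by (induction k arbitrary: f) (auto intro: continuous_on_subset)

lemma smooth_on_subset: "smooth_on S f \<Longrightarrow> T \<subseteq> S \<Longrightarrow> smooth_on T f"
  unfolding smooth_on_def using C_diff_on_subset by blast

lemma differentiable_has_derivative: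
  "f differentiable (at x) \<Longrightarrow> (f has_derivative frechet_derivative f (at x)) (at x)"
  by (simp add: frechet_derivative_works)

lemma frechet_derivative_linear: "f differentiable (at x) \<Longrightarrow> linear (frechet_derivative f (at x))"
  using differentiable_has_derivative has_derivative_linear by blast

lemma has_derivative_cong_open:
  assumes "(f has_derivative f') (at x)" "open S" "x \<in> S" "\<And>y. y \<in> S \<Longrightarrow> f y = g y"
  shows "(g has_derivative f') (at x)"
  using has_derivative_transform_within_open[OF assms(1,2,3)] assms(4) by blast

lemma differentiable_cong_open:
  assumes "f differentiable (at x)" "open S" "x \<in> S" "\<And>y. y \<in> S \<Longrightarrow> f y = g y"
  shows "g differentiable (at x)"
  using has_derivative_cong_open[OF differentiable_has_derivative[OF assms(1)] assms(2-4)]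
  by (rule differentiableI)

lemma frechet_derivative_cong_open:
  assumes "f differentiable (at x)" "open S" "x \<in> S" "\<And>y. y \<in> S \<Longrightarrow> f y = g y"
  shows "frechet_derivative g (at x) = frechet_derivative f (at x)"
  by (rule frechet_derivative_at[symmetric])
    (rule has_derivative_cong_open[OF differentiable_has_derivative[OF assms(1)] assms(2-4)])

lemma C_diff_on_cong:
  assumes S: "open S"
  shows "C_diff_on k S f \<Longrightarrow> (\<And>x. x \<in> S \<Longrightarrow> f x = g x) \<Longrightarrow> C_diff_on k S g"
proof (induction k arbitrary: f g)
  case 0
  then show ?case using continuous_on_cong[OF refl] by (metis C_diff_on.simps(1))
next
  case (Suc k)
  have d: "f differentiable (at x)" if "x \<in> S" for x using Suc.prems(1) that by simp
  have "g differentiable (at x)" if "x \<in> S" for x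
    by (rule differentiable_cong_open[OF d[OF that] S that Suc.prems(2)])
  moreover have "C_diff_on k S (\<lambda>x. frechet_derivative g (at x) v)" for v
  proof (rule Suc.IH)
    show "C_diff_on k S (\<lambda>x. frechet_derivative f (at x) v)" using Suc.prems(1) by simp
    show "frechet_derivative f (at x) v = frechet_derivative g (at x) v" if "x \<in> S" for x
      using frechet_derivative_cong_open[OF d[OF that] S that Suc.prems(2)] by simp
  qed
  ultimately show ?case by simp
qed

lemma smooth_on_cong:
  "open S \<Longrightarrow> smooth_on S f \<Longrightarrow> (\<And>x. x \<in> S \<Longrightarrow> f x = g x) \<Longrightarrow> smooth_on S g"
  unfolding smooth_on_def using C_diff_on_cong by blast

lemma C_diff_on_bounded_linear:
  assumes S: "open S" and L: "bounded_linear L"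
  shows "C_diff_on k S f \<Longrightarrow> C_diff_on k S (\<lambda>x. L (f x))"
proof (induction k arbitrary: f)
  case 0
  then show ?case using bounded_linear.continuous_on[OF L] by simp
next
  case (Suc k)
  have h: "((\<lambda>x. L (f x)) has_derivative (\<lambda>v. L (frechet_derivative f (at x) v))) (at x)"
    if "x \<in> S" for x
    using Suc.prems that by (intro bounded_linear.has_derivative[OF L] differentiable_has_derivative) simp
  have "C_diff_on k S (\<lambda>x. frechet_derivative (\<lambda>x. L (f x)) (at x) v)" for v
  proof (rule C_diff_on_cong[OF S])
    show "C_diff_on k S (\<lambda>x. L (frechet_derivative f (at x) v))"
      using Suc.prems by (intro Suc.IH) simp
    show "L (frechet_derivative f (at x) v) = frechet_derivative (\<lambda>x. L (f x)) (at x) v"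
      if "x \<in> S" for x using frechet_derivative_at[OF h[OF that]] by (metis)
  qed
  moreover have "(\<lambda>x. L (f x)) differentiable (at x)" if "x \<in> S" for x
    using h[OF that] by (rule differentiableI)
  ultimately show ?case by simp
qed

lemma C_diff_on_add:
  assumes S: "open S"
  shows "C_diff_on k S f \<Longrightarrow> C_diff_on k S g \<Longrightarrow> C_diff_on k S (\<lambda>x. f x + g x)"
proof (induction k arbitrary: f g)
  case 0
  then show ?case by (simp add: continuous_on_add)
next
  case (Suc k)
  have h: "((\<lambda>x. f x + g x) has_derivative
      (\<lambda>v. frechet_derivative f (at x) v + frechet_derivative g (at x) v)) (at x)"
    if "x \<in> S" for x
    using Suc.prems that by (intro has_derivative_add differentiable_has_derivative) auto
  have "C_diff_on k S (\<lambda>x. frechet_derivative (\<lambda>x. f x + g x) (at x) v)" for v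
  proof (rule C_diff_on_cong[OF S])
    show "C_diff_on k S (\<lambda>x. frechet_derivative f (at x) v + frechet_derivative g (at x) v)"
      using Suc.prems by (intro Suc.IH) simp_all
    show "frechet_derivative f (at x) v + frechet_derivative g (at x) v =
        frechet_derivative (\<lambda>x. f x + g x) (at x) v"
      if "x \<in> S" for x using frechet_derivative_at[OF h[OF that]] by (metis)
  qed
  moreover have "(\<lambda>x. f x + g x) differentiable (at x)" if "x \<in> S" for x
    using h[OF that] by (rule differentiableI)
  ultimately show ?case by simp
qed

lemma smooth_on_add: "open S \<Longrightarrow> smooth_on S f \<Longrightarrow> smooth_on S g \<Longrightarrow> smooth_on S (\<lambda>x. f x + g x)"
  by (simp add: smooth_on_def C_diff_on_add)

lemma smooth_on_mult_left:
  fixes f :: "'a::real_normed_vector \<Rightarrow> complex"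
  shows "open S \<Longrightarrow> smooth_on S f \<Longrightarrow> smooth_on S (\<lambda>x. a * f x)"
  unfolding smooth_on_def using C_diff_on_bounded_linear[OF _ bounded_linear_mult_right] by blast

lemma C_diff_on_zero: "C_diff_on k S (\<lambda>x. 0)"
  by (induction k) simp_all

lemma smooth_on_zero: "smooth_on S (\<lambda>x. 0)"
  by (simp add: smooth_on_def C_diff_on_zero)

lemma smooth_on_sum:
  assumes "open S" "\<And>i. i \<in> I \<Longrightarrow> smooth_on S (f i)"
  shows "smooth_on S (\<lambda>x. \<Sum>i\<in>I. f i x)"
  using assms(2)
  by (induction I rule: infinite_finite_induct) (simp_all add: smooth_on_zero smooth_on_add[OF assms(1)])

text \<open>The mean value theorem, applied first in the direction \<open>v\<close> and then in the direction \<open>w\<close>.\<close>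

lemma second_difference_mean_value:
  fixes F :: "'a::real_normed_vector \<Rightarrow> real"
  assumes h: "h > 0" and P: "\<And>s t. 0 \<le> s \<Longrightarrow> s \<le> h \<Longrightarrow> 0 \<le> t \<Longrightarrow> t \<le> h \<Longrightarrow> x + s *\<^sub>R v + t *\<^sub>R w \<in> S"
    and F: "\<And>y. y \<in> S \<Longrightarrow> F differentiable (at y)"
    and F': "\<And>y. y \<in> S \<Longrightarrow> (\<lambda>z. frechet_derivative F (at z) v) differentiable (at y)"
  obtains s t where "0 < s" "s < h" "0 < t" "t < h"
    "F (x + h *\<^sub>R v + h *\<^sub>R w) - F (x + h *\<^sub>R v) - F (x + h *\<^sub>R w) + F x =
      h * h * frechet_derivative (\<lambda>z. frechet_derivative F (at z) v) (at (x + s *\<^sub>R v + t *\<^sub>R w)) w"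
proof -
  define D where "D = (\<lambda>z. frechet_derivative F (at z) v)"
  have line: "((\<lambda>s. g (y + s *\<^sub>R u)) has_field_derivative frechet_derivative g (at (y + s *\<^sub>R u)) u) (at s)"
    if "g differentiable (at (y + s *\<^sub>R u))" for g :: "'a \<Rightarrow> real" and y u s
  proof -
    have "((\<lambda>s. y + s *\<^sub>R u) has_derivative (\<lambda>r. r *\<^sub>R u)) (at s)"
      by (auto intro!: derivative_eq_intros)
    from has_derivative_compose[OF this differentiable_has_derivative[OF that]]
    have "((\<lambda>s. g (y + s *\<^sub>R u)) has_derivative
        (\<lambda>r. frechet_derivative g (at (y + s *\<^sub>R u)) (r *\<^sub>R u))) (at s)" .
    then show ?thesis
      using linear_scale[OF frechet_derivative_linear[OF that]]
      by (simp add: has_field_derivative_def mult.commute[of _ "frechet_derivative g _ u"])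
  qed
  have "\<exists>s>0. s < h \<and> (F (x + h *\<^sub>R w + h *\<^sub>R v) - F (x + h *\<^sub>R v)) - (F (x + h *\<^sub>R w + 0 *\<^sub>R v) - F (x + 0 *\<^sub>R v)) =
      (h - 0) * (D (x + h *\<^sub>R w + s *\<^sub>R v) - D (x + s *\<^sub>R v))"
  proof (rule MVT2[OF h])
    fix s assume s: "0 \<le> s" "s \<le> h"
    have "x + h *\<^sub>R w + s *\<^sub>R v \<in> S" "x + s *\<^sub>R v \<in> S"
      using P[of s h] P[of s 0] s h by (simp_all add: algebra_simps)
    then show "((\<lambda>s. F (x + h *\<^sub>R w + s *\<^sub>R v) - F (x + s *\<^sub>R v)) has_real_derivative
        D (x + h *\<^sub>R w + s *\<^sub>R v) - D (x + s *\<^sub>R v)) (at s)"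
      unfolding D_def by (intro DERIV_diff line F)
  qed
  then obtain s where s: "0 < s" "s < h"
    "F (x + h *\<^sub>R v + h *\<^sub>R w) - F (x + h *\<^sub>R v) - F (x + h *\<^sub>R w) + F x =
      h * (D (x + h *\<^sub>R w + s *\<^sub>R v) - D (x + s *\<^sub>R v))"
    by (auto simp: algebra_simps)
  have "\<exists>t>0. t < h \<and> D (x + s *\<^sub>R v + h *\<^sub>R w) - D (x + s *\<^sub>R v + 0 *\<^sub>R w) =
      (h - 0) * frechet_derivative D (at (x + s *\<^sub>R v + t *\<^sub>R w)) w"
  proof (rule MVT2[OF h])
    fix t assume t: "0 \<le> t" "t \<le> h"
    have "x + s *\<^sub>R v + t *\<^sub>R w \<in> S" using P[of s t] s t by simp
    then show "((\<lambda>t. D (x + s *\<^sub>R v + t *\<^sub>R w)) has_real_derivative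
        frechet_derivative D (at (x + s *\<^sub>R v + t *\<^sub>R w)) w) (at t)"
      using F' unfolding D_def by (intro line)
  qed
  then obtain t where t: "0 < t" "t < h" "D (x + s *\<^sub>R v + h *\<^sub>R w) - D (x + s *\<^sub>R v) =
      h * frechet_derivative D (at (x + s *\<^sub>R v + t *\<^sub>R w)) w" by auto
  have "x + h *\<^sub>R w + s *\<^sub>R v = x + s *\<^sub>R v + h *\<^sub>R w" by (simp add: algebra_simps)
  with s(3) t(3) have "F (x + h *\<^sub>R v + h *\<^sub>R w) - F (x + h *\<^sub>R v) - F (x + h *\<^sub>R w) + F x =
      h * h * frechet_derivative D (at (x + s *\<^sub>R v + t *\<^sub>R w)) w"
    by (simp add: mult.assoc)
  then show ?thesis using that s t unfolding D_def by blast
qed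

text \<open>The second difference over a small parallelogram is symmetric in \<open>v\<close> and \<open>w\<close>, and by the
  mean value theorem it is close to \<open>h\<^sup>2\<close> times either mixed derivative at \<open>x\<close>.\<close>

lemma second_derivative_symmetric_real:
  fixes F :: "'a::real_normed_vector \<Rightarrow> real"
  assumes S: "open S" "x \<in> S" and F: "smooth_on S F"
  shows "frechet_derivative (\<lambda>z. frechet_derivative F (at z) v) (at x) w =
    frechet_derivative (\<lambda>z. frechet_derivative F (at z) w) (at x) v"
proof -
  define D where "D = (\<lambda>v w y. frechet_derivative (\<lambda>z. frechet_derivative F (at z) v) (at y) w)"
  have cont: "continuous_on S (D v w)" for v w
    unfolding D_def using F by (intro smooth_on_continuous_on smooth_on_derivative)
  have "\<bar>D v w x - D w v x\<bar> < e" if e: "e > 0" for e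
  proof -
    obtain d0 where d0: "d0 > 0" "ball x d0 \<subseteq> S" using S open_contains_ball by blast
    have near: "\<exists>d>0. \<forall>y\<in>S. dist y x < d \<longrightarrow> \<bar>D a b y - D a b x\<bar> < e / 2" for a b
      using cont[of a b, unfolded continuous_on_iff, rule_format, OF S(2), of "e / 2"] e
      by (simp add: dist_real_def)
    obtain d1 where d1: "d1 > 0" "\<And>y. y \<in> S \<Longrightarrow> dist y x < d1 \<Longrightarrow> \<bar>D v w y - D v w x\<bar> < e / 2"
      using near by blast
    obtain d2 where d2: "d2 > 0" "\<And>y. y \<in> S \<Longrightarrow> dist y x < d2 \<Longrightarrow> \<bar>D w v y - D w v x\<bar> < e / 2"
      using near by blast
    define d where "d = min d0 (min d1 d2)"
    define h where "h = d / (norm v + norm w + 1)"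
    have d: "d > 0" using d0 d1 d2 by (simp add: d_def)
    have pos: "norm v + norm w + 1 > 0" using norm_ge_zero[of v] norm_ge_zero[of w] by linarith
    have h: "h > 0" using d pos by (simp add: h_def)
    have small: "dist (x + s *\<^sub>R a + t *\<^sub>R b) x < d"
      if st: "0 \<le> s" "s \<le> h" "0 \<le> t" "t \<le> h" and ab: "norm a + norm b = norm v + norm w" for s t a b
    proof -
      have "dist (x + s *\<^sub>R a + t *\<^sub>R b) x = norm (s *\<^sub>R a + t *\<^sub>R b)"
        by (simp add: dist_norm add.assoc)
      also have "\<dots> \<le> s * norm a + t * norm b"
        using norm_triangle_ineq[of "s *\<^sub>R a" "t *\<^sub>R b"] st by simp
      also have "\<dots> \<le> h * norm a + h * norm b"
        using st by (intro add_mono mult_right_mono) auto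
      also have "\<dots> = h * (norm v + norm w)" using ab by (simp add: distrib_left[symmetric])
      also have "\<dots> < h * (norm v + norm w + 1)" using h by simp
      also have "\<dots> = d" using pos by (simp add: h_def)
      finally show ?thesis .
    qed
    have inS: "y \<in> S" if "dist y x < d" for y
      using that d0(2) by (auto simp: d_def dist_commute)
    obtain s t where st: "0 < s" "s < h" "0 < t" "t < h"
      "F (x + h *\<^sub>R v + h *\<^sub>R w) - F (x + h *\<^sub>R v) - F (x + h *\<^sub>R w) + F x =
      h * h * D v w (x + s *\<^sub>R v + t *\<^sub>R w)"
    proof (rule second_difference_mean_value[OF h, of x v w S F])
      show "x + s *\<^sub>R v + t *\<^sub>R w \<in> S" if "0 \<le> s" "s \<le> h" "0 \<le> t" "t \<le> h" for s t
        using inS small that by blast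
    qed (use smooth_on_differentiable[OF F] smooth_on_differentiable[OF smooth_on_derivative[OF F]]
          in \<open>auto simp: D_def\<close>)
    obtain s' t' where st': "0 < s'" "s' < h" "0 < t'" "t' < h"
      "F (x + h *\<^sub>R w + h *\<^sub>R v) - F (x + h *\<^sub>R w) - F (x + h *\<^sub>R v) + F x =
      h * h * D w v (x + s' *\<^sub>R w + t' *\<^sub>R v)"
    proof (rule second_difference_mean_value[OF h, of x w v S F])
      show "x + s *\<^sub>R w + t *\<^sub>R v \<in> S" if "0 \<le> s" "s \<le> h" "0 \<le> t" "t \<le> h" for s t
        using inS small[of s t w v] that by (simp add: add.commute)
    qed (use smooth_on_differentiable[OF F] smooth_on_differentiable[OF smooth_on_derivative[OF F]]
          in \<open>auto simp: D_def\<close>)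
    have comm: "x + h *\<^sub>R w + h *\<^sub>R v = x + h *\<^sub>R v + h *\<^sub>R w" by (simp add: algebra_simps)
    have "h * h * D v w (x + s *\<^sub>R v + t *\<^sub>R w) = h * h * D w v (x + s' *\<^sub>R w + t' *\<^sub>R v)"
      using st(5) st'(5)[unfolded comm] by linarith
    then have eq: "D v w (x + s *\<^sub>R v + t *\<^sub>R w) = D w v (x + s' *\<^sub>R w + t' *\<^sub>R v)"
      using h by simp
    have "dist (x + s *\<^sub>R v + t *\<^sub>R w) x < d" "dist (x + s' *\<^sub>R w + t' *\<^sub>R v) x < d"
      using small[of s t v w] small[of s' t' w v] st st' by (simp_all add: add.commute)
    then have "\<bar>D v w (x + s *\<^sub>R v + t *\<^sub>R w) - D v w x\<bar> < e / 2"
      "\<bar>D w v (x + s' *\<^sub>R w + t' *\<^sub>R v) - D w v x\<bar> < e / 2"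
      using d1(2) d2(2) inS by (simp_all add: d_def)
    then show ?thesis using eq by linarith
  qed
  then have "\<bar>D v w x - D w v x\<bar> \<le> 0" by (meson less_irrefl not_le)
  then show ?thesis by (simp add: D_def)
qed

lemma second_derivative_symmetric:
  fixes f :: "'a::real_normed_vector \<Rightarrow> 'b::euclidean_space"
  assumes S: "open S" "x \<in> S" and f: "smooth_on S f"
  shows "frechet_derivative (\<lambda>z. frechet_derivative f (at z) v) (at x) w =
    frechet_derivative (\<lambda>z. frechet_derivative f (at z) w) (at x) v"
proof (rule euclidean_eqI)
  fix b :: 'b assume "b \<in> Basis"
  have d1: "frechet_derivative (\<lambda>z. g z \<bullet> b) (at y) = (\<lambda>v. frechet_derivative g (at y) v \<bullet> b)"
    if "smooth_on S g" "y \<in> S" for g :: "'a \<Rightarrow> 'b" and y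
    using has_derivative_inner_left[OF differentiable_has_derivative[OF smooth_on_differentiable[OF that]], of b]
    by (rule frechet_derivative_at[symmetric])
  have d2: "frechet_derivative (\<lambda>z. frechet_derivative (\<lambda>z. f z \<bullet> b) (at z) v) (at x) w =
      frechet_derivative (\<lambda>z. frechet_derivative f (at z) v) (at x) w \<bullet> b" for v w
  proof -
    have sm: "smooth_on S (\<lambda>z. frechet_derivative f (at z) v)" by (rule smooth_on_derivative[OF f])
    have "frechet_derivative (\<lambda>z. frechet_derivative (\<lambda>z. f z \<bullet> b) (at z) v) (at x) =
        frechet_derivative (\<lambda>z. frechet_derivative f (at z) v \<bullet> b) (at x)"
    proof (rule frechet_derivative_cong_open[OF _ S])
      show "(\<lambda>z. frechet_derivative f (at z) v \<bullet> b) differentiable (at x)"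
        using smooth_on_differentiable[OF sm S(2)] by simp
    qed (simp add: d1[OF f])
    then show ?thesis by (simp add: d1[OF sm S(2)])
  qed
  have "smooth_on S (\<lambda>z. f z \<bullet> b)"
    using f C_diff_on_bounded_linear[OF S(1) bounded_linear_inner_left] unfolding smooth_on_def by blast
  from second_derivative_symmetric_real[OF S this]
  show "frechet_derivative (\<lambda>z. frechet_derivative f (at z) v) (at x) w \<bullet> b =
    frechet_derivative (\<lambda>z. frechet_derivative f (at z) w) (at x) v \<bullet> b"
    by (simp add: d2)
qed


section \<open>Alternating sums and multilinear product rule\<close>

lemma remove_nth_Cons: "remove_nth 0 (a # l) = l" "remove_nth (Suc i) (a # l) = a # remove_nth i l"
  by (simp_all add: remove_nth_def)

text \<open>For \<open>K v\<close> the derivative of the coefficients of a form in the direction \<open>v\<close>, this is the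
  formula for the exterior derivative.\<close>

definition alt_sum :: "('v \<Rightarrow> 'v list \<Rightarrow> complex) \<Rightarrow> 'v list \<Rightarrow> complex" where
  "alt_sum K l = (\<Sum>i<length l. (-1) ^ i * K (l ! i) (remove_nth i l))"

lemma alt_sum_Nil: "alt_sum K [] = 0"
  by (simp add: alt_sum_def)

lemma alt_sum_Cons: "alt_sum K (a # l) = K a l - alt_sum (\<lambda>v m. K v (a # m)) l"
  unfolding alt_sum_def length_Cons sum.lessThan_Suc_shift
  by (simp add: remove_nth_Cons sum_negf)

lemma alt_sum_add: "alt_sum (\<lambda>v m. K v m + K' v m) l = alt_sum K l + alt_sum K' l"
  by (simp add: alt_sum_def distrib_left sum.distrib)

lemma alt_sum_scale: "alt_sum (\<lambda>v m. c * K v m) l = c * alt_sum K l"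
  by (simp add: alt_sum_def sum_distrib_left mult.left_commute)

lemma alt_sum_diff: "alt_sum (\<lambda>v m. K v m - K' v m) l = alt_sum K l - alt_sum K' l"
  by (simp add: alt_sum_def right_diff_distrib sum_subtractf)

lemma alt_sum_zero: "alt_sum (\<lambda>v m. 0) l = 0"
  by (simp add: alt_sum_def)

lemma alt_sum_map: "alt_sum K (map f l) = alt_sum (\<lambda>v m. K (f v) (map f m)) l"
  unfolding alt_sum_def by (intro sum.cong) (auto simp: remove_nth_def take_map drop_map)

text \<open>The identity behind \<open>d\<^sup>2 = 0\<close>: removing \<open>v\<close> and \<open>w\<close> in one order or in the other
  produces opposite signs.\<close>

lemma alt_sum_iterated_symmetric:
  assumes "\<And>v w m. H v w m = H w v m"
  shows "alt_sum (\<lambda>v. alt_sum (H v)) l = 0"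
  using assms
proof (induction l arbitrary: H)
  case Nil
  show ?case by (simp add: alt_sum_Nil)
next
  case (Cons c l)
  have "alt_sum (\<lambda>v. alt_sum (H v)) (c # l) = alt_sum (H c) l - alt_sum (\<lambda>v m. alt_sum (H v) (c # m)) l"
    by (simp add: alt_sum_Cons)
  also have "\<dots> = alt_sum (H c) l - (alt_sum (\<lambda>v. H v c) l - alt_sum (\<lambda>v. alt_sum (\<lambda>w m. H v w (c # m))) l)"
    by (simp add: alt_sum_Cons alt_sum_diff)
  also have "(\<lambda>v. H v c) = H c" by (rule ext, rule ext, rule Cons.prems)
  also have "alt_sum (\<lambda>v. alt_sum (\<lambda>w m. H v w (c # m))) l = 0"
    by (rule Cons.IH) (rule Cons.prems)
  finally show ?case by simp
qed

lemma alternating_swap: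
  assumes "alternating \<alpha>"
  shows "\<alpha> (xs @ v # w # ys) = - \<alpha> (xs @ w # v # ys)"
proof -
  have l1: "\<alpha> (xs @ (a + b) # ys) = \<alpha> (xs @ a # ys) + \<alpha> (xs @ b # ys)" for xs ys a b
    by (rule linear_add[OF alternating_linear[OF assms]])
  have z: "\<alpha> (xs @ a # a # ys) = 0" for a using alternating_repeat[OF assms, of xs a "[]" ys] by simp
  have "0 = \<alpha> (xs @ (v + w) # (v + w) # ys)" using z by simp
  also have "\<dots> = \<alpha> (xs @ v # (v + w) # ys) + \<alpha> (xs @ w # (v + w) # ys)" by (rule l1)
  also have "\<dots> = \<alpha> (xs @ v # w # ys) + \<alpha> (xs @ w # v # ys)"
    using l1[of "xs @ [v]" v w ys] l1[of "xs @ [w]" v w ys] z by simp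
  finally show ?thesis by (simp add: eq_neg_iff_add_eq_0)
qed

lemma alternating_move_front:
  assumes "alternating \<alpha>"
  shows "\<alpha> (xs @ v # ys) = (-1) ^ length xs * \<alpha> (v # xs @ ys)"
proof (induction xs arbitrary: ys rule: rev_induct)
  case Nil
  show ?case by simp
next
  case (snoc a xs)
  have "\<alpha> ((xs @ [a]) @ v # ys) = - \<alpha> (xs @ v # a # ys)"
    using alternating_swap[OF assms, of xs a v ys] by simp
  then show ?case using snoc.IH[of "a # ys"] by simp
qed

text \<open>Only the term that removes \<open>v\<close> survives.\<close>

lemma alt_sum_removes:
  assumes "\<And>w xs ys. L w (xs @ v # ys) = 0"
  shows "alt_sum L (ys @ v # zs) = (-1) ^ length ys * L v (ys @ zs)"
  using assms
proof (induction ys arbitrary: L)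
  case Nil
  have "alt_sum (\<lambda>w m. L w (v # m)) zs = 0"
    using Nil[of _ "[]"] by (simp add: alt_sum_zero)
  then show ?case by (simp add: alt_sum_Cons)
next
  case (Cons y ys)
  have "alt_sum (\<lambda>w m. L w (y # m)) (ys @ v # zs) = (-1) ^ length ys * L v (y # ys @ zs)"
    using Cons.prems[of _ "y # _"] by (intro Cons.IH) simp
  then show ?case using Cons.prems[of y ys zs] by (simp add: alt_sum_Cons)
qed

lemma linear_alt_sum:
  assumes K1: "\<And>m. linear (\<lambda>v. K v m)" and K2: "\<And>v. alternating (K v)"
  shows "linear (\<lambda>v. alt_sum K (xs @ v # ys))"
  using assms
proof (induction xs arbitrary: K)
  case Nil
  have "linear (\<lambda>v. \<Sum>i<length ys. (-1) ^ i * K (ys ! i) (v # remove_nth i ys))"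
  proof (intro linear_compose_sum ballI)
    fix i
    have "linear (\<lambda>v. K (ys ! i) (v # remove_nth i ys))"
      using alternating_linear[OF Nil(2), of "ys ! i" "[]"] by simp
    then show "linear (\<lambda>v. (-1) ^ i * K (ys ! i) (v # remove_nth i ys))"
      using linear_compose[of _ "\<lambda>z. (-1) ^ i * z"] bounded_linear.linear[OF bounded_linear_mult_right]
      unfolding comp_def by blast
  qed
  then have "linear (\<lambda>v. K v ys - alt_sum (\<lambda>w m. K w (v # m)) ys)"
    unfolding alt_sum_def by (intro linear_compose_sub Nil(1))
  then show ?case by (simp add: alt_sum_Cons)
next
  case (Cons a xs)
  have "linear (\<lambda>v. K a (xs @ v # ys) - alt_sum (\<lambda>w m. K w (a # m)) (xs @ v # ys))"
    by (intro linear_compose_sub alternating_linear Cons alternating_Cons)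
  then show ?case by (simp add: alt_sum_Cons)
qed

text \<open>When an entry \<open>v\<close> occurs twice, only the two terms that remove one of the copies survive.
  The remaining lists differ by moving \<open>v\<close> past the entries between the copies, and the
  resulting sign makes the two terms cancel.\<close>

lemma alt_sum_alternating:
  assumes K1: "\<And>m. linear (\<lambda>v. K v m)" and K2: "\<And>v. alternating (K v)"
  shows "alternating (alt_sum K)"
proof -
  have "alt_sum K (xs @ v # ys @ v # zs) = 0" for xs v ys zs
    using assms
  proof (induction xs arbitrary: K)
    case Nil
    have "alt_sum (\<lambda>w m. K w (v # m)) (ys @ v # zs) = (-1) ^ length ys * K v (v # ys @ zs)"
      using alternating_repeat[OF Nil(2), of _ "[]"] by (intro alt_sum_removes) simp
    also have "\<dots> = K v (ys @ v # zs)"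
      using alternating_move_front[OF Nil(2)] by simp
    finally show ?case by (simp add: alt_sum_Cons)
  next
    case (Cons a xs)
    have "alt_sum (\<lambda>w m. K w (a # m)) (xs @ v # ys @ v # zs) = 0"
      by (intro Cons.IH Cons.prems(1) alternating_Cons Cons.prems(2))
    then show ?case using alternating_repeat[OF Cons.prems(2), of a xs] by (simp add: alt_sum_Cons)
  qed
  then show ?thesis using linear_alt_sum[OF K1 K2] by (simp add: alternating_def)
qed

text \<open>Replacing one entry at a time is again an alternating sum, as every replaced entry can be
  moved to the front.\<close>

lemma sum_replace_eq_alt_sum:
  assumes \<alpha>: "alternating \<alpha>"
  shows "(\<Sum>j<length m. \<alpha> ((map A m)[j := \<beta> (m ! j)])) = alt_sum (\<lambda>w r. \<alpha> (\<beta> w # map A r)) m"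
  unfolding alt_sum_def
proof (rule sum.cong[OF refl])
  fix j assume j: "j \<in> {..<length m}"
  have "(map A m)[j := \<beta> (m ! j)] = map A (take j m) @ \<beta> (m ! j) # map A (drop (Suc j) m)"
    using j by (simp add: upd_conv_take_nth_drop take_map drop_map)
  then have "\<alpha> ((map A m)[j := \<beta> (m ! j)]) =
      (-1) ^ j * \<alpha> (\<beta> (m ! j) # map A (take j m) @ map A (drop (Suc j) m))"
    using alternating_move_front[OF \<alpha>, of "map A (take j m)" "\<beta> (m ! j)" "map A (drop (Suc j) m)"] j by simp
  then show "\<alpha> ((map A m)[j := \<beta> (m ! j)]) = (-1) ^ j * \<alpha> (\<beta> (m ! j) # map A (remove_nth j m))"
    by (simp add: remove_nth_def)
qed

text \<open>The product rule for \<open>F (\<phi> z) (map (\<lambda>a. a z) As)\<close>, which is multilinear in \<open>As\<close>.\<close>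

lemma multilinear_has_derivative:
  fixes F :: "complex^'n::finite \<Rightarrow> (complex^'n) list \<Rightarrow> complex"
  assumes S: "open S" "x \<in> S" and T: "open T" "\<And>z. z \<in> S \<Longrightarrow> \<phi> z \<in> T"
    and alt: "\<And>y. y \<in> T \<Longrightarrow> alternating (F y)"
    and F: "\<And>l. (\<lambda>y. F y l) differentiable (at (\<phi> x))"
    and \<phi>: "(\<phi> has_derivative \<phi>') (at x)"
  shows "(\<And>a. a \<in> set As \<Longrightarrow> a differentiable (at x)) \<Longrightarrow>
    ((\<lambda>z. F (\<phi> z) (xs @ map (\<lambda>a. a z) As)) has_derivative
      (\<lambda>v. frechet_derivative (\<lambda>y. F y (xs @ map (\<lambda>a. a x) As)) (at (\<phi> x)) (\<phi>' v) +
        (\<Sum>j<length As. F (\<phi> x) (xs @ (map (\<lambda>a. a x) As)[j := frechet_derivative (As ! j) (at x) v])))) (at x)"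
proof (induction As arbitrary: xs)
  case Nil
  show ?case
    using has_derivative_compose[OF \<phi> differentiable_has_derivative[OF F]] by simp
next
  case (Cons a As)
  define R where "R z = map (\<lambda>a. a z) As" for z
  define rest where "rest v j = (R x)[j := frechet_derivative (As ! j) (at x) v]" for v j
  define a' where "a' = frechet_derivative a (at x)"
  have a: "(a has_derivative a') (at x)"
    unfolding a'_def using Cons.prems by (intro differentiable_has_derivative) simp
  have x: "\<phi> x \<in> T" using S T by blast
  have expand: "F y (xs @ u # ys) = (\<Sum>b\<in>Basis. (u \<bullet> b) *\<^sub>R F y (xs @ b # ys))" if "y \<in> T" for y u ys
  proof -
    note lin = alternating_linear[OF alt[OF that], of xs ys]
    have "F y (xs @ (\<Sum>b\<in>Basis. (u \<bullet> b) *\<^sub>R b) # ys) = (\<Sum>b\<in>Basis. (u \<bullet> b) *\<^sub>R F y (xs @ b # ys))"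
      unfolding linear_sum[OF lin] linear_scale[OF lin] ..
    then show ?thesis by (simp add: euclidean_representation)
  qed
  have IH: "((\<lambda>z. F (\<phi> z) (xs @ b # R z)) has_derivative
      (\<lambda>v. frechet_derivative (\<lambda>y. F y (xs @ b # R x)) (at (\<phi> x)) (\<phi>' v) +
        (\<Sum>j<length As. F (\<phi> x) (xs @ b # rest v j)))) (at x)" for b
    using Cons.IH[of "xs @ [b]"] Cons.prems by (simp add: R_def rest_def)
  have "((\<lambda>z. \<Sum>b\<in>Basis. (a z \<bullet> b) *\<^sub>R F (\<phi> z) (xs @ b # R z)) has_derivative
      (\<lambda>v. \<Sum>b\<in>Basis. (a x \<bullet> b) *\<^sub>R (frechet_derivative (\<lambda>y. F y (xs @ b # R x)) (at (\<phi> x)) (\<phi>' v) +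
        (\<Sum>j<length As. F (\<phi> x) (xs @ b # rest v j))) + (a' v \<bullet> b) *\<^sub>R F (\<phi> x) (xs @ b # R x))) (at x)"
    by (intro has_derivative_sum has_derivative_scaleR IH has_derivative_inner_left a)
  then have "((\<lambda>z. F (\<phi> z) (xs @ a z # R z)) has_derivative
      (\<lambda>v. \<Sum>b\<in>Basis. (a x \<bullet> b) *\<^sub>R (frechet_derivative (\<lambda>y. F y (xs @ b # R x)) (at (\<phi> x)) (\<phi>' v) +
        (\<Sum>j<length As. F (\<phi> x) (xs @ b # rest v j))) + (a' v \<bullet> b) *\<^sub>R F (\<phi> x) (xs @ b # R x))) (at x)"
    by (rule has_derivative_cong_open[OF _ S]) (simp add: expand[OF T(2), symmetric])
  also have "(\<lambda>v. \<Sum>b\<in>Basis. (a x \<bullet> b) *\<^sub>R (frechet_derivative (\<lambda>y. F y (xs @ b # R x)) (at (\<phi> x)) (\<phi>' v) +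
        (\<Sum>j<length As. F (\<phi> x) (xs @ b # rest v j))) + (a' v \<bullet> b) *\<^sub>R F (\<phi> x) (xs @ b # R x)) =
      (\<lambda>v. frechet_derivative (\<lambda>y. F y (xs @ a x # R x)) (at (\<phi> x)) (\<phi>' v) +
        (F (\<phi> x) (xs @ a' v # R x) + (\<Sum>j<length As. F (\<phi> x) (xs @ a x # rest v j))))"
  proof
    fix v
    have "((\<lambda>y. \<Sum>b\<in>Basis. (a x \<bullet> b) *\<^sub>R F y (xs @ b # R x)) has_derivative
        (\<lambda>v. \<Sum>b\<in>Basis. (a x \<bullet> b) *\<^sub>R frechet_derivative (\<lambda>y. F y (xs @ b # R x)) (at (\<phi> x)) v)) (at (\<phi> x))"
      by (intro has_derivative_sum has_derivative_scaleR_right differentiable_has_derivative F)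
    then have "((\<lambda>y. F y (xs @ a x # R x)) has_derivative
        (\<lambda>v. \<Sum>b\<in>Basis. (a x \<bullet> b) *\<^sub>R frechet_derivative (\<lambda>y. F y (xs @ b # R x)) (at (\<phi> x)) v)) (at (\<phi> x))"
      by (rule has_derivative_cong_open[OF _ T(1) x]) (simp add: expand[symmetric])
    then have 1: "frechet_derivative (\<lambda>y. F y (xs @ a x # R x)) (at (\<phi> x)) (\<phi>' v) =
        (\<Sum>b\<in>Basis. (a x \<bullet> b) *\<^sub>R frechet_derivative (\<lambda>y. F y (xs @ b # R x)) (at (\<phi> x)) (\<phi>' v))"
      by (simp add: frechet_derivative_at[symmetric])
    have 2: "(\<Sum>j<length As. F (\<phi> x) (xs @ a x # rest v j)) =
        (\<Sum>b\<in>Basis. (a x \<bullet> b) *\<^sub>R (\<Sum>j<length As. F (\<phi> x) (xs @ b # rest v j)))"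
      unfolding expand[OF x, of "a x"] scaleR_sum_right by (rule sum.swap)
    show "(\<Sum>b\<in>Basis. (a x \<bullet> b) *\<^sub>R (frechet_derivative (\<lambda>y. F y (xs @ b # R x)) (at (\<phi> x)) (\<phi>' v) +
        (\<Sum>j<length As. F (\<phi> x) (xs @ b # rest v j))) + (a' v \<bullet> b) *\<^sub>R F (\<phi> x) (xs @ b # R x)) =
      frechet_derivative (\<lambda>y. F y (xs @ a x # R x)) (at (\<phi> x)) (\<phi>' v) +
        (F (\<phi> x) (xs @ a' v # R x) + (\<Sum>j<length As. F (\<phi> x) (xs @ a x # rest v j)))"
      unfolding 1 2 expand[OF x, of "a' v"] sum.distrib[symmetric]
      by (intro sum.cong refl) (simp add: scaleR_add_right)
  qed
  also have "\<dots> = (\<lambda>v. frechet_derivative (\<lambda>y. F y (xs @ map (\<lambda>a. a x) (a # As))) (at (\<phi> x)) (\<phi>' v) +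
        (\<Sum>j<length (a # As). F (\<phi> x) (xs @ (map (\<lambda>a. a x) (a # As))[j := frechet_derivative ((a # As) ! j) (at x) v])))"
    unfolding length_Cons sum.lessThan_Suc_shift by (simp add: R_def rest_def a'_def)
  finally show ?case by (simp add: R_def)
qed


section \<open>The Dolbeault operators in coordinates\<close>

text \<open>The parameter \<open>s\<close> treats the complex linear and the antilinear part of the derivative at
  once: they are the cases \<open>s = 1\<close> and \<open>s = -1\<close>.\<close>

definition pd :: "complex \<Rightarrow> (complex^'n::finite \<Rightarrow> complex) \<Rightarrow> complex^'n \<Rightarrow> complex^'n \<Rightarrow> complex" where
  "pd s f x v = (frechet_derivative f (at x) v - s * \<i> * frechet_derivative f (at x) (\<i> *s v)) / 2"

lemma pd_eq:
  assumes "(f has_derivative f') (at x)"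
  shows "pd s f x v = (f' v - s * \<i> * f' (\<i> *s v)) / 2"
  by (simp add: pd_def frechet_derivative_at[OF assms, symmetric])

lemma pd_cong_open:
  assumes "f differentiable (at x)" "open S" "x \<in> S" "\<And>y. y \<in> S \<Longrightarrow> f y = g y"
  shows "pd s g x v = pd s f x v"
  unfolding pd_def by (simp only: frechet_derivative_cong_open[OF assms])

lemma bounded_linear_mult_i: "bounded_linear (\<lambda>v::complex^'n::finite. \<i> *s v)"
proof -
  have "linear (\<lambda>v::complex^'n. \<i> *s v)"
    by (rule linearI) (simp_all add: vec_eq_iff algebra_simps)
  then show ?thesis by (simp add: linear_conv_bounded_linear)
qed

lemma pd_linear:
  assumes "f differentiable (at x)"
  shows "linear (pd s f x)"
proof -
  note lin = frechet_derivative_linear[OF assms]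
  have I: "linear (\<lambda>v::complex^'a. \<i> *s v)" using bounded_linear_mult_i by (rule bounded_linear.linear)
  show ?thesis
    unfolding pd_def
    by (rule linearI)
      (simp_all add: linear_add[OF lin] linear_scale[OF lin] linear_add[OF I] linear_scale[OF I]
        scaleR_conv_of_real[of _ "_::complex"] field_simps)
qed

lemma pd_add:
  assumes "f differentiable (at x)" "g differentiable (at x)"
  shows "pd s (\<lambda>y. f y + g y) x v = pd s f x v + pd s g x v"
proof -
  have "((\<lambda>y. f y + g y) has_derivative
      (\<lambda>v. frechet_derivative f (at x) v + frechet_derivative g (at x) v)) (at x)"
    by (intro has_derivative_add differentiable_has_derivative assms)
  then show ?thesis
    by (simp add: pd_eq pd_def[of s f] pd_def[of s g] algebra_simps add_divide_distrib diff_divide_distrib)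
qed

lemma pd_mult_left:
  assumes "f differentiable (at x)"
  shows "pd s (\<lambda>y. c * f y) x v = c * pd s f x v"
proof -
  have "((\<lambda>y. c * f y) has_derivative (\<lambda>v. c * frechet_derivative f (at x) v)) (at x)"
    by (intro has_derivative_mult_right differentiable_has_derivative assms)
  from pd_eq[OF this, of s v] show ?thesis
    by (simp add: pd_def[of s f] field_simps)
qed

lemma pd_const: "pd s (\<lambda>y. c) x v = 0"
  using pd_eq[OF has_derivative_const[of c "at x"]] by simp

lemma pd_sum:
  assumes "finite I" "\<And>i. i \<in> I \<Longrightarrow> f i differentiable (at x)"
  shows "pd s (\<lambda>y. \<Sum>i\<in>I. f i y) x v = (\<Sum>i\<in>I. pd s (f i) x v)"
  using assms
proof (induction I rule: finite_induct)
  case empty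
  show ?case by (simp add: pd_const)
next
  case (insert i I)
  have "(\<lambda>y. \<Sum>i\<in>I. f i y) differentiable (at x)"
    using insert by (intro differentiable_sum) auto
  then show ?case using insert by (simp add: pd_add)
qed

lemma smooth_on_pd:
  assumes "open S" "smooth_on S f"
  shows "smooth_on S (\<lambda>x. pd s f x v)"
proof -
  have "smooth_on S (\<lambda>x. (1/2) * frechet_derivative f (at x) v +
      (- s * \<i> / 2) * frechet_derivative f (at x) (\<i> *s v))"
    by (intro smooth_on_add smooth_on_mult_left smooth_on_derivative assms)
  then show ?thesis by (rule smooth_on_cong[OF assms(1)]) (simp add: pd_def field_simps)
qed

lemma pd_commute:
  assumes S: "open S" "x \<in> S" and f: "smooth_on S f"
  shows "pd s (\<lambda>y. pd t f y w) x v = pd t (\<lambda>y. pd s f y v) x w"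
proof -
  define D where "D a b = frechet_derivative (\<lambda>y. frechet_derivative f (at y) a) (at x) b" for a b
  have sym: "D a b = D b a" for a b
    unfolding D_def by (rule second_derivative_symmetric[OF S f])
  have D: "((\<lambda>y. frechet_derivative f (at y) a) has_derivative D a) (at x)" for a
    unfolding D_def
    by (rule differentiable_has_derivative[OF smooth_on_differentiable[OF smooth_on_derivative[OF f] S(2)]])
  have d: "((\<lambda>y. pd t f y w) has_derivative (\<lambda>b. (D w b - t * \<i> * D (\<i> *s w) b) / 2)) (at x)" for t w
    unfolding pd_def divide_inverse
    by (intro has_derivative_mult_left has_derivative_diff has_derivative_mult_right D)
  have I: "D (\<i> *s a) (\<i> *s b) = D (\<i> *s b) (\<i> *s a)" "D a (\<i> *s b) = D (\<i> *s b) a" for a b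
    by (rule sym)+
  show ?thesis
    unfolding pd_eq[OF d] sym[of w v] I(2)[of w] I(2)[of v] I(1)[of w v] by (simp add: field_simps)
qed

definition dloc :: "complex \<Rightarrow> (complex^'n::finite \<Rightarrow> (complex^'n) list \<Rightarrow> complex) \<Rightarrow>
    complex^'n \<Rightarrow> (complex^'n) list \<Rightarrow> complex" where
  "dloc s F x = alt_sum (\<lambda>v m. pd s (\<lambda>y. F y m) x v)"

text \<open>A form in local coordinates.\<close>

definition smooth_field :: "(complex^'n) set \<Rightarrow> (complex^'n::finite \<Rightarrow> (complex^'n) list \<Rightarrow> complex) \<Rightarrow> bool" where
  "smooth_field S F \<longleftrightarrow> (\<forall>y\<in>S. alternating (F y)) \<and> (\<forall>l. smooth_on S (\<lambda>y. F y l))"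

lemma smooth_fieldD:
  assumes "smooth_field S F"
  shows "y \<in> S \<Longrightarrow> alternating (F y)" "smooth_on S (\<lambda>y. F y l)"
    "y \<in> S \<Longrightarrow> (\<lambda>y. F y l) differentiable (at y)"
  using assms smooth_on_differentiable unfolding smooth_field_def by blast+

lemma dloc_smooth_field:
  assumes S: "open S" and F: "smooth_field S F"
  shows "smooth_field S (dloc s F)"
  unfolding smooth_field_def
proof (intro conjI ballI allI)
  show "smooth_on S (\<lambda>y. dloc s F y l)" for l
    unfolding dloc_def alt_sum_def
    by (intro smooth_on_sum smooth_on_mult_left smooth_on_pd smooth_fieldD(2)[OF F] S)
next
  fix x assume x: "x \<in> S"
  note diff = smooth_fieldD(3)[OF F x]
  show "alternating (dloc s F x)"
    unfolding dloc_def
  proof (rule alt_sum_alternating)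
    show "linear (\<lambda>v. pd s (\<lambda>y. F y m) x v)" for m
      using pd_linear[OF diff] .
    fix v
    show "alternating (\<lambda>m. pd s (\<lambda>y. F y m) x v)"
      unfolding alternating_def
    proof (intro conjI allI)
      fix xs ys :: "(complex^'a) list"
      show "linear (\<lambda>w. pd s (\<lambda>y. F y (xs @ w # ys)) x v)"
      proof (rule linearI)
        fix a b :: "complex^'a" and r :: real
        have "pd s (\<lambda>y. F y (xs @ (a + b) # ys)) x v = pd s (\<lambda>y. F y (xs @ a # ys) + F y (xs @ b # ys)) x v"
          by (rule pd_cong_open[OF _ S x])
            (auto intro!: differentiable_add diff
              simp: linear_add[OF alternating_linear[OF smooth_fieldD(1)[OF F]]])
        then show "pd s (\<lambda>y. F y (xs @ (a + b) # ys)) x v =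
            pd s (\<lambda>y. F y (xs @ a # ys)) x v + pd s (\<lambda>y. F y (xs @ b # ys)) x v"
          by (simp add: pd_add diff)
        have "pd s (\<lambda>y. F y (xs @ (r *\<^sub>R a) # ys)) x v = pd s (\<lambda>y. of_real r * F y (xs @ a # ys)) x v"
          by (rule pd_cong_open[OF _ S x])
            (auto intro!: differentiable_mult diff differentiable_const
              simp: linear_scale[OF alternating_linear[OF smooth_fieldD(1)[OF F]]] scaleR_conv_of_real[of _ "_::complex"])
        then show "pd s (\<lambda>y. F y (xs @ (r *\<^sub>R a) # ys)) x v = r *\<^sub>R pd s (\<lambda>y. F y (xs @ a # ys)) x v"
          by (simp add: pd_mult_left diff scaleR_conv_of_real[of _ "_::complex"])
      qed
    next
      fix xs ys zs and w :: "complex^'a"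
      have "pd s (\<lambda>y. F y (xs @ w # ys @ w # zs)) x v = pd s (\<lambda>y. 0) x v"
        by (rule pd_cong_open[OF _ S x])
          (simp_all add: alternating_repeat[OF smooth_fieldD(1)[OF F]])
      then show "pd s (\<lambda>y. F y (xs @ w # ys @ w # zs)) x v = 0" by (simp add: pd_const)
    qed
  qed
qed

lemma pd_alt_sum:
  assumes "\<And>w r. (\<lambda>y. K y w r) differentiable (at x)"
  shows "pd s (\<lambda>y. alt_sum (K y) m) x v = alt_sum (\<lambda>w r. pd s (\<lambda>y. K y w r) x v) m"
  unfolding alt_sum_def
  by (subst pd_sum) (auto intro!: differentiable_mult assms simp: pd_mult_left[OF assms])

text \<open>Both second-order alternating sums have the same coefficients up to the order of the two
  directions, so their sum is symmetric in these directions and the alternating sum vanishes.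
  For \<open>s = t\<close> the lemma says that the operator squares to zero.\<close>

lemma dloc_anticommute:
  assumes S: "open S" "x \<in> S" and F: "smooth_field S F"
  shows "dloc s (dloc t F) x l + dloc t (dloc s F) x l = 0"
proof -
  have two: "dloc s (dloc t F) x l =
      alt_sum (\<lambda>v. alt_sum (\<lambda>w r. pd s (\<lambda>y. pd t (\<lambda>y. F y r) y w) x v)) l" for s t
  proof -
    have "pd s (\<lambda>y. dloc t F y m) x v = alt_sum (\<lambda>w r. pd s (\<lambda>y. pd t (\<lambda>y. F y r) y w) x v) m" for v m
      unfolding dloc_def
      by (rule pd_alt_sum)
        (rule smooth_on_differentiable[OF smooth_on_pd[OF S(1) smooth_fieldD(2)[OF F]] S(2)])
    then show ?thesis unfolding dloc_def[of s] by simp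
  qed
  have "pd s (\<lambda>y. pd t (\<lambda>y. F y r) y w) x v = pd t (\<lambda>y. pd s (\<lambda>y. F y r) y v) x w" for s t r v w
    by (rule pd_commute[OF S smooth_fieldD(2)[OF F]])
  note comm = this
  have "alt_sum (\<lambda>v. alt_sum (\<lambda>w r. pd s (\<lambda>y. pd t (\<lambda>y. F y r) y w) x v +
      pd t (\<lambda>y. pd s (\<lambda>y. F y r) y w) x v)) l = 0"
  proof (rule alt_sum_iterated_symmetric)
    fix v w r
    show "pd s (\<lambda>y. pd t (\<lambda>y. F y r) y w) x v + pd t (\<lambda>y. pd s (\<lambda>y. F y r) y w) x v =
      pd s (\<lambda>y. pd t (\<lambda>y. F y r) y v) x w + pd t (\<lambda>y. pd s (\<lambda>y. F y r) y v) x w"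
      unfolding comm[of s t r w v] comm[of t s r w v] by (rule add.commute)
  qed
  moreover have "alt_sum (\<lambda>v m. K v m + K' v m) = (\<lambda>m. alt_sum K m + alt_sum K' m)"
    for K K' :: "complex^'a \<Rightarrow> (complex^'a) list \<Rightarrow> complex"
    by (rule HOL.ext) (rule alt_sum_add)
  ultimately show ?thesis unfolding two by simp
qed

text \<open>Differentiating \<open>F (\<phi> z) (map (\<phi>' z) l)\<close> produces, besides the desired term, the terms in
  which an entry is replaced by a second derivative \<open>B v w\<close> of \<open>\<phi>\<close>. These form an iterated
  alternating sum with coefficients symmetric in \<open>v\<close> and \<open>w\<close>. Holomorphy enters here: it
  gives \<open>B (\<i> v) w = \<i> B v w = B (\<i> w) v\<close>, which keeps the symmetry for the complex linear
  and antilinear parts separately.\<close>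

lemma dloc_pullback:
  assumes S: "open S" "x \<in> S" and T: "open T" "\<phi> ` S \<subseteq> T"
    and \<phi>: "holomorphic_map_on S \<phi>"
    and F: "smooth_field T F"
    and G: "\<And>z l. z \<in> S \<Longrightarrow> G z l = F (\<phi> z) (map (frechet_derivative \<phi> (at z)) l)"
  shows "dloc s G x l = dloc s F (\<phi> x) (map (frechet_derivative \<phi> (at x)) l)"
proof -
  define A where "A = frechet_derivative \<phi> (at x)"
  define B where "B v w = frechet_derivative (\<lambda>z. frechet_derivative \<phi> (at z) w) (at x) v" for v w
  have sm: "smooth_on S \<phi>" and cl: "\<And>z c v. z \<in> S \<Longrightarrow>
      frechet_derivative \<phi> (at z) (c *s v) = c *s frechet_derivative \<phi> (at z) v"
    using \<phi> by (auto simp: holomorphic_map_on_def)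
  have d\<phi>: "\<phi> differentiable (at x)" by (rule smooth_on_differentiable[OF sm S(2)])
  have dA: "(\<lambda>z. frechet_derivative \<phi> (at z) w) differentiable (at x)" for w
    by (rule smooth_on_differentiable[OF smooth_on_derivative[OF sm] S(2)])
  have B_sym: "B v w = B w v" for v w
    unfolding B_def by (rule second_derivative_symmetric[OF S sm])
  have B_i: "B v (\<i> *s w) = \<i> *s B v w" for v w
  proof -
    have "((\<lambda>z. \<i> *s frechet_derivative \<phi> (at z) w) has_derivative (\<lambda>v. \<i> *s B v w)) (at x)"
      unfolding B_def
      by (rule bounded_linear.has_derivative[OF bounded_linear_mult_i differentiable_has_derivative[OF dA]])
    then have "((\<lambda>z. frechet_derivative \<phi> (at z) (\<i> *s w)) has_derivative (\<lambda>v. \<i> *s B v w)) (at x)"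
      by (rule has_derivative_cong_open[OF _ S]) (simp add: cl)
    then show ?thesis unfolding B_def by (metis frechet_derivative_at)
  qed
  have \<phi>x: "\<phi> x \<in> T" using S T by blast
  note alt = smooth_fieldD(1)[OF F \<phi>x]
  define H where "H v w r = (F (\<phi> x) (B v w # map A r) - s * \<i> * F (\<phi> x) (B (\<i> *s v) w # map A r)) / 2"
    for v w r
  have K: "pd s (\<lambda>z. G z m) x v = pd s (\<lambda>y. F y (map A m)) (\<phi> x) (A v) + alt_sum (H v) m" for v m
  proof -
    define As where "As = map (\<lambda>w z. frechet_derivative \<phi> (at z) w) m"
    have As: "map (\<lambda>a. a z) As = map (frechet_derivative \<phi> (at z)) m" for z
      by (simp add: As_def)
    have "((\<lambda>z. F (\<phi> z) ([] @ map (\<lambda>a. a z) As)) has_derivative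
      (\<lambda>v. frechet_derivative (\<lambda>y. F y ([] @ map (\<lambda>a. a x) As)) (at (\<phi> x)) (A v) +
        (\<Sum>j<length As. F (\<phi> x) ([] @ (map (\<lambda>a. a x) As)[j := frechet_derivative (As ! j) (at x) v])))) (at x)"
    proof (rule multilinear_has_derivative[OF S T(1)])
      show "(\<phi> has_derivative A) (at x)"
        unfolding A_def by (rule differentiable_has_derivative[OF d\<phi>])
      show "\<phi> z \<in> T" if "z \<in> S" for z using T(2) that by blast
      show "a differentiable (at x)" if "a \<in> set As" for a using that dA by (auto simp: As_def)
    qed (use smooth_fieldD[OF F] \<phi>x in auto)
    also have "(\<lambda>v. \<Sum>j<length As. F (\<phi> x) ([] @ (map (\<lambda>a. a x) As)[j := frechet_derivative (As ! j) (at x) v])) =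
        (\<lambda>v. \<Sum>j<length m. F (\<phi> x) ((map A m)[j := B v (m ! j)]))"
      by (intro HOL.ext sum.cong) (auto simp: As_def A_def B_def comp_def)
    also have "\<dots> = (\<lambda>v. alt_sum (\<lambda>w r. F (\<phi> x) (B v w # map A r)) m)"
      by (rule HOL.ext, rule sum_replace_eq_alt_sum[OF alt])
    finally have h: "((\<lambda>z. G z m) has_derivative
      (\<lambda>v. frechet_derivative (\<lambda>y. F y (map A m)) (at (\<phi> x)) (A v) +
        alt_sum (\<lambda>w r. F (\<phi> x) (B v w # map A r)) m)) (at x)"
      unfolding append_Nil As A_def[symmetric]
      by (rule has_derivative_cong_open[OF _ S]) (simp add: G)
    have "A (\<i> *s v) = \<i> *s A v" unfolding A_def by (rule cl[OF S(2)])
    moreover have "alt_sum (H v) m = (alt_sum (\<lambda>w r. F (\<phi> x) (B v w # map A r)) m -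
        s * \<i> * alt_sum (\<lambda>w r. F (\<phi> x) (B (\<i> *s v) w # map A r)) m) / 2"
      unfolding H_def alt_sum_def
      by (simp add: sum_distrib_left sum_subtractf[symmetric] sum_divide_distrib algebra_simps diff_divide_distrib)
    ultimately show ?thesis
      unfolding pd_eq[OF h] by (simp add: pd_def algebra_simps diff_divide_distrib add_divide_distrib)
  qed
  have "alt_sum (\<lambda>v. alt_sum (H v)) l = 0"
  proof (rule alt_sum_iterated_symmetric)
    fix v w r
    have "B (\<i> *s v) w = B (\<i> *s w) v"
      using B_sym[of "\<i> *s v" w] B_sym[of "\<i> *s w" v] B_i[of w v] B_i[of v w] B_sym[of v w] by simp
    then show "H v w r = H w v r" using B_sym[of v w] by (simp add: H_def)
  qed
  then have "dloc s G x l = alt_sum (\<lambda>v m. pd s (\<lambda>y. F y (map A m)) (\<phi> x) (A v)) l"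
    unfolding dloc_def K by (simp add: alt_sum_add)
  then show ?thesis by (simp add: dloc_def alt_sum_map A_def)
qed


section \<open>The Dolbeault operators on a complex manifold\<close>

lemma D10_eq_pd: "D10 = pd 1" and D01_eq_pd: "D01 = pd (-1)"
  by (intro HOL.ext; simp add: D10_def D01_def pd_def)+

lemma dloc_cong_open:
  assumes S: "open S" "x \<in> S" and F: "smooth_field S F" and G: "\<And>y l. y \<in> S \<Longrightarrow> F y l = G y l"
  shows "dloc s G x = dloc s F x"
proof
  fix l
  have "pd s (\<lambda>y. G y m) x v = pd s (\<lambda>y. F y m) x v" for m v
    by (rule pd_cong_open[OF smooth_fieldD(3)[OF F S(2)] S G])
  then show "dloc s G x l = dloc s F x l" by (simp add: dloc_def)
qed

lemma dloc_linear:
  assumes S: "x \<in> S" and F: "smooth_field S F" "smooth_field S G"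
  shows "dloc s (\<lambda>y l. a * F y l + b * G y l) x l = a * dloc s F x l + b * dloc s G x l"
proof -
  have "pd s (\<lambda>y. a * F y m + b * G y m) x v = a * pd s (\<lambda>y. F y m) x v + b * pd s (\<lambda>y. G y m) x v" for m v
    using smooth_fieldD(3)[OF F(1) S] smooth_fieldD(3)[OF F(2) S]
    by (simp add: pd_add pd_mult_left differentiable_mult)
  then show ?thesis by (simp add: dloc_def alt_sum_add alt_sum_scale)
qed

lemma alternating_compose_linear:
  assumes "alternating \<alpha>" "linear T"
  shows "alternating (\<lambda>l. \<alpha> (map T l))"
  unfolding alternating_def
proof (intro conjI allI)
  fix xs ys
  show "linear (\<lambda>v. \<alpha> (map T (xs @ v # ys)))"
    using linear_compose[OF assms(2) alternating_linear[OF assms(1), of "map T xs" "map T ys"]]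
    by (simp add: comp_def)
qed (use alternating_repeat[OF assms(1)] in simp)

lemma alternating_combination:
  assumes "alternating \<alpha>" "alternating \<beta>"
  shows "alternating (\<lambda>l. a * \<alpha> l + b * \<beta> l)"
  unfolding alternating_def
proof (intro conjI allI)
  fix xs ys
  note lin = alternating_linear[OF assms(1), of xs ys] alternating_linear[OF assms(2), of xs ys]
  show "linear (\<lambda>v. a * \<alpha> (xs @ v # ys) + b * \<beta> (xs @ v # ys))"
    by (rule linearI)
      (simp_all add: linear_add[OF lin(1)] linear_add[OF lin(2)] linear_scale[OF lin(1)]
        linear_scale[OF lin(2)] algebra_simps)
qed (simp add: alternating_repeat[OF assms(1)] alternating_repeat[OF assms(2)])

fun real_coord :: "'n + 'n \<Rightarrow> complex^'n::finite \<Rightarrow> real" where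
  "real_coord (Inl k) v = Re (v $ k)"
| "real_coord (Inr k) v = Im (v $ k)"

lemma frame_coords_real_basis: "frame_coords real_basis_vec (real_coord :: 'n::finite + 'n \<Rightarrow> complex^'n \<Rightarrow> real)"
  unfolding frame_coords_def
proof (intro conjI allI)
  fix i :: "'n + 'n"
  show "linear (real_coord i)" by (cases i) (auto intro!: linearI)
next
  fix x :: "complex^'n"
  have "(\<Sum>i\<in>UNIV. real_coord i x *\<^sub>R real_basis_vec i) =
      (\<Sum>k\<in>UNIV. Re (x $ k) *\<^sub>R axis k 1) + (\<Sum>k\<in>UNIV. Im (x $ k) *\<^sub>R axis k \<i>)"
    by (simp add: UNIV_Plus_UNIV[symmetric] sum.Plus del: UNIV_Plus_UNIV)
  also have "\<dots> = x"
    by (simp add: vec_eq_iff axis_def if_distrib[of "\<lambda>z. _ *\<^sub>R z"] cong: if_cong)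
      (simp add: complex_eq_iff)
  finally show "x = (\<Sum>i\<in>UNIV. real_coord i x *\<^sub>R real_basis_vec i)" by simp
next
  fix i j :: "'n + 'n"
  show "real_coord i (real_basis_vec j :: complex^'n) = (if i = j then 1 else 0)"
    by (cases i; cases j) (auto simp: axis_def)
qed

lemma frame_coords_image:
  assumes c: "frame_coords e c" and T: "linear T" and T': "linear T'" "\<And>x. T (T' x) = x" "\<And>x. T' (T x) = x"
  shows "frame_coords (\<lambda>i. T (e i)) (\<lambda>i x. c i (T' x))"
  unfolding frame_coords_def
proof (intro conjI allI)
  show "linear (\<lambda>x. c i (T' x))" for i
    using linear_compose[OF T'(1), of "c i"] c by (simp add: frame_coords_def comp_def)
  fix x
  have "x = T (\<Sum>i\<in>UNIV. c i (T' x) *\<^sub>R e i)"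
    using c T'(2)[of x] by (simp add: frame_coords_def)
  then show "x = (\<Sum>i\<in>UNIV. c i (T' x) *\<^sub>R T (e i))"
    by (simp add: linear_sum[OF T] linear_scale[OF T])
qed (use c T'(3) in \<open>simp add: frame_coords_def\<close>)

abbreviation chart_inv :: "('m, 'n) chart \<Rightarrow> complex^'n \<Rightarrow> 'm" where
  "chart_inv c \<equiv> inv_into (fst c) (snd c)"

text \<open>The common form of \<^const>\<open>del\<close> and \<^const>\<open>delbar\<close>.\<close>

definition dop :: "complex \<Rightarrow> ('m, 'n::finite) chart set \<Rightarrow> ('m, 'n) form \<Rightarrow> ('m, 'n) form" where
  "dop s \<A> u p = dloc s (form_rep \<A> u (chart_at \<A> p)) (snd (chart_at \<A> p) p)"

lemma del_eq_dop: "del \<A> = dop 1 \<A>" and delbar_eq_dop: "delbar \<A> = dop (-1) \<A>"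
  by (intro HOL.ext;
      simp add: del_def delbar_def dop_def dloc_def alt_sum_def Let_def D10_eq_pd D01_eq_pd)+

locale complex_manifold =
  fixes \<A> :: "('m::topological_space, 'n::finite) chart set"
  assumes atlas: "complex_atlas \<A>"
begin

definition overlap :: "('m, 'n) chart \<Rightarrow> ('m, 'n) chart \<Rightarrow> (complex^'n) set" where
  "overlap c d = snd c ` (fst c \<inter> fst d)"

definition transition :: "('m, 'n) chart \<Rightarrow> ('m, 'n) chart \<Rightarrow> complex^'n \<Rightarrow> complex^'n" where
  "transition c d = snd d \<circ> chart_inv c"

lemma chart:
  assumes "c \<in> \<A>"
  shows "open (fst c)" "open (snd c ` fst c)" "homeomorphism (fst c) (snd c ` fst c) (snd c) (chart_inv c)"
  using assms atlas by (auto simp: complex_atlas_def split_beta)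

lemma chart_inv_left: "c \<in> \<A> \<Longrightarrow> p \<in> fst c \<Longrightarrow> chart_inv c (snd c p) = p"
  using chart(3) by (auto simp: homeomorphism_def)

lemma chart_inv_right: "x \<in> snd c ` fst c \<Longrightarrow> snd c (chart_inv c x) = x"
  by (rule f_inv_into_f)

lemma chart_inv_mem: "x \<in> snd c ` fst c \<Longrightarrow> chart_inv c x \<in> fst c"
  by (rule inv_into_into)

lemma chart_at: "chart_at \<A> p \<in> \<A>" "p \<in> fst (chart_at \<A> p)"
proof -
  have "p \<in> (\<Union>(U, \<phi>)\<in>\<A>. U)" using atlas by (simp add: complex_atlas_def)
  then have "\<exists>c. c \<in> \<A> \<and> p \<in> fst c" by auto
  then have "chart_at \<A> p \<in> \<A> \<and> p \<in> fst (chart_at \<A> p)" unfolding chart_at_def by (rule someI_ex)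
  then show "chart_at \<A> p \<in> \<A>" "p \<in> fst (chart_at \<A> p)" by auto
qed

lemma open_chart_image:
  assumes c: "c \<in> \<A>" and V: "open V"
  shows "open (snd c ` (fst c \<inter> V))"
proof -
  have "snd c ` (fst c \<inter> V) = snd c ` fst c \<inter> chart_inv c -` V"
    using chart_inv_left[OF c] by force
  moreover have "continuous_on (snd c ` fst c) (chart_inv c)"
    using chart(3)[OF c] by (simp add: homeomorphism_def)
  ultimately show ?thesis
    using continuous_open_preimage[OF _ chart(2)[OF c] V] by metis
qed

lemma open_overlap: "c \<in> \<A> \<Longrightarrow> d \<in> \<A> \<Longrightarrow> open (overlap c d)"
  unfolding overlap_def by (intro open_chart_image chart(1))

lemma overlap_image: "overlap c d \<subseteq> snd c ` fst c"
  by (auto simp: overlap_def)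

lemma overlap_mem: "c \<in> \<A> \<Longrightarrow> x \<in> overlap c d \<Longrightarrow> chart_inv c x \<in> fst c \<inter> fst d"
  using chart_inv_left by (auto simp: overlap_def)

lemma overlapI: "x \<in> snd c ` fst c \<Longrightarrow> chart_inv c x \<in> fst d \<Longrightarrow> x \<in> overlap c d"
  unfolding overlap_def using chart_inv_right chart_inv_mem by (metis IntI image_eqI)

lemma transition_holomorphic:
  "c \<in> \<A> \<Longrightarrow> d \<in> \<A> \<Longrightarrow> holomorphic_map_on (overlap c d) (transition c d)"
  using atlas unfolding complex_atlas_def overlap_def transition_def by fastforce

lemma transition_differentiable:
  "c \<in> \<A> \<Longrightarrow> d \<in> \<A> \<Longrightarrow> x \<in> overlap c d \<Longrightarrow> transition c d differentiable (at x)"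
  using transition_holomorphic smooth_on_differentiable unfolding holomorphic_map_on_def by blast

lemma transition_overlap:
  assumes "c \<in> \<A>" "d \<in> \<A>" "x \<in> overlap c d"
  shows "transition c d x \<in> overlap d c" "chart_inv d (transition c d x) = chart_inv c x"
  using overlap_mem[OF assms(1,3)] chart_inv_left[OF assms(2)]
  by (auto simp: transition_def overlap_def)

lemma tangent_coord_eq:
  "tangent_coord \<A> c x = frechet_derivative (transition c (chart_at \<A> (chart_inv c x))) (at x)"
  by (simp add: tangent_coord_def transition_def Let_def)

lemma tangent_coord_overlap: "x \<in> snd c ` fst c \<Longrightarrow> x \<in> overlap c (chart_at \<A> (chart_inv c x))"
  by (intro overlapI chart_at)

lemma tangent_coord_linear:
  "c \<in> \<A> \<Longrightarrow> x \<in> snd c ` fst c \<Longrightarrow> linear (tangent_coord \<A> c x)"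
  unfolding tangent_coord_eq
  by (intro frechet_derivative_linear transition_differentiable chart_at tangent_coord_overlap)

lemma tangent_coord_chain:
  assumes c: "c \<in> \<A>" and d: "d \<in> \<A>" and x: "x \<in> overlap c d"
  shows "tangent_coord \<A> c x v =
    tangent_coord \<A> d (transition c d x) (frechet_derivative (transition c d) (at x) v)"
proof -
  define y where "y = transition c d x"
  define e where "e = chart_at \<A> (chart_inv c x)"
  have e: "e \<in> \<A>" unfolding e_def by (rule chart_at)
  have y: "y \<in> overlap d c" "chart_inv d y = chart_inv c x"
    unfolding y_def by (rule transition_overlap[OF c d x])+
  have ye: "y \<in> overlap d e"
    using tangent_coord_overlap[of y d] y overlap_image[of d c] by (auto simp: e_def)
  have "((\<lambda>z. transition d e (transition c d z)) has_derivative
      (\<lambda>v. frechet_derivative (transition d e) (at y) (frechet_derivative (transition c d) (at x) v))) (at x)"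
    using has_derivative_compose[OF differentiable_has_derivative[OF transition_differentiable[OF c d x]]
        differentiable_has_derivative[OF transition_differentiable[OF d e ye[unfolded y_def]]]]
    by (simp add: y_def)
  then have "(transition c e has_derivative
      (\<lambda>v. frechet_derivative (transition d e) (at y) (frechet_derivative (transition c d) (at x) v))) (at x)"
    by (rule has_derivative_cong_open[OF _ open_overlap[OF c d] x])
      (use transition_overlap(2)[OF c d] in \<open>simp add: transition_def\<close>)
  from frechet_derivative_at[OF this] show ?thesis
    unfolding tangent_coord_eq y_def[symmetric] y(2) e_def[symmetric] by metis
qed

lemma tangent_coord_chart_at:
  assumes "p \<in> fst (chart_at \<A> p)"
  shows "tangent_coord \<A> (chart_at \<A> p) (snd (chart_at \<A> p) p) v = v"
proof -
  define e where "e = chart_at \<A> p"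
  have e: "e \<in> \<A>" "p \<in> fst e" unfolding e_def by (rule chart_at)+
  have "((\<lambda>z. z) has_derivative (\<lambda>v. v)) (at (snd e p))" by (rule has_derivative_ident)
  then have "(transition e e has_derivative (\<lambda>v. v)) (at (snd e p))"
    by (rule has_derivative_cong_open[OF _ chart(2)[OF e(1)]])
      (use e chart_inv_right[of _ e] in \<open>auto simp: transition_def simp del: inv_into_f_f\<close>)
  from frechet_derivative_at[OF this] show ?thesis
    unfolding tangent_coord_eq e_def[symmetric] chart_inv_left[OF e]
    by (metis e_def)
qed

text \<open>The map \<^const>\<open>tangent_coord\<close> is invertible, the inverse being the derivative of the
  transition back from the distinguished chart; so it carries the standard real basis to a
  basis of the tangent space.\<close>

lemma tangent_frame:
  assumes c: "c \<in> \<A>" and x: "x \<in> snd c ` fst c"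
  shows "\<exists>k. frame_coords (\<lambda>i. tangent_coord \<A> c x (real_basis_vec i)) k"
proof -
  define p where "p = chart_inv c x"
  define e where "e = chart_at \<A> p"
  define y where "y = snd e p"
  define T where "T = tangent_coord \<A> c x"
  define R where "R = frechet_derivative (transition e c) (at y)"
  have e: "e \<in> \<A>" "p \<in> fst e" unfolding e_def by (rule chart_at)+
  have p: "p \<in> fst c" unfolding p_def by (rule chart_inv_mem[OF x])
  have y: "y \<in> overlap e c" "transition e c y = x"
    using e p chart_inv_left[OF e] chart_inv_right[OF x]
    by (auto simp: overlap_def y_def transition_def p_def)
  have T: "linear T" unfolding T_def by (rule tangent_coord_linear[OF c x])
  have R: "linear R"
    unfolding R_def by (intro frechet_derivative_linear transition_differentiable e c y)
  have TR: "T (R v) = v" for v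
    using tangent_coord_chain[OF e(1) c y(1), of v] tangent_coord_chart_at[of p v] e(2)
    unfolding y(2) T_def R_def by (simp add: e_def y_def)
  have "surj T" using TR by (metis surjI)
  then have "inj T" using linear_surjective_imp_injective[OF T] by blast
  then have "R (T v) = v" for v using TR[of "T v"] by (simp add: injD)
  from frame_coords_image[OF frame_coords_real_basis T R TR this]
  show ?thesis unfolding T_def by blast
qed

lemma form_rep_transition:
  assumes "c \<in> \<A>" "d \<in> \<A>" "x \<in> overlap c d"
  shows "form_rep \<A> u c x l =
    form_rep \<A> u d (transition c d x) (map (frechet_derivative (transition c d) (at x)) l)"
  unfolding form_rep_def transition_overlap(2)[OF assms]
  by (simp add: comp_def tangent_coord_chain[OF assms, symmetric])

lemma alternating_form_rep:
  assumes "alternating (u (chart_inv c x))" "c \<in> \<A>" "x \<in> snd c ` fst c"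
  shows "alternating (form_rep \<A> u c x)"
  using alternating_compose_linear[OF assms(1) tangent_coord_linear[OF assms(2,3)]]
  by (simp add: form_rep_def[abs_def])

lemma smooth_formsD:
  assumes "u \<in> smooth_forms \<A>"
  shows "alternating (u p)" "c \<in> \<A> \<Longrightarrow> smooth_field (snd c ` fst c) (form_rep \<A> u c)"
  using assms alternating_form_rep by (auto simp: smooth_forms_def smooth_field_def)

text \<open>The definition of \<^const>\<open>dop\<close> uses a different chart at each point; this is its expression in
  one fixed chart, from which smoothness can be read off.\<close>

lemma form_rep_dop:
  assumes u: "u \<in> smooth_forms \<A>" and c: "c \<in> \<A>" and x: "x \<in> snd c ` fst c"
  shows "form_rep \<A> (dop s \<A> u) c x l = dloc s (form_rep \<A> u c) x l"
proof -
  define p where "p = chart_inv c x"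
  define e where "e = chart_at \<A> p"
  have e: "e \<in> \<A>" unfolding e_def by (rule chart_at)
  have x': "x \<in> overlap c e" unfolding e_def p_def by (rule tangent_coord_overlap[OF x])
  have "dloc s (form_rep \<A> u c) x l = dloc s (form_rep \<A> u e) (transition c e x)
      (map (frechet_derivative (transition c e) (at x)) l)"
  proof (rule dloc_pullback[OF open_overlap[OF c e] x' chart(2)[OF e] _
        transition_holomorphic[OF c e] smooth_formsD(2)[OF u e]])
    show "transition c e ` overlap c e \<subseteq> snd e ` fst e"
      using transition_overlap(1)[OF c e] overlap_image[of e c] by blast
  qed (rule form_rep_transition[OF c e])
  moreover have "transition c e x = snd e p" by (simp add: transition_def p_def)
  moreover have "tangent_coord \<A> c x = frechet_derivative (transition c e) (at x)"
    unfolding tangent_coord_eq e_def p_def ..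
  ultimately show ?thesis by (simp add: form_rep_def dop_def p_def[symmetric] e_def[symmetric])
qed

lemma chart_at_image: "snd (chart_at \<A> p) p \<in> snd (chart_at \<A> p) ` fst (chart_at \<A> p)"
  using chart_at by blast

lemma dop_smooth:
  assumes u: "u \<in> smooth_forms \<A>"
  shows "dop s \<A> u \<in> smooth_forms \<A>"
proof -
  have F: "smooth_field (snd c ` fst c) (dloc s (form_rep \<A> u c))" if "c \<in> \<A>" for c
    by (rule dloc_smooth_field[OF chart(2)[OF that] smooth_formsD(2)[OF u that]])
  have "alternating (dop s \<A> u p)" for p
    unfolding dop_def by (rule smooth_fieldD(1)[OF F[OF chart_at(1)] chart_at_image])
  moreover have "smooth_on (snd c ` fst c) (\<lambda>x. form_rep \<A> (dop s \<A> u) c x l)" if c: "c \<in> \<A>" for c l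
    by (rule smooth_on_cong[OF chart(2)[OF c] smooth_fieldD(2)[OF F[OF c]]])
      (simp add: form_rep_dop[OF u c])
  ultimately show ?thesis by (simp add: smooth_forms_def)
qed

lemma smooth_forms_combination:
  assumes u: "u \<in> smooth_forms \<A>" and v: "v \<in> smooth_forms \<A>"
  shows "(\<lambda>p l. a * u p l + b * v p l) \<in> smooth_forms \<A>"
proof -
  have "smooth_on (snd c ` fst c) (\<lambda>x. a * form_rep \<A> u c x l + b * form_rep \<A> v c x l)"
    if "c \<in> \<A>" for c l
    using smooth_fieldD(2)[OF smooth_formsD(2)[OF u that]] smooth_fieldD(2)[OF smooth_formsD(2)[OF v that]]
    by (intro smooth_on_add smooth_on_mult_left chart(2)[OF that])
  then show ?thesis
    using smooth_formsD(1)[OF u] smooth_formsD(1)[OF v]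
    by (simp add: smooth_forms_def alternating_combination form_rep_def)
qed

lemma dop_linear:
  assumes u: "u \<in> smooth_forms \<A>" and v: "v \<in> smooth_forms \<A>"
  shows "dop s \<A> (\<lambda>p l. a * u p l + b * v p l) = (\<lambda>p l. a * dop s \<A> u p l + b * dop s \<A> v p l)"
proof (intro HOL.ext)
  fix p l
  define e where "e = chart_at \<A> p"
  have e: "e \<in> \<A>" unfolding e_def by (rule chart_at)
  have "form_rep \<A> (\<lambda>p l. a * u p l + b * v p l) e = (\<lambda>x l. a * form_rep \<A> u e x l + b * form_rep \<A> v e x l)"
    by (intro HOL.ext) (simp add: form_rep_def)
  then show "dop s \<A> (\<lambda>p l. a * u p l + b * v p l) p l = a * dop s \<A> u p l + b * dop s \<A> v p l"
    unfolding dop_def e_def[symmetric]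
    using dloc_linear[OF _ smooth_formsD(2)[OF u e] smooth_formsD(2)[OF v e]] chart_at_image[of p]
    by (simp add: e_def)
qed

lemma dop_support:
  assumes u: "u \<in> smooth_forms \<A>"
  shows "form_support (dop s \<A> u) \<subseteq> form_support u"
proof -
  have "dop s \<A> u p l = 0" if p: "p \<notin> form_support u" for p l
  proof -
    define N where "N = - form_support u"
    define e where "e = chart_at \<A> p"
    have e: "e \<in> \<A>" "p \<in> fst e" unfolding e_def by (rule chart_at)+
    have N: "open N" "p \<in> N" using p by (auto simp: N_def form_support_def)
    have zero: "u q m = 0" if "q \<in> N" for q m
      using that closure_subset[of "{p. \<exists>l. u p l \<noteq> 0}"] by (auto simp: N_def form_support_def)
    define S where "S = snd e ` (fst e \<inter> N)"
    have S: "open S" "snd e p \<in> S"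
      unfolding S_def using open_chart_image[OF e(1) N(1)] e N by auto
    have F: "smooth_field S (form_rep \<A> u e)"
      using smooth_formsD(2)[OF u e(1)] smooth_on_subset[of "snd e ` fst e" _ S]
      unfolding smooth_field_def S_def by blast
    have "form_rep \<A> u e y m = 0" if "y \<in> S" for y m
      using that chart_inv_left[OF e(1)] zero by (auto simp: S_def form_rep_def)
    then have "dloc s (\<lambda>_ _. 0) (snd e p) = dloc s (form_rep \<A> u e) (snd e p)"
      by (intro dloc_cong_open[OF S F]) simp
    moreover have "dloc s (\<lambda>_ _. 0) (snd e p) l = 0"
      by (simp add: dloc_def pd_const alt_sum_zero)
    ultimately show ?thesis by (simp add: dop_def e_def)
  qed
  then have "{p. \<exists>l. dop s \<A> u p l \<noteq> 0} \<subseteq> form_support u" by blast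
  then show ?thesis
    unfolding form_support_def[of "dop s \<A> u"]
    by (rule closure_minimal) (simp add: form_support_def)
qed

lemma dop_local: "local_operator \<A> (dop s \<A>)"
  unfolding local_operator_def using dop_smooth dop_support dop_linear by simp

lemma dop_anticommute:
  assumes u: "u \<in> smooth_forms \<A>"
  shows "dop s \<A> (dop t \<A> u) p l + dop t \<A> (dop s \<A> u) p l = 0"
proof -
  define e where "e = chart_at \<A> p"
  have e: "e \<in> \<A>" "p \<in> fst e" unfolding e_def by (rule chart_at)+
  note F = smooth_formsD(2)[OF u e(1)]
  have x: "snd e p \<in> snd e ` fst e" using e by blast
  have "dop s \<A> (dop t \<A> u) p l = dloc s (dloc t (form_rep \<A> u e)) (snd e p) l" for s t
    unfolding dop_def[of s \<A> "dop t \<A> u"] e_def[symmetric]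
    by (subst dloc_cong_open[OF chart(2)[OF e(1)] x dloc_smooth_field[OF chart(2)[OF e(1)] F]])
      (simp_all add: form_rep_dop[OF u e(1)])
  then show ?thesis using dloc_anticommute[OF chart(2)[OF e(1)] x F] by simp
qed

end


section \<open>Measurability of forms and local finiteness of the volume\<close>

text \<open>Cramer's rule makes the entries of the inverse continuous functions of the matrix.\<close>

lemma matrix_inv_cramer:
  fixes A :: "real^'i^'i"
  assumes "invertible A"
  shows "matrix_inv A $ k $ j = det (\<chi> i l. if l = k then (if i = j then 1 else 0) else A $ i $ l) / det A"
proof -
  define B where "B = matrix_inv A"
  have "\<exists>B. A ** B = mat 1 \<and> B ** A = mat 1" using assms by (simp add: invertible_def)
  from someI_ex[OF this] have AB: "A ** B = mat 1" unfolding B_def matrix_inv_def by (rule conjunct1)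
  have det: "det A \<noteq> 0" using assms invertible_det_nz by blast
  have "A *v (\<chi> i. B $ i $ j) = (\<chi> i. if i = j then 1 else 0)"
  proof -
    have "(A ** B) $ i $ j = (if i = j then 1 else 0)" for i unfolding AB by (simp add: mat_def)
    then show ?thesis by (simp add: vec_eq_iff matrix_matrix_mult_def matrix_vector_mult_def)
  qed
  then have "(\<chi> i. B $ i $ j) =
      (\<chi> k. det (\<chi> i l. if l = k then (\<chi> i. if i = j then 1 else 0) $ i else A $ i $ l) / det A)"
    using cramer[OF det] by blast
  then have "(\<chi> i. B $ i $ j) $ k =
      det (\<chi> i l. if l = k then (\<chi> i. if i = j then 1 else 0) $ i else A $ i $ l) / det A"
    by simp
  moreover have "(\<chi> i l. if l = k then (\<chi> i. if i = j then 1 else 0) $ i else A $ i $ l) =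
      ((\<chi> i l. if l = k then (if i = j then 1 else 0) else A $ i $ l) :: real^'i^'i)"
    by (simp add: vec_eq_iff)
  ultimately show ?thesis by (simp only: B_def vec_lambda_beta)
qed

lemma continuous_on_det:
  fixes A :: "'b::topological_space \<Rightarrow> real^'i^'i"
  assumes "\<And>i j. continuous_on S (\<lambda>x. A x $ i $ j)"
  shows "continuous_on S (\<lambda>x. det (A x))"
  unfolding det_def by (intro continuous_intros assms)

lemma continuous_on_matrix_inv:
  fixes A :: "'b::topological_space \<Rightarrow> real^'i^'i"
  assumes A: "\<And>i j. continuous_on S (\<lambda>x. A x $ i $ j)" and inv: "\<And>x. x \<in> S \<Longrightarrow> invertible (A x)"
  shows "continuous_on S (\<lambda>x. matrix_inv (A x) $ k $ j)"
proof -
  have nz: "\<forall>x\<in>S. det (A x) \<noteq> 0" using inv invertible_det_nz by blast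
  have "continuous_on S (\<lambda>x. det (\<chi> i l. if l = k then (if i = j then 1 else 0) else A x $ i $ l) / det (A x))"
  proof (intro continuous_on_divide continuous_on_det A nz)
    show "continuous_on S (\<lambda>x. (\<chi> i l. if l = k then (if i = j then 1 else 0) else A x $ i $ l) $ a $ b)" for a b
      using A by (cases "b = k") simp_all
  qed
  then show ?thesis
    by (rule continuous_on_eq) (simp add: matrix_inv_cramer[OF inv])
qed

lemma contraction_map:
  "contraction k H (\<lambda>i. T (e i)) \<alpha> \<beta> = contraction k H e (\<lambda>l. \<alpha> (map T l)) (\<lambda>l. \<beta> (map T l))"
  by (induction k arbitrary: \<alpha> \<beta>) simp_all

lemma continuous_on_contraction:
  assumes H: "\<And>i j. continuous_on S (\<lambda>x. H x $ i $ j)"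
  shows "(\<And>l. continuous_on S (\<lambda>x. \<alpha> x l)) \<Longrightarrow> (\<And>l. continuous_on S (\<lambda>x. \<beta> x l)) \<Longrightarrow>
    continuous_on S (\<lambda>x. contraction k (H x) e (\<alpha> x) (\<beta> x))"
proof (induction k arbitrary: \<alpha> \<beta>)
  case 0
  then show ?case by (auto intro!: continuous_intros)
next
  case (Suc k)
  show ?case
    unfolding contraction.simps
    by (intro continuous_on_sum continuous_on_mult continuous_on_of_real H Suc.IH Suc.prems)
qed

lemma borel_measurable_contraction:
  assumes H: "\<And>i j. (\<lambda>x. H x $ i $ j) \<in> borel_measurable M"
  shows "(\<And>l. (\<lambda>x. \<alpha> x l) \<in> borel_measurable M) \<Longrightarrow> (\<And>l. (\<lambda>x. \<beta> x l) \<in> borel_measurable M) \<Longrightarrow>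
    (\<lambda>x. contraction k (H x) e (\<alpha> x) (\<beta> x)) \<in> borel_measurable M"
proof (induction k arbitrary: \<alpha> \<beta>)
  case 0
  have "cnj \<in> borel_measurable borel" by (intro borel_measurable_continuous_onI continuous_intros)
  from measurable_compose[OF 0(2) this] show ?case
    using 0(1) by (auto intro!: borel_measurable_times)
next
  case (Suc k)
  have "(\<lambda>x. complex_of_real (H x $ i $ j)) \<in> borel_measurable M" for i j
    by (rule measurable_compose[OF H]) (intro borel_measurable_continuous_onI continuous_intros)
  then show ?case
    unfolding contraction.simps
    by (intro borel_measurable_sum borel_measurable_times Suc.IH Suc.prems)
qed

locale hermitian_volume = complex_manifold \<A>
  for \<A> :: "('m::{t2_space, second_countable_topology}, 'n::finite) chart set" +
  fixes g :: "('m, 'n) metric_tensor" and \<mu> :: "'m measure"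
  assumes hermitian: "hermitian_manifold \<A> g" and volume: "riemannian_volume \<A> g \<mu>"
begin

lemma positive_definite_metric: "positive_definite (g p)"
  using hermitian unfolding hermitian_manifold_def riemannian_metric_def positive_definite_def by blast

lemma metric_rep_smooth: "c \<in> \<A> \<Longrightarrow> smooth_on (snd c ` fst c) (\<lambda>x. metric_rep \<A> g c x v w)"
  using hermitian unfolding hermitian_manifold_def riemannian_metric_def by blast

lemma sets_volume: "sets \<mu> = sets borel"
  using volume by (simp add: riemannian_volume_def)

lemma space_volume: "space \<mu> = UNIV"
  using sets_eq_imp_space_eq[OF sets_volume] by simp

lemma continuous_on_chart: "c \<in> \<A> \<Longrightarrow> continuous_on (fst c) (snd c)"
  using chart(3) by (simp add: homeomorphism_def)

lemma continuous_on_smooth_chart: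
  assumes "c \<in> \<A>" "smooth_on (snd c ` fst c) f"
  shows "continuous_on (fst c) (\<lambda>p. f (snd c p))"
  using continuous_on_compose2[OF smooth_on_continuous_on[OF assms(2)] continuous_on_chart[OF assms(1)]]
  by simp

definition inverse_gram :: "('m, 'n) chart \<Rightarrow> 'm \<Rightarrow> real^('n + 'n)^('n + 'n)" where
  "inverse_gram c p = matrix_inv (\<chi> i j. metric_rep \<A> g c (snd c p) (real_basis_vec i) (real_basis_vec j))"

lemma gram_matrix_metric:
  assumes "c \<in> \<A>" "p \<in> fst c"
  shows "gram_matrix (g p) (\<lambda>i. tangent_coord \<A> c (snd c p) (real_basis_vec i)) =
    (\<chi> i j. metric_rep \<A> g c (snd c p) (real_basis_vec i) (real_basis_vec j))"
  using chart_inv_left[OF assms] by (simp add: gram_matrix_def metric_rep_def)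

lemma continuous_on_inverse_gram:
  assumes c: "c \<in> \<A>"
  shows "continuous_on (fst c) (\<lambda>p. inverse_gram c p $ i $ j)"
  unfolding inverse_gram_def
proof (rule continuous_on_matrix_inv)
  show "continuous_on (fst c) (\<lambda>p. (\<chi> i j. metric_rep \<A> g c (snd c p) (real_basis_vec i) (real_basis_vec j)) $ i $ j)" for i j
    using continuous_on_smooth_chart[OF c metric_rep_smooth[OF c]] by simp
  fix p assume p: "p \<in> fst c"
  then obtain k where k: "frame_coords (\<lambda>i. tangent_coord \<A> c (snd c p) (real_basis_vec i)) k"
    using tangent_frame[OF c, of "snd c p"] by blast
  show "invertible (\<chi> i j. metric_rep \<A> g c (snd c p) (real_basis_vec i) (real_basis_vec j))"
    using gram_matrix_inverse(1)[OF positive_definite_metric orthonormal_basis_some[OF positive_definite_metric] k, of p]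
    unfolding gram_matrix_metric[OF c p] .
qed

text \<open>The inner product of forms in a chart, free of the choice of an orthonormal basis.\<close>

lemma form_inner_chart:
  assumes c: "c \<in> \<A>" and p: "p \<in> fst c" and "alternating (u p)" "alternating (v p)"
  shows "form_inner (g p) (u p) (v p) = (\<Sum>k\<le>DIM(complex^'n).
    contraction k (inverse_gram c p) real_basis_vec
      (form_rep \<A> u c (snd c p)) (form_rep \<A> v c (snd c p)) / fact k)"
proof -
  have "snd c p \<in> snd c ` fst c" using p by blast
  then obtain k where k: "frame_coords (\<lambda>i. tangent_coord \<A> c (snd c p) (real_basis_vec i)) k"
    using tangent_frame[OF c] by blast
  have rep: "form_rep \<A> u c (snd c p) = (\<lambda>l. u p (map (tangent_coord \<A> c (snd c p)) l))" for u
    by (rule HOL.ext) (simp add: form_rep_def chart_inv_left[OF c p])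
  show ?thesis
    unfolding form_inner_eq_contraction[OF positive_definite_metric k assms(3,4)]
      gram_matrix_metric[OF c p] inverse_gram_def[symmetric] contraction_map rep ..
qed

lemma countable_charts:
  obtains C where "countable C" "C \<subseteq> fst ` \<A>" "\<Union>C = UNIV"
proof -
  have "S \<in> fst ` \<A> \<Longrightarrow> open S" for S using chart(1) by auto
  from Lindelof[OF this] obtain C where C: "C \<subseteq> fst ` \<A>" "countable C" "\<Union>C = \<Union>(fst ` \<A>)" by blast
  moreover have "\<Union>(fst ` \<A>) = UNIV" using chart_at by blast
  ultimately show ?thesis using that by auto
qed

lemma measurable_formsD:
  assumes "u \<in> measurable_forms \<A>"
  shows "alternating (u p)"
    "c \<in> \<A> \<Longrightarrow> (\<lambda>p. form_rep \<A> u c (snd c p) l) \<in> borel_measurable (restrict_space borel (fst c))"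
  using assms by (auto simp: measurable_forms_def split_beta)

text \<open>The chart formula shows measurability on each chart domain, and countably many of these
  cover the manifold.\<close>

lemma form_inner_measurable:
  assumes u: "u \<in> measurable_forms \<A>" and v: "v \<in> measurable_forms \<A>"
  shows "(\<lambda>p. form_inner (g p) (u p) (v p)) \<in> borel_measurable \<mu>"
proof -
  obtain C where C: "countable C" "C \<subseteq> fst ` \<A>" "\<Union>C = UNIV" by (rule countable_charts)
  have "(\<lambda>p. form_inner (g p) (u p) (v p)) \<in> borel_measurable borel"
  proof (rule measurable_piecewise_restrict[OF C(1)])
    fix U assume "U \<in> C"
    then obtain c where c: "c \<in> \<A>" "U = fst c" using C by blast
    show "U \<inter> space borel \<in> sets borel" using chart(1)[OF c(1)] c(2) by simp
    have "(\<lambda>p. \<Sum>k\<le>DIM(complex^'n). contraction k (inverse_gram c p) real_basis_vec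
        (form_rep \<A> u c (snd c p)) (form_rep \<A> v c (snd c p)) / fact k)
        \<in> borel_measurable (restrict_space borel U)"
      unfolding c(2)
      by (intro borel_measurable_sum borel_measurable_divide borel_measurable_const
          borel_measurable_contraction measurable_formsD(2)[OF u c(1)] measurable_formsD(2)[OF v c(1)]
          borel_measurable_continuous_on_restrict continuous_on_inverse_gram c(1))
    then show "(\<lambda>p. form_inner (g p) (u p) (v p)) \<in> borel_measurable (restrict_space borel U)"
      by (rule measurable_cong[THEN iffD2, rotated])
        (use form_inner_chart[OF c(1)] measurable_formsD(1)[OF u] measurable_formsD(1)[OF v] in
          \<open>simp add: c(2) space_restrict_space\<close>)
  qed (use C in simp)
  then show ?thesis using measurable_cong_sets[OF sets_volume refl] by blast
qed

lemma form_rep_continuous: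
  assumes u: "u \<in> smooth_forms \<A>" and c: "c \<in> \<A>"
  shows "continuous_on (fst c) (\<lambda>p. form_rep \<A> u c (snd c p) l)"
  by (rule continuous_on_smooth_chart[OF c smooth_fieldD(2)[OF smooth_formsD(2)[OF u c]]])

lemma smooth_forms_measurable: "smooth_forms \<A> \<subseteq> measurable_forms \<A>"
proof
  fix u assume u: "u \<in> smooth_forms \<A>"
  show "u \<in> measurable_forms \<A>"
    using smooth_formsD(1)[OF u] form_rep_continuous[OF u]
    by (auto simp: measurable_forms_def intro!: borel_measurable_continuous_on_restrict)
qed

lemma form_inner_continuous:
  assumes u: "u \<in> smooth_forms \<A>" and v: "v \<in> smooth_forms \<A>"
  shows "continuous_on UNIV (\<lambda>p. form_inner (g p) (u p) (v p))"
proof -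
  have "continuous_on (\<Union>(fst ` \<A>)) (\<lambda>p. form_inner (g p) (u p) (v p))"
  proof (rule continuous_on_open_Union)
    fix U assume "U \<in> fst ` \<A>"
    then obtain c where c: "c \<in> \<A>" "U = fst c" by blast
    show "open U" using chart(1)[OF c(1)] c(2) by simp
    have "continuous_on U (\<lambda>p. \<Sum>k\<le>DIM(complex^'n). contraction k (inverse_gram c p) real_basis_vec
        (form_rep \<A> u c (snd c p)) (form_rep \<A> v c (snd c p)) / fact k)"
      unfolding c(2)
      by (intro continuous_on_sum continuous_on_divide continuous_on_const continuous_on_contraction
          form_rep_continuous[OF u c(1)] form_rep_continuous[OF v c(1)] continuous_on_inverse_gram c(1)) simp
    then show "continuous_on U (\<lambda>p. form_inner (g p) (u p) (v p))"
      by (rule continuous_on_eq)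
        (use form_inner_chart[OF c(1)] smooth_formsD(1)[OF u] smooth_formsD(1)[OF v] in \<open>simp add: c(2)\<close>)
  qed
  moreover have "\<Union>(fst ` \<A>) = UNIV" using chart_at by blast
  ultimately show ?thesis by simp
qed

lemma volume_density_continuous:
  assumes c: "c \<in> \<A>"
  shows "continuous_on (snd c ` fst c) (volume_density \<A> g c)"
  unfolding volume_density_def
  by (intro continuous_on_real_sqrt continuous_on_det)
    (use smooth_on_continuous_on[OF metric_rep_smooth[OF c]] in simp)

text \<open>In a chart the volume density is continuous, hence bounded on a small closed ball.\<close>

lemma locally_finite_volume: "\<exists>N. open N \<and> p \<in> N \<and> emeasure \<mu> N < \<infinity>"
proof -
  define c where "c = chart_at \<A> p"
  have c: "c \<in> \<A>" "p \<in> fst c" unfolding c_def by (rule chart_at)+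
  obtain r where r: "r > 0" "cball (snd c p) r \<subseteq> snd c ` fst c"
    using chart(2)[OF c(1)] c(2) open_contains_cball by (metis image_eqI)
  define N where "N = fst c \<inter> snd c -` ball (snd c p) r"
  have N: "open N" "p \<in> N" "N \<subseteq> fst c"
    unfolding N_def using continuous_open_preimage[OF continuous_on_chart[OF c(1)] chart(1)[OF c(1)] open_ball] c r
    by auto
  have "compact (volume_density \<A> g c ` cball (snd c p) r)"
    by (intro compact_continuous_image continuous_on_subset[OF volume_density_continuous[OF c(1)] r(2)]) simp
  then obtain B where B: "\<And>x. x \<in> cball (snd c p) r \<Longrightarrow> norm (volume_density \<A> g c x) \<le> B"
    using compact_imp_bounded bounded_iff by (metis image_eqI)
  have "emeasure \<mu> N = (\<integral>\<^sup>+x. ennreal (volume_density \<A> g c x) * indicator (snd c ` N) x \<partial>lborel)"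
  proof -
    have "N \<in> sets borel" using N(1) by simp
    moreover have "\<forall>c\<in>\<A>. \<forall>S\<in>sets borel. S \<subseteq> fst c \<longrightarrow> emeasure \<mu> S =
        (\<integral>\<^sup>+x. ennreal (volume_density \<A> g c x) * indicator (snd c ` S) x \<partial>lborel)"
      using volume by (simp add: riemannian_volume_def)
    ultimately show ?thesis using c(1) N(3) by blast
  qed
  also have "\<dots> \<le> (\<integral>\<^sup>+x. ennreal B * indicator (cball (snd c p) r) x \<partial>lborel)"
  proof (rule nn_integral_mono)
    fix x
    show "ennreal (volume_density \<A> g c x) * indicator (snd c ` N) x \<le>
        ennreal B * indicator (cball (snd c p) r) x"
    proof (cases "x \<in> snd c ` N")
      case True
      then have x: "x \<in> cball (snd c p) r" by (auto simp: N_def)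
      then show ?thesis using B[OF x] True by (simp add: ennreal_leI)
    qed simp
  qed
  also have "\<dots> = ennreal B * emeasure lborel (cball (snd c p) r)"
    by (rule nn_integral_cmult_indicator) simp
  also have "\<dots> < \<infinity>"
    using emeasure_bounded_finite[of "cball (snd c p) r"] by (simp add: ennreal_mult_less_top)
  finally show ?thesis using N by blast
qed

lemma compact_finite_volume:
  assumes K: "compact K"
  shows "emeasure \<mu> K < \<infinity>"
proof -
  define F where "F = {N. open N \<and> emeasure \<mu> N < \<infinity>}"
  have "K \<subseteq> \<Union>F" using locally_finite_volume by (auto simp: F_def)
  from this obtain F' where F': "F' \<subseteq> F" "finite F'" "K \<subseteq> \<Union>F'"
  proof -
    assume that: "\<And>F'. F' \<subseteq> F \<Longrightarrow> finite F' \<Longrightarrow> K \<subseteq> \<Union>F' \<Longrightarrow> thesis"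
    have op: "\<And>N. N \<in> F \<Longrightarrow> open N" by (simp add: F_def)
    show thesis by (rule compactE[OF K \<open>K \<subseteq> \<Union>F\<close> op that])
  qed
  have sets: "F' \<subseteq> sets \<mu>" using F'(1) by (auto simp: F_def sets_volume)
  have "emeasure \<mu> K \<le> emeasure \<mu> (\<Union>F')"
    by (rule emeasure_mono[OF F'(3)]) (use F'(2) sets in auto)
  also have "\<dots> \<le> (\<Sum>N\<in>F'. emeasure \<mu> N)"
    using emeasure_subadditive_finite[OF F'(2), of "\<lambda>N. N" \<mu>] sets by auto
  also have "\<dots> < \<infinity>" using F' by (auto simp: F_def)
  finally show ?thesis .
qed

text \<open>The pointwise norm of a smooth form is continuous, so it is bounded on the support, which
  has finite volume.\<close>

lemma test_forms_L2: "test_forms \<A> \<subseteq> L2_forms \<A> g \<mu>"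
proof
  fix u assume "u \<in> test_forms \<A>"
  then have u: "u \<in> smooth_forms \<A>" and K: "compact (form_support u)"
    by (auto simp: test_forms_def)
  define f where "f p = form_inner (g p) (u p) (u p)" for p
  have m: "u \<in> measurable_forms \<A>" using u smooth_forms_measurable by blast
  have "compact (f ` form_support u)"
    unfolding f_def by (intro compact_continuous_image continuous_on_subset[OF form_inner_continuous[OF u u]] K) simp
  then obtain B where B: "\<And>p. p \<in> form_support u \<Longrightarrow> norm (f p) \<le> B"
    using compact_imp_bounded bounded_iff by (metis image_eqI)
  have zero: "f p = 0" if "p \<notin> form_support u" for p
  proof -
    have "u p l = 0" for l
      using that closure_subset[of "{p. \<exists>l. u p l \<noteq> 0}"] by (auto simp: form_support_def)
    then show ?thesis by (simp add: f_def form_inner_alt)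
  qed
  have "integrable \<mu> f"
  proof (rule integrableI_bounded_set[of "form_support u" _ _ B])
    show "form_support u \<in> sets \<mu>" by (simp add: sets_volume form_support_def)
    show "f \<in> borel_measurable \<mu>" unfolding f_def[abs_def] by (rule form_inner_measurable[OF m m])
    show "emeasure \<mu> (form_support u) < \<infinity>" by (rule compact_finite_volume[OF K])
  qed (use B zero in auto)
  then show "u \<in> L2_forms \<A> g \<mu>" using m by (simp add: L2_forms_def f_def[abs_def])
qed

end


section \<open>The Hilbert space of square-integrable forms\<close>

definition form_scale :: "complex \<Rightarrow> ('m, 'n) form \<Rightarrow> ('m, 'n) form" where
  "form_scale c u = (\<lambda>p l. c * u p l)"

context hermitian_volume
begin

definition nsq :: "('m, 'n) form \<Rightarrow> 'm \<Rightarrow> real" where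
  "nsq u p = Re (form_inner (g p) (u p) (u p))"

lemma nsq_eq: "nsq u p = (\<Sum>l\<in>frame_lists (g p). (cmod (u p l))\<^sup>2 / fact (length l))"
  unfolding nsq_def by (rule Re_form_inner_self)

lemma nsq_nonneg: "0 \<le> nsq u p"
  unfolding nsq_def by (rule form_inner_self_nonneg)

lemma nsq_measurable: "u \<in> measurable_forms \<A> \<Longrightarrow> nsq u \<in> borel_measurable \<mu>"
  unfolding nsq_def[abs_def]
  by (rule measurable_compose[OF form_inner_measurable])
    (auto intro!: borel_measurable_continuous_onI continuous_intros)

lemma measurable_forms_combination:
  assumes u: "u \<in> measurable_forms \<A>" and v: "v \<in> measurable_forms \<A>"
  shows "(\<lambda>p l. a * u p l + b * v p l) \<in> measurable_forms \<A>"
proof -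
  have "(\<lambda>p. a * form_rep \<A> u c (snd c p) l + b * form_rep \<A> v c (snd c p) l)
      \<in> borel_measurable (restrict_space borel (fst c))" if "c \<in> \<A>" for c l
    by (intro borel_measurable_add borel_measurable_times borel_measurable_const
        measurable_formsD(2)[OF u that] measurable_formsD(2)[OF v that])
  then show ?thesis
    using measurable_formsD(1)[OF u] measurable_formsD(1)[OF v]
    by (auto simp: measurable_forms_def alternating_combination form_rep_def)
qed

lemma measurable_forms_add: "u \<in> measurable_forms \<A> \<Longrightarrow> v \<in> measurable_forms \<A> \<Longrightarrow> u + v \<in> measurable_forms \<A>"
  using measurable_forms_combination[of u v 1 1] by (simp add: plus_fun_def)

lemma measurable_forms_diff: "u \<in> measurable_forms \<A> \<Longrightarrow> v \<in> measurable_forms \<A> \<Longrightarrow> u - v \<in> measurable_forms \<A>"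
  using measurable_forms_combination[of u v 1 "-1"] by (simp add: fun_diff_def)

lemma measurable_forms_scale: "u \<in> measurable_forms \<A> \<Longrightarrow> form_scale c u \<in> measurable_forms \<A>"
  using measurable_forms_combination[of u u c 0] by (simp add: form_scale_def)

lemma integrable_form_inner_iff:
  assumes "u \<in> measurable_forms \<A>"
  shows "integrable \<mu> (\<lambda>p. form_inner (g p) (u p) (u p)) \<longleftrightarrow> integrable \<mu> (nsq u)"
proof -
  have "(\<lambda>p. form_inner (g p) (u p) (u p)) = (\<lambda>p. complex_of_real (nsq u p))"
    using form_inner_self_real by (intro HOL.ext) (simp add: nsq_def)
  then show ?thesis
    using integrable_of_real[of \<mu> "nsq u"] integrable_Re[of \<mu> "\<lambda>p. complex_of_real (nsq u p)"] by auto
qed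

lemma L2_forms_iff: "u \<in> L2_forms \<A> g \<mu> \<longleftrightarrow> u \<in> measurable_forms \<A> \<and> integrable \<mu> (nsq u)"
  using integrable_form_inner_iff by (auto simp: L2_forms_def)

lemma nsq_add: "nsq (u + v) p \<le> 2 * nsq u p + 2 * nsq v p"
  using form_inner_add_bound[of "g p" "u p" "v p"] by (simp add: nsq_def plus_fun_def)

lemma nsq_scale: "nsq (form_scale c u) p = (cmod c)\<^sup>2 * nsq u p"
  by (simp add: nsq_eq form_scale_def norm_mult power_mult_distrib sum_distrib_left)

lemma L2_forms_add:
  assumes "u \<in> L2_forms \<A> g \<mu>" "v \<in> L2_forms \<A> g \<mu>"
  shows "u + v \<in> L2_forms \<A> g \<mu>"
proof -
  have m: "u + v \<in> measurable_forms \<A>"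
    using assms by (intro measurable_forms_add) (auto simp: L2_forms_iff)
  have "integrable \<mu> (\<lambda>p. 2 * nsq u p + 2 * nsq v p)"
    using assms by (auto simp: L2_forms_iff)
  then have "integrable \<mu> (nsq (u + v))"
    by (rule Bochner_Integration.integrable_bound[OF _ nsq_measurable[OF m]])
      (simp add: nsq_add nsq_nonneg)
  then show ?thesis using m by (simp add: L2_forms_iff)
qed

lemma L2_forms_scale: "u \<in> L2_forms \<A> g \<mu> \<Longrightarrow> form_scale c u \<in> L2_forms \<A> g \<mu>"
  by (simp add: L2_forms_iff measurable_forms_scale nsq_scale[abs_def])

lemma L2_forms_zero: "0 \<in> L2_forms \<A> g \<mu>"
proof -
  have "0 \<in> measurable_forms \<A>"
    by (auto simp: measurable_forms_def alternating_def form_rep_def zero_fun_def intro!: linearI)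
  moreover have "nsq 0 = (\<lambda>p. 0)" by (intro HOL.ext) (simp add: nsq_eq)
  ultimately show ?thesis by (simp add: L2_forms_iff)
qed

lemma integrable_form_inner:
  assumes "u \<in> L2_forms \<A> g \<mu>" "v \<in> L2_forms \<A> g \<mu>"
  shows "integrable \<mu> (\<lambda>p. form_inner (g p) (u p) (v p))"
proof (rule Bochner_Integration.integrable_bound)
  show "integrable \<mu> (\<lambda>p. nsq u p + nsq v p)" using assms by (auto simp: L2_forms_iff)
  show "(\<lambda>p. form_inner (g p) (u p) (v p)) \<in> borel_measurable \<mu>"
    using assms by (intro form_inner_measurable) (auto simp: L2_forms_iff)
  show "AE p in \<mu>. cmod (form_inner (g p) (u p) (v p)) \<le> norm (nsq u p + nsq v p)"
    using form_inner_bound by (auto simp: nsq_def form_inner_self_nonneg)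
qed

sublocale L2: semi_inner_product "L2_forms \<A> g \<mu>" form_scale "L2_inner g \<mu>"
proof
  fix u v w :: "('m, 'n) form" and c :: complex
  show "form_scale (- 1) u = - u" by (simp add: form_scale_def fun_Compl_def)
  assume u: "u \<in> L2_forms \<A> g \<mu>"
  show "0 \<le> Re (L2_inner g \<mu> u u)"
    unfolding L2_inner_def integral_Re[OF integrable_form_inner[OF u u], symmetric]
    by (rule integral_nonneg_AE) (simp add: form_inner_self_nonneg)
  assume v: "v \<in> L2_forms \<A> g \<mu>"
  show "L2_inner g \<mu> (form_scale c u) v = c * L2_inner g \<mu> u v"
    by (simp add: L2_inner_def form_scale_def form_inner_scale_left)
  show "L2_inner g \<mu> v u = cnj (L2_inner g \<mu> u v)"
    unfolding L2_inner_def using form_inner_cnj[of "g _" "v _" "u _"] by (simp add: integral_cnj)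
  assume w: "w \<in> L2_forms \<A> g \<mu>"
  show "L2_inner g \<mu> (u + v) w = L2_inner g \<mu> u w + L2_inner g \<mu> v w"
    using integrable_form_inner[OF u w] integrable_form_inner[OF v w]
    by (simp add: L2_inner_def plus_fun_def form_inner_add_left)
qed (rule L2_forms_zero L2_forms_add L2_forms_scale; assumption)+

lemma nn_integral_nsq:
  assumes "u \<in> L2_forms \<A> g \<mu>"
  shows "(\<integral>\<^sup>+p. ennreal (nsq u p) \<partial>\<mu>) = ennreal ((L2.nrm u)\<^sup>2)"
proof -
  have "(\<integral>p. nsq u p \<partial>\<mu>) = Re (L2_inner g \<mu> u u)"
    using integral_Re[OF integrable_form_inner[OF assms assms]] by (simp add: L2_inner_def nsq_def[abs_def])
  then show ?thesis
    using assms nsq_nonneg by (simp add: nn_integral_eq_integral L2_forms_iff L2.nrm_square)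
qed

text \<open>The weights \<open>4 ^ k\<close> come from \<open>2 a \<le> 4 ^ k * a\<^sup>2 + (1/4) ^ k\<close>, which bounds the increments
  \<open>a\<close> themselves by a summable sequence.\<close>

lemma pointwise_convergent:
  assumes X: "\<And>k. alternating (X k)" and h: "positive_definite h"
    and s: "summable (\<lambda>k. 4 ^ k * Re (form_inner h (\<lambda>l. X (Suc k) l - X k l) (\<lambda>l. X (Suc k) l - X k l)))"
  shows "convergent (\<lambda>k. X k l)"
proof (rule convergent_form_values[OF h X])
  fix l assume l: "l \<in> frame_lists h"
  define d where "d k = Re (form_inner h (\<lambda>l. X (Suc k) l - X k l) (\<lambda>l. X (Suc k) l - X k l))" for k
  have "cmod (X (Suc k) l - X k l) \<le> fact (length l) * (4 ^ k * d k) + (1/4) ^ k" for k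
  proof -
    define a where "a = cmod (X (Suc k) l - X k l)"
    have "a\<^sup>2 / fact (length l) \<le> d k"
      unfolding d_def Re_form_inner_self a_def
      by (rule member_le_sum[OF l]) (auto simp: finite_frame_lists[OF h])
    then have "a\<^sup>2 \<le> fact (length l) * d k" by (simp add: field_simps)
    then have "4 ^ k * a\<^sup>2 \<le> fact (length l) * (4 ^ k * d k)"
      by (simp add: mult.left_commute)
    moreover have "2 * a \<le> 4 ^ k * a\<^sup>2 + (1/4) ^ k"
    proof -
      have "0 \<le> (2 ^ k * a - (1/2) ^ k)\<^sup>2" by simp
      also have "\<dots> = (2 ^ k)\<^sup>2 * a\<^sup>2 - 2 * (2 ^ k * (1/2) ^ k) * a + ((1/2) ^ k)\<^sup>2"
        by (simp add: power2_diff power_mult_distrib)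
      also have "(2 ^ k)\<^sup>2 = (4 ^ k :: real)" by (simp add: power2_eq_square power_mult_distrib[symmetric])
      also have "((1/2) ^ k)\<^sup>2 = ((1/4) ^ k :: real)" by (simp add: power2_eq_square power_mult_distrib[symmetric])
      also have "2 ^ k * (1/2) ^ k = (1::real)" by (simp add: power_mult_distrib[symmetric])
      finally show ?thesis by simp
    qed
    moreover have "0 \<le> a" by (simp add: a_def)
    ultimately show ?thesis unfolding a_def by linarith
  qed
  moreover have "summable (\<lambda>k. fact (length l) * (4 ^ k * d k) + (1/4) ^ k)"
    using s by (intro summable_add summable_mult summable_geometric) (auto simp: d_def)
  ultimately have "summable (\<lambda>k. X (Suc k) l - X k l)"
    by (intro summable_comparison_test[of "\<lambda>k. X (Suc k) l - X k l"]) auto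
  then have "convergent (\<lambda>n. \<Sum>k<n. X (Suc k) l - X k l)"
    by (simp add: summable_iff_convergent)
  then have "convergent (\<lambda>n. X n l - X 0 l)" 
    using sum_lessThan_telescope[of "\<lambda>n. X n l"] by simp
  then have "convergent (\<lambda>n. (X n l - X 0 l) + X 0 l)" by (intro convergent_add convergent_const)
  then show "convergent (\<lambda>k. X k l)" by simp
qed

text \<open>The argument of Riesz and Fischer. A subsequence \<open>Y\<close> with increments of norm below
  \<open>(1/4) ^ k\<close> has \<open>\<integral> \<Sum>k. 4 ^ k |Y (k+1) - Y k|\<^sup>2 < \<infinity>\<close>, so it converges pointwise outside a
  null set, and Fatou's lemma bounds the distance to the limit.\<close>

lemma L2_complete:
  assumes X: "\<And>n. X n \<in> L2_forms \<A> g \<mu>"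
    and Cauchy: "\<And>e. e > 0 \<Longrightarrow> \<exists>N. \<forall>m\<ge>N. \<forall>n\<ge>N. L2.nrm (X m - X n) < e"
  shows "\<exists>u\<in>L2_forms \<A> g \<mu>. (\<lambda>n. L2.nrm (X n - u)) \<longlonglongrightarrow> 0"
proof -
  have Xm: "X n \<in> measurable_forms \<A>" for n using X by (simp add: L2_forms_iff)
  have "\<exists>N. \<forall>m\<ge>N. \<forall>n\<ge>N. L2.nrm (X m - X n) < (1/4) ^ k" for k
    by (rule Cauchy) simp
  then obtain N where N: "L2.nrm (X m - X n) < (1/4) ^ k" if "m \<ge> N k" "n \<ge> N k" for k m n
    by metis
  \<comment> \<open>nondecreasing, at least \<open>N k\<close>, and tending to infinity\<close>
  define r where "r k = k + (\<Sum>i\<le>k. N i)" for k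
  have r: "r k \<ge> N k" "r k \<ge> k" "r (Suc k) \<ge> r k" for k
    using member_le_sum[of k "{..k}" N] by (auto simp: r_def)
  define Y where "Y k = X (r k)" for k
  have Y: "Y k \<in> L2_forms \<A> g \<mu>" "Y k \<in> measurable_forms \<A>" for k
    using X Xm by (auto simp: Y_def)
  define d where "d k = nsq (Y (Suc k) - Y k)" for k
  have dm: "d k \<in> borel_measurable \<mu>" for k
    unfolding d_def by (intro nsq_measurable measurable_forms_diff Y)
  have d_int: "(\<integral>\<^sup>+p. ennreal (4 ^ k * d k p) \<partial>\<mu>) \<le> ennreal ((1/4) ^ k)" for k
  proof -
    have V: "Y (Suc k) - Y k \<in> L2_forms \<A> g \<mu>" by (intro L2.V_diff Y)
    have "L2.nrm (Y (Suc k) - Y k) \<le> (1/4) ^ k"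
      using N[of k "r (Suc k)" "r k"] r[of k] by (simp add: Y_def)
    then have "(L2.nrm (Y (Suc k) - Y k))\<^sup>2 \<le> ((1/4) ^ k)\<^sup>2"
      by (intro power_mono L2.nrm_nonneg V)
    then have "4 ^ k * (L2.nrm (Y (Suc k) - Y k))\<^sup>2 \<le> 4 ^ k * ((1/4) ^ k)\<^sup>2"
      by (rule mult_left_mono) simp
    also have "\<dots> = (1/4) ^ k"
      by (simp add: power2_eq_square mult.assoc[symmetric] power_mult_distrib[symmetric])
    finally have le: "4 ^ k * (L2.nrm (Y (Suc k) - Y k))\<^sup>2 \<le> (1/4) ^ k" .
    have "(\<integral>\<^sup>+p. ennreal (4 ^ k * d k p) \<partial>\<mu>) = (\<integral>\<^sup>+p. ennreal (4 ^ k) * ennreal (d k p) \<partial>\<mu>)"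
      by (simp add: ennreal_mult d_def nsq_nonneg)
    also have "\<dots> = ennreal (4 ^ k) * (\<integral>\<^sup>+p. ennreal (d k p) \<partial>\<mu>)"
      by (rule nn_integral_cmult) (intro measurable_compose[OF dm] measurable_ennreal)
    also have "\<dots> = ennreal (4 ^ k * (L2.nrm (Y (Suc k) - Y k))\<^sup>2)"
      unfolding d_def nn_integral_nsq[OF V] by (simp add: ennreal_mult)
    finally show ?thesis using le by (simp add: ennreal_leI)
  qed
  define h where "h p = (\<Sum>k. ennreal (4 ^ k * d k p))" for p
  have term_m: "(\<lambda>p. ennreal (4 ^ k * d k p)) \<in> borel_measurable \<mu>" for k
    by (intro measurable_compose[OF _ measurable_ennreal] borel_measurable_times borel_measurable_const dm)
  have hm: "h \<in> borel_measurable \<mu>"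
    unfolding h_def[abs_def] using term_m by (rule borel_measurable_suminf_order)
  have "(\<integral>\<^sup>+p. h p \<partial>\<mu>) = (\<Sum>k. \<integral>\<^sup>+p. ennreal (4 ^ k * d k p) \<partial>\<mu>)"
    unfolding h_def by (rule nn_integral_suminf[OF term_m])
  also have "\<dots> \<le> (\<Sum>k. ennreal ((1/4) ^ k))"
    by (intro suminf_le d_int) auto
  also have "\<dots> < top"
  proof -
    have "summable (\<lambda>k. (1/4) ^ k :: real)" by (rule summable_geometric) simp
    then have "(\<Sum>k. ennreal ((1/4) ^ k)) \<noteq> top" by (rule ennreal_suminf_neq_top) simp
    then show ?thesis by (simp only: less_top)
  qed
  finally have "(\<integral>\<^sup>+p. h p \<partial>\<mu>) \<noteq> \<infinity>" unfolding infinity_ennreal_def by (rule less_imp_neq)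
  then have AE: "AE p in \<mu>. h p \<noteq> \<infinity>" by (rule nn_integral_PInf_AE[OF hm])
  define A where "A = {p. h p \<noteq> \<infinity>}"
  have A: "A \<in> sets borel"
  proof -
    have "{p \<in> space \<mu>. h p \<noteq> \<infinity>} \<in> sets \<mu>"
      using hm by measurable
    then show ?thesis by (simp add: A_def space_volume sets_volume)
  qed
  \<comment> \<open>zero off \<open>A\<close>, so that \<open>u p\<close> is alternating at every point\<close>
  define u where "u p l = (if p \<in> A then lim (\<lambda>k. Y k p l) else 0)" for p l
  have lim: "(\<lambda>k. Y k p l) \<longlonglongrightarrow> u p l" if p: "p \<in> A" for p l
  proof -
    have "summable (\<lambda>k. 4 ^ k * d k p)"
      using p by (intro summable_suminf_not_top) (auto simp: A_def h_def d_def nsq_nonneg)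
    then have "convergent (\<lambda>k. Y k p l)"
      by (intro pointwise_convergent[OF measurable_formsD(1)[OF Y(2)] positive_definite_metric])
        (simp add: d_def nsq_def fun_diff_def)
    then show ?thesis using p by (simp add: u_def convergent_LIMSEQ_iff)
  qed
  have um: "u \<in> measurable_forms \<A>"
  proof -
    have "alternating (u p)" for p
    proof (cases "p \<in> A")
      case True
      show ?thesis by (rule alternating_limit[OF measurable_formsD(1)[OF Y(2)] lim[OF True]])
    next
      case False
      then have "u p = (\<lambda>l. 0)" by (intro HOL.ext) (simp add: u_def)
      then show ?thesis by (auto simp: alternating_def intro!: linearI)
    qed
    moreover have "(\<lambda>p. form_rep \<A> u c (snd c p) l) \<in> borel_measurable (restrict_space borel (fst c))"
      if c: "c \<in> \<A>" for c l
    proof (rule borel_measurable_LIMSEQ_metric)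
      fix k
      have "(indicator A :: 'm \<Rightarrow> complex) \<in> borel_measurable borel"
        using A by (intro borel_measurable_indicator) simp
      then show "(\<lambda>p. indicator A p * form_rep \<A> (Y k) c (snd c p) l) \<in> borel_measurable (restrict_space borel (fst c))"
        by (intro borel_measurable_times measurable_restrict_space1 measurable_formsD(2)[OF Y(2) c])
    next
      fix p assume "p \<in> space (restrict_space borel (fst c))"
      then have "chart_inv c (snd c p) = p"
        using chart_inv_left[OF c] by (simp add: space_restrict_space)
      then show "(\<lambda>k. indicator A p * form_rep \<A> (Y k) c (snd c p) l) \<longlonglongrightarrow> form_rep \<A> u c (snd c p) l"
        using lim by (cases "p \<in> A") (simp_all add: form_rep_def u_def)
    qed
    ultimately show ?thesis by (auto simp: measurable_forms_def)
  qed
  have bound: "(\<integral>\<^sup>+p. ennreal (nsq (X n - u) p) \<partial>\<mu>) \<le> ennreal (e\<^sup>2)"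
    if e: "e > 0" and M: "\<And>m n. m \<ge> M \<Longrightarrow> n \<ge> M \<Longrightarrow> L2.nrm (X m - X n) < e" and n: "n \<ge> M" for n M e
  proof -
    have "AE p in \<mu>. ennreal (nsq (X n - u) p) = liminf (\<lambda>k. ennreal (nsq (X n - Y k) p))"
      using AE
    proof (rule AE_mp, intro AE_I2 impI)
      fix p assume "h p \<noteq> \<infinity>"
      then have p: "p \<in> A" by (simp add: A_def)
      have "(\<lambda>k. nsq (X n - Y k) p) \<longlonglongrightarrow> nsq (X n - u) p"
        unfolding nsq_eq fun_diff_def
        by (intro tendsto_sum tendsto_divide tendsto_power tendsto_norm tendsto_diff tendsto_const lim[OF p]) simp
      then have "(\<lambda>k. ennreal (nsq (X n - Y k) p)) \<longlonglongrightarrow> ennreal (nsq (X n - u) p)"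
        by (rule tendsto_ennrealI)
      then show "ennreal (nsq (X n - u) p) = liminf (\<lambda>k. ennreal (nsq (X n - Y k) p))"
        by (intro lim_imp_Liminf[symmetric]) simp_all
    qed
    then have "(\<integral>\<^sup>+p. ennreal (nsq (X n - u) p) \<partial>\<mu>) = (\<integral>\<^sup>+p. liminf (\<lambda>k. ennreal (nsq (X n - Y k) p)) \<partial>\<mu>)"
      by (rule nn_integral_cong_AE)
    also have "\<dots> \<le> liminf (\<lambda>k. \<integral>\<^sup>+p. ennreal (nsq (X n - Y k) p) \<partial>\<mu>)"
      by (intro nn_integral_liminf measurable_compose[OF _ measurable_ennreal] nsq_measurable
          measurable_forms_diff Xm Y)
    also have "\<dots> \<le> ennreal (e\<^sup>2)"
    proof (rule Liminf_le)
      show "\<forall>\<^sub>F k in sequentially. (\<integral>\<^sup>+p. ennreal (nsq (X n - Y k) p) \<partial>\<mu>) \<le> ennreal (e\<^sup>2)"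
        using eventually_ge_at_top[of M]
      proof eventually_elim
        case (elim k)
        have V: "X n - Y k \<in> L2_forms \<A> g \<mu>" by (intro L2.V_diff X Y)
        have "L2.nrm (X n - Y k) \<le> e"
          using M[OF n, of "r k"] elim r(2)[of k] by (simp add: Y_def)
        then have "(L2.nrm (X n - Y k))\<^sup>2 \<le> e\<^sup>2" by (intro power_mono L2.nrm_nonneg V)
        then show ?case unfolding nn_integral_nsq[OF V] by (rule ennreal_leI)
      qed
    qed simp
    finally show ?thesis .
  qed
  have diff_L2: "X n - u \<in> L2_forms \<A> g \<mu>" if "(\<integral>\<^sup>+p. ennreal (nsq (X n - u) p) \<partial>\<mu>) \<le> ennreal b" for n b
  proof -
    have m: "X n - u \<in> measurable_forms \<A>" by (intro measurable_forms_diff Xm um)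
    have "integrable \<mu> (nsq (X n - u))"
      using that nsq_measurable[OF m] nsq_nonneg
      by (intro integrableI_bounded) (auto intro: le_less_trans)
    then show ?thesis using m by (simp add: L2_forms_iff)
  qed
  obtain M1 where M1: "L2.nrm (X m - X n) < 1" if "m \<ge> M1" "n \<ge> M1" for m n
    using Cauchy[of 1] by auto
  have "X M1 - u \<in> L2_forms \<A> g \<mu>"
    using diff_L2[OF bound[of 1 M1 M1]] M1 by simp
  then have "X M1 - (X M1 - u) \<in> L2_forms \<A> g \<mu>" by (rule L2.V_diff[OF X])
  then have uL2: "u \<in> L2_forms \<A> g \<mu>" by simp
  have "(\<lambda>n. L2.nrm (X n - u)) \<longlonglongrightarrow> 0"
  proof (rule LIMSEQ_I)
    fix e :: real assume e: "e > 0"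
    obtain M where M: "L2.nrm (X m - X n) < e / 2" if "m \<ge> M" "n \<ge> M" for m n
      using Cauchy[of "e / 2"] e by auto
    have "norm (L2.nrm (X n - u) - 0) < e" if n: "n \<ge> M" for n
    proof -
      have V: "X n - u \<in> L2_forms \<A> g \<mu>" by (intro L2.V_diff X uL2)
      have "ennreal ((L2.nrm (X n - u))\<^sup>2) \<le> ennreal ((e / 2)\<^sup>2)"
        using bound[of "e / 2" M n] M n e unfolding nn_integral_nsq[OF V] by simp
      then have "(L2.nrm (X n - u))\<^sup>2 \<le> (e / 2)\<^sup>2" by (simp add: ennreal_le_iff)
      then have "L2.nrm (X n - u) \<le> e / 2" by (rule power2_le_imp_le) (use e in simp)
      then show ?thesis using e L2.nrm_nonneg[OF V] by simp
    qed
    then show "\<exists>no. \<forall>n\<ge>no. norm (L2.nrm (X n - u) - 0) < e" by blast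
  qed
  then show ?thesis using uL2 by blast
qed

sublocale L2: semi_hilbert "L2_forms \<A> g \<mu>" form_scale "L2_inner g \<mu>"
  by unfold_locales (rule L2_complete)

end


section \<open>The operators on the Hilbert space of forms\<close>

lemma form_support_closed: "closed (form_support u)"
  by (simp add: form_support_def)

lemma form_support_outside: "p \<notin> form_support u \<Longrightarrow> u p l = 0"
  using closure_subset[of "{p. \<exists>l. u p l \<noteq> 0}"] by (auto simp: form_support_def)

lemma form_support_subset: "(\<And>p l. p \<notin> S \<Longrightarrow> u p l = 0) \<Longrightarrow> closed S \<Longrightarrow> form_support u \<subseteq> S"
  unfolding form_support_def by (intro closure_minimal) auto

lemma local_operatorD:
  assumes "local_operator \<A> P"
  shows "u \<in> smooth_forms \<A> \<Longrightarrow> P u \<in> smooth_forms \<A>"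
    "u \<in> smooth_forms \<A> \<Longrightarrow> form_support (P u) \<subseteq> form_support u"
    "u \<in> smooth_forms \<A> \<Longrightarrow> v \<in> smooth_forms \<A> \<Longrightarrow>
      P (\<lambda>p l. a * u p l + b * v p l) = (\<lambda>p l. a * P u p l + b * P v p l)"
  using assms unfolding local_operator_def by blast+

lemma local_operator_test_forms:
  assumes P: "local_operator \<A> P" and u: "u \<in> test_forms \<A>"
  shows "P u \<in> test_forms \<A>"
proof -
  have u': "u \<in> smooth_forms \<A>" "compact (form_support u)" using u by (auto simp: test_forms_def)
  have "compact (form_support u \<inter> form_support (P u))"
    by (rule compact_Int_closed[OF u'(2) form_support_closed])
  moreover have "form_support u \<inter> form_support (P u) = form_support (P u)"
    using local_operatorD(2)[OF P u'(1)] by blast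
  ultimately show ?thesis using local_operatorD(1)[OF P u'(1)] by (simp add: test_forms_def)
qed

lemma local_operator_compose:
  assumes P: "local_operator \<A> P" and Q: "local_operator \<A> Q"
  shows "local_operator \<A> (\<lambda>u. P (Q u))"
  unfolding local_operator_def
proof (intro conjI ballI allI)
  fix u v a b assume u: "u \<in> smooth_forms \<A>" and v: "v \<in> smooth_forms \<A>"
  show "P (Q (\<lambda>p l. a * u p l + b * v p l)) = (\<lambda>p l. a * P (Q u) p l + b * P (Q v) p l)"
    unfolding local_operatorD(3)[OF Q u v]
    by (rule local_operatorD(3)[OF P local_operatorD(1)[OF Q u] local_operatorD(1)[OF Q v]])
next
  fix u assume u: "u \<in> smooth_forms \<A>"
  note Qu = local_operatorD(1)[OF Q u]
  show "P (Q u) \<in> smooth_forms \<A>" by (rule local_operatorD(1)[OF P Qu])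
  show "form_support (P (Q u)) \<subseteq> form_support u"
    using local_operatorD(2)[OF P Qu] local_operatorD(2)[OF Q u] by blast
qed

context complex_manifold
begin

lemma local_operator_add:
  assumes P: "local_operator \<A> P" and Q: "local_operator \<A> Q"
  shows "local_operator \<A> (\<lambda>u p l. P u p l + Q u p l)"
  unfolding local_operator_def
proof (intro conjI ballI allI)
  fix u v a b assume u: "u \<in> smooth_forms \<A>" and v: "v \<in> smooth_forms \<A>"
  show "(\<lambda>p l. P (\<lambda>p l. a * u p l + b * v p l) p l + Q (\<lambda>p l. a * u p l + b * v p l) p l) =
      (\<lambda>p l. a * (P u p l + Q u p l) + b * (P v p l + Q v p l))"
    unfolding local_operatorD(3)[OF P u v] local_operatorD(3)[OF Q u v]
    by (intro HOL.ext) (simp add: algebra_simps)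
next
  fix u assume u: "u \<in> smooth_forms \<A>"
  show "(\<lambda>p l. P u p l + Q u p l) \<in> smooth_forms \<A>"
    using smooth_forms_combination[OF local_operatorD(1)[OF P u] local_operatorD(1)[OF Q u], of 1 1] by simp
  show "form_support (\<lambda>p l. P u p l + Q u p l) \<subseteq> form_support u"
  proof (rule form_support_subset[OF _ form_support_closed])
    fix p l assume "p \<notin> form_support u"
    then have "p \<notin> form_support (P u)" "p \<notin> form_support (Q u)"
      using local_operatorD(2)[OF P u] local_operatorD(2)[OF Q u] by auto
    then show "P u p l + Q u p l = 0" by (simp add: form_support_outside)
  qed
qed

lemma test_forms_combination:
  assumes u: "u \<in> test_forms \<A>" and v: "v \<in> test_forms \<A>"
  shows "(\<lambda>p l. a * u p l + b * v p l) \<in> test_forms \<A>"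
proof -
  define w where "w = (\<lambda>p l. a * u p l + b * v p l)"
  have "compact (form_support u \<union> form_support v)" using u v by (auto simp: test_forms_def)
  then have "compact ((form_support u \<union> form_support v) \<inter> form_support w)"
    by (rule compact_Int_closed) (rule form_support_closed)
  moreover have "form_support w \<subseteq> form_support u \<union> form_support v"
    by (intro form_support_subset closed_Un form_support_closed) (auto simp: w_def form_support_outside)
  ultimately have "compact (form_support w)" by (simp add: Int_absorb1)
  moreover have "w \<in> smooth_forms \<A>"
    unfolding w_def using u v by (intro smooth_forms_combination) (auto simp: test_forms_def)
  ultimately show ?thesis by (simp add: test_forms_def w_def)
qed

lemma zero_test_form: "0 \<in> test_forms \<A>"
  by (auto simp: test_forms_def smooth_forms_def form_support_def alternating_def form_rep_def zero_fun_def
      smooth_on_zero intro!: linearI)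

end

context hermitian_volume
begin

sublocale T: test_space "L2_forms \<A> g \<mu>" form_scale "L2_inner g \<mu>" "test_forms \<A>"
proof
  show "L2.subspace_of (test_forms \<A>)"
    unfolding L2.subspace_of_def
  proof (intro conjI ballI allI)
    fix u v assume "u \<in> test_forms \<A>" "v \<in> test_forms \<A>"
    from test_forms_combination[OF this, of 1 1] show "u + v \<in> test_forms \<A>"
      by (simp add: plus_fun_def)
  next
    fix c u assume "u \<in> test_forms \<A>"
    from test_forms_combination[OF this this, of c 0] show "form_scale c u \<in> test_forms \<A>"
      by (simp add: form_scale_def)
  qed (use test_forms_L2 zero_test_form in auto)
qed

lemma L2_dist_eq: "L2_dist g \<mu> u v = L2.nrm (u - v)"
  by (simp add: L2_dist_def L2.nrm_def fun_diff_def Let_def)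

lemma graph_closure_eq: "graph_closure \<A> g \<mu> = L2.gclosure"
  by (intro HOL.ext) (simp add: graph_closure_def L2.gclosure_def L2_dist_eq)

lemma graph_adjoint_eq: "graph_adjoint \<A> g \<mu> = L2.gadjoint"
  by (intro HOL.ext) (simp add: graph_adjoint_def L2.gadjoint_def)

lemma densely_defined_eq: "densely_defined \<A> g \<mu> = L2.gdense"
  by (intro HOL.ext) (simp add: densely_defined_def L2.gdense_def L2_dist_eq)

lemma restrict0_eq: "restrict0 \<A> P = T.graph0 P"
  by (simp add: restrict0_def T.graph0_def)

lemma local_operator_linear_op:
  assumes P: "local_operator \<A> P"
  shows "T.linear_op P"
  unfolding T.linear_op_def
proof (intro conjI ballI allI)
  have smooth: "test_forms \<A> \<subseteq> smooth_forms \<A>" by (auto simp: test_forms_def)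
  fix u v c assume u: "u \<in> test_forms \<A>"
  show "P u \<in> test_forms \<A>" by (rule local_operator_test_forms[OF P u])
  show "P (form_scale c u) = form_scale c (P u)"
    using local_operatorD(3)[OF P, of u u c 0] u smooth by (auto simp: form_scale_def)
  assume v: "v \<in> test_forms \<A>"
  show "P (u + v) = P u + P v"
    using local_operatorD(3)[OF P, of u v 1 1] u v smooth by (auto simp: plus_fun_def)
next
  have "(0 :: ('m, 'n) form) \<in> smooth_forms \<A>" using zero_test_form by (auto simp: test_forms_def)
  from local_operatorD(3)[OF P this this, of 0 0] show "P 0 = 0" by (simp add: zero_fun_def)
qed

lemma formal_adjoint_pair:
  assumes "local_operator \<A> P" "formal_adjoint \<A> g \<mu> P Q"
  shows "T.adjoint_pair P Q"
  using assms local_operator_linear_op by (auto simp: T.adjoint_pair_def formal_adjoint_def)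

lemma adjoint_pair_formal:
  assumes "T.adjoint_pair P Q" "local_operator \<A> Q"
  shows "formal_adjoint \<A> g \<mu> P Q"
  using assms by (auto simp: T.adjoint_pair_def formal_adjoint_def)

text \<open>Two formal adjoints agree almost everywhere on test forms, so they all
  define the same weak extension.\<close>

lemma weak_ext_eq:
  assumes P: "local_operator \<A> P" and Q: "formal_adjoint \<A> g \<mu> P Q"
  shows "weak_ext \<A> g \<mu> P = T.weak Q"
proof -
  have eq: "L2_inner g \<mu> u (Q' w) = L2_inner g \<mu> u (Q w)"
    if Q': "formal_adjoint \<A> g \<mu> P Q'" and u: "u \<in> L2_forms \<A> g \<mu>" and w: "w \<in> test_forms \<A>" for Q' u w
  proof -
    define y where "y = Q' w - Q w"
    have QC: "Q w \<in> test_forms \<A>" "Q' w \<in> test_forms \<A>"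
      using local_operator_test_forms[OF _ w] Q Q' by (auto simp: formal_adjoint_def)
    then have V: "Q w \<in> L2_forms \<A> g \<mu>" "Q' w \<in> L2_forms \<A> g \<mu>" using T.C_V by auto
    have y: "y \<in> test_forms \<A>"
      unfolding y_def using test_forms_combination[OF QC(2,1), of 1 "-1"] by (simp add: fun_diff_def)
    have "L2_inner g \<mu> y (Q' w) = L2_inner g \<mu> y (Q w)"
      using Q Q' y w by (simp add: formal_adjoint_def)
    then have "L2_inner g \<mu> y y = 0"
      unfolding y_def[symmetric] using L2.ip_diff_right[OF V(2,1) T.C_V[OF y]] by (simp add: y_def)
    then have "L2.nrm y = 0" by (simp add: L2.nrm_def)
    then have "L2_inner g \<mu> u y = 0" by (rule L2.ip_null[OF T.C_V[OF y] u])
    then show ?thesis using L2.ip_diff_right[OF V(2,1) u] by (simp add: y_def)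
  qed
  show ?thesis
  proof (intro equalityI subsetI; clarify)
    fix u v assume "(u, v) \<in> weak_ext \<A> g \<mu> P"
    then obtain Q' where "u \<in> L2_forms \<A> g \<mu>" "v \<in> L2_forms \<A> g \<mu>" "formal_adjoint \<A> g \<mu> P Q'"
        "\<forall>w\<in>test_forms \<A>. L2_inner g \<mu> v w = L2_inner g \<mu> u (Q' w)"
      unfolding weak_ext_def by blast
    then show "(u, v) \<in> T.weak Q" using eq by (simp add: T.weak_def)
  next
    fix u v assume "(u, v) \<in> T.weak Q"
    then show "(u, v) \<in> weak_ext \<A> g \<mu> P" using Q by (auto simp: weak_ext_def T.weak_def)
  qed
qed

end

theorem theorem7p6:
  fixes \<A> :: "('m::{t2_space, second_countable_topology}, 'n::finite) chart set"
    and g :: "('m, 'n) metric_tensor"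
    and \<mu> :: "'m measure"
    and ds dbs :: "('m, 'n) form_op"
  assumes "hermitian_manifold \<A> g"
    and "riemannian_volume \<A> g \<mu>"
    and "formal_adjoint \<A> g \<mu> (del \<A>) ds"
    and "formal_adjoint \<A> g \<mu> (delbar \<A>) dbs"
    and "essentially_self_adjoint \<A> g \<mu> (restrict0 \<A> (box_BC \<A> ds dbs)) \<or>
         essentially_self_adjoint \<A> g \<mu> (restrict0 \<A> (box_A \<A> ds dbs))"
  shows "strong_ext \<A> g \<mu> (del \<A> \<circ> delbar \<A>) = weak_ext \<A> g \<mu> (del \<A> \<circ> delbar \<A>) \<and>
         strong_ext \<A> g \<mu> (dbs \<circ> ds) = weak_ext \<A> g \<mu> (dbs \<circ> ds)"
proof -
  interpret hermitian_volume \<A> g \<mu>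
    using assms(1,2) by unfold_locales (auto simp: hermitian_manifold_def)
  define D where "D = (\<lambda>u. del \<A> (delbar \<A> u))"
  define Dt where "Dt = (\<lambda>u. dbs (ds u))"
  have loc: "local_operator \<A> (del \<A>)" "local_operator \<A> (delbar \<A>)"
    unfolding del_eq_dop delbar_eq_dop by (rule dop_local)+
  have loc': "local_operator \<A> ds" "local_operator \<A> dbs"
    using assms(3,4) by (auto simp: formal_adjoint_def)
  note loc_D = local_operator_compose[OF loc, folded D_def]
  note loc_Dt = local_operator_compose[OF loc'(2,1), folded Dt_def]
  note lin = local_operator_linear_op
  have adj: "T.adjoint_pair (del \<A>) ds" "T.adjoint_pair (delbar \<A>) dbs"
    by (rule formal_adjoint_pair[OF loc(1) assms(3)], rule formal_adjoint_pair[OF loc(2) assms(4)])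
  note C = T.linear_op_C[OF lin[OF loc(1)]] T.linear_op_C[OF lin[OF loc(2)]]
    T.linear_op_C[OF lin[OF loc'(1)]] T.linear_op_C[OF lin[OF loc'(2)]]
  have ip: "L2_inner g \<mu> (del \<A> u) w = L2_inner g \<mu> u (ds w)"
    "L2_inner g \<mu> (delbar \<A> u) w = L2_inner g \<mu> u (dbs w)"
    "L2_inner g \<mu> (ds u) w = L2_inner g \<mu> u (del \<A> w)"
    "L2_inner g \<mu> (dbs u) w = L2_inner g \<mu> u (delbar \<A> w)"
    if "u \<in> test_forms \<A>" "w \<in> test_forms \<A>" for u w
    using adj adj[THEN T.adjoint_pair_sym] that by (auto simp: T.adjoint_pair_def)
  have pair: "T.adjoint_pair D Dt"
    unfolding T.adjoint_pair_def using lin[OF loc_D] lin[OF loc_Dt]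
    by (auto simp: D_def Dt_def ip C)
  note pair' = T.adjoint_pair_sym[OF pair]
  have zero: "del \<A> 0 = 0" "delbar \<A> 0 = 0" "ds 0 = 0" "dbs 0 = 0"
    using lin[OF loc(1)] lin[OF loc(2)] lin[OF loc'(1)] lin[OF loc'(2)] by (simp_all add: T.linear_op_def)
  have smooth: "u \<in> smooth_forms \<A>" if "u \<in> test_forms \<A>" for u using that by (simp add: test_forms_def)
  have dd: "del \<A> (del \<A> u) = 0" "delbar \<A> (delbar \<A> u) = 0"
    if "u \<in> test_forms \<A>" for u
    using dop_anticommute[OF smooth[OF that], of 1 1] dop_anticommute[OF smooth[OF that], of "-1" "-1"]
    by (auto simp: del_eq_dop delbar_eq_dop fun_eq_iff)
  have anti: "del \<A> (delbar \<A> u) = - delbar \<A> (del \<A> u)" if "u \<in> test_forms \<A>" for u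
    using dop_anticommute[OF smooth[OF that], of 1 "-1"]
    by (auto simp: del_eq_dop delbar_eq_dop fun_eq_iff eq_neg_iff_add_eq_0)
  have ddd: "del \<A> (delbar \<A> (del \<A> u)) = 0" "delbar \<A> (del \<A> (delbar \<A> u)) = 0"
    if "u \<in> test_forms \<A>" for u
    using anti[OF C(1)[OF that]] anti[OF C(2)[OF that]] dd[OF that] zero by simp_all
  have main: "L2.gclosure (T.graph0 D) = T.weak Dt \<and> L2.gclosure (T.graph0 Dt) = T.weak D"
    using assms(5)
  proof
    assume esa: "essentially_self_adjoint \<A> g \<mu> (restrict0 \<A> (box_BC \<A> ds dbs))"
    define L where "L = (\<lambda>v p l. ds (del \<A> v) p l + dbs (delbar \<A> v) p l)"
    have L: "local_operator \<A> L"
      unfolding L_def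
      by (rule local_operator_add[OF local_operator_compose[OF loc'(1) loc(1)]
            local_operator_compose[OF loc'(2) loc(2)]])
    have L_eq: "L v = ds (del \<A> v) + dbs (delbar \<A> v)" for v by (simp add: L_def plus_fun_def)
    have LL: "T.adjoint_pair L L"
      unfolding T.adjoint_pair_def using lin[OF L]
      by (auto simp: L_eq L2.ip_add L2.ip_add_right T.C_V C ip)
    \<comment> \<open>\<open>D w\<close> is annihilated by both \<^const>\<open>del\<close> and \<^const>\<open>delbar\<close>\<close>
    have LD: "L (D w) = 0" if "w \<in> test_forms \<A>" for w
      using that by (simp add: L_eq D_def dd ddd C zero)
    have box: "box_BC \<A> ds dbs w = D (Dt w) + L (L w)" for w
      by (simp add: box_BC_def Let_def D_def Dt_def L_def plus_fun_def)
    have "local_operator \<A> (\<lambda>w p l. D (Dt w) p l + L (L w) p l)"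
      by (rule local_operator_add[OF local_operator_compose[OF loc_D loc_Dt] local_operator_compose[OF L L]])
    moreover have "box_BC \<A> ds dbs = (\<lambda>w p l. D (Dt w) p l + L (L w) p l)"
      by (intro HOL.ext) (simp add: box)
    ultimately have "local_operator \<A> (box_BC \<A> ds dbs)" by simp
    note B = lin[OF this]
    have sa: "L2.gdense (L2.gclosure (T.graph0 (box_BC \<A> ds dbs)))"
      "L2.gadjoint (L2.gclosure (T.graph0 (box_BC \<A> ds dbs))) = L2.gclosure (T.graph0 (box_BC \<A> ds dbs))"
      using esa by (simp_all add: essentially_self_adjoint_def self_adjoint_def graph_closure_eq
          graph_adjoint_eq densely_defined_eq restrict0_eq)
    show ?thesis
      using T.essentially_self_adjoint_imp_strong_eq_weak[OF pair' B box LL _ sa] LD by blast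
  next
    assume esa: "essentially_self_adjoint \<A> g \<mu> (restrict0 \<A> (box_A \<A> ds dbs))"
    define L where "L = (\<lambda>v p l. del \<A> (ds v) p l + delbar \<A> (dbs v) p l)"
    have L: "local_operator \<A> L"
      unfolding L_def
      by (rule local_operator_add[OF local_operator_compose[OF loc(1) loc'(1)]
            local_operator_compose[OF loc(2) loc'(2)]])
    have L_eq: "L v = del \<A> (ds v) + delbar \<A> (dbs v)" for v by (simp add: L_def plus_fun_def)
    have LL: "T.adjoint_pair L L"
      unfolding T.adjoint_pair_def using lin[OF L]
      by (auto simp: L_eq L2.ip_add L2.ip_add_right T.C_V C ip)
    \<comment> \<open>\<open>L w\<close> is a sum of images of \<^const>\<open>del\<close> and \<^const>\<open>delbar\<close>, which \<open>D\<close> annihilates\<close>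
    have DL: "D (L w) = 0" if w: "w \<in> test_forms \<A>" for w
    proof -
      have "D (L w) = D (del \<A> (ds w)) + D (delbar \<A> (dbs w))"
        unfolding L_eq using lin[OF loc_D] C w by (simp add: T.linear_op_def)
      then show ?thesis using w by (simp add: D_def dd ddd C zero)
    qed
    have box: "box_A \<A> ds dbs w = Dt (D w) + L (L w)" for w
      by (simp add: box_A_def Let_def D_def Dt_def L_def plus_fun_def)
    have "local_operator \<A> (\<lambda>w p l. Dt (D w) p l + L (L w) p l)"
      by (rule local_operator_add[OF local_operator_compose[OF loc_Dt loc_D] local_operator_compose[OF L L]])
    moreover have "box_A \<A> ds dbs = (\<lambda>w p l. Dt (D w) p l + L (L w) p l)"
      by (intro HOL.ext) (simp add: box)
    ultimately have "local_operator \<A> (box_A \<A> ds dbs)" by simp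
    note B = lin[OF this]
    have sa: "L2.gdense (L2.gclosure (T.graph0 (box_A \<A> ds dbs)))"
      "L2.gadjoint (L2.gclosure (T.graph0 (box_A \<A> ds dbs))) = L2.gclosure (T.graph0 (box_A \<A> ds dbs))"
      using esa by (simp_all add: essentially_self_adjoint_def self_adjoint_def graph_closure_eq
          graph_adjoint_eq densely_defined_eq restrict0_eq)
    show ?thesis
      using T.essentially_self_adjoint_imp_strong_eq_weak[OF pair B box LL _ sa] DL by blast
  qed
  have weak: "weak_ext \<A> g \<mu> D = T.weak Dt" "weak_ext \<A> g \<mu> Dt = T.weak D"
    by (rule weak_ext_eq[OF loc_D adjoint_pair_formal[OF pair loc_Dt]],
        rule weak_ext_eq[OF loc_Dt adjoint_pair_formal[OF pair' loc_D]])
  have "del \<A> \<circ> delbar \<A> = D" "dbs \<circ> ds = Dt" by (simp_all add: D_def Dt_def comp_def)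
  then show ?thesis
    using main weak by (simp add: strong_ext_def graph_closure_eq restrict0_eq)
qed

end
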